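(* For every $R>0$ there is a constant $\eta_0=\eta_0(R)>0$ with the following property. If $\mathscr{J}$ is a Jacobi matrix with $\mathscr{J}\in \mathrm{EC}(\eta_0)$ and $\mathscr{J}\in\mathcal{J}(R)$, then there exists a self-adjoint operator $Q_{\mathscr{J}}$ on $\ell^2(\mathbb{Z})$ such that $$\operatorname*{s-lim}_{t\to\infty}\frac1t X_{\mathscr{J}}(t)=Q_{\mathscr{J}},$$ that is, $\lim_{t\to\infty}\left\|\frac1t X_{\mathscr{J}}(t)\varphi-Q_{\mathscr{J}}\varphi\right\|=0$ for every $\varphi\in D(X)$, and $\ker(Q_{\mathscr{J}})\cap \ell^1(\mathbb{Z})=\{0\}$. In particular, $\beta^+_\varphi(p)=\beta^-_\varphi(p)=1$ for all nonzero $\varphi\in\mathcal{S}(\mathbb{Z})$ and all $p>0$.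
   Context: A Jacobi matrix is a bounded self-adjoint operator $\mathscr{J}=\mathscr{J}_{a,b}:\ell^2(\mathbb{Z})\to\ell^2(\mathbb{Z})$ given by $(\mathscr{J}\varphi)_n=a_{n-1}\varphi_{n-1}+b_n\varphi_n+a_n\varphi_{n+1}$, where $a,b\in\ell^\infty(\mathbb{Z},\mathbb{R})$ and $\inf_n a_n>0$. It is $q$-periodic ($q$ a positive integer) if $a_{n+q}=a_n$ and $b_{n+q}=b_n$ for all $n\in\mathbb{Z}$. It is limit-periodic if it is an operator-norm limit of a sequence of periodic Jacobi matrices. For $\eta>0$, a limit-periodic Jacobi matrix $\mathscr{J}$ is of exponential class $\eta$, written $\mathscr{J}\in\mathrm{EC}(\eta)$, if there exist positive integers $q_n$ ($n\ge1$) and $q_n$-periodic Jacobi matrices $\mathscr{J}_n$ such that $\lim_{n\to\infty}e^{\eta q_{n+1}}\|\mathscr{J}-\mathscr{J}_n\|=0$, and $q_n\mid q_{n+1}$ and $q_n\ne q_{n+1}$ for all $n$. For $R>0$, $\mathcal{J}(R)$ is the set of Jacobi matrices $\mathscr{J}=\mathscr{J}_{a,b}$ with $\|\mathscr{J}\|\le R$ and $\inf_n a_n\ge R^{-1}$. The position operator $X$ is the self-adjoint operator $(X\varphi)_n=n\varphi_n$ with domain $D(X)=\{\varphi\in\ell^2(\mathbb{Z}):\sum_n|n\varphi_n|^2<\infty\}$, and $X_{\mathscr{J}}(t)=e^{it\mathscr{J}}Xe^{-it\mathscr{J}}$ for $t\in\mathbb{R}$; it is known that the domain of $X_{\mathscr{J}}(t)$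 is $D(X)$ for all $t$. $\mathcal{S}(\mathbb{Z})=\{\varphi\in\ell^2(\mathbb{Z}):\sum_n|n|^p|\varphi_n|<\infty\text{ for all }p>0\}$. For $p>0$ and $\varphi\in\ell^2(\mathbb{Z})$ put $|X|^p_\varphi(t)=\sum_{n\in\mathbb{Z}}(|n|^p+1)\,|\langle\delta_n,e^{-it\mathscr{J}}\varphi\rangle|^2$, and for $\varphi\in\mathcal{S}(\mathbb{Z})$ $$\beta^+_\varphi(p)=\limsup_{t\to\infty}\frac{\log|X|^p_\varphi(t)}{p\log t},\qquad \beta^-_\varphi(p)=\liminf_{t\to\infty}\frac{\log|X|^p_\varphi(t)}{p\log t}.$$ *)

theory Defs
  imports "HOL-Analysis.Analysis"
begin

section \<open>The Hilbert space of square summable two-sided sequences\<close>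

definition square_summable :: "(int \<Rightarrow> complex) \<Rightarrow> bool" where
  "square_summable f \<longleftrightarrow> (\<lambda>n. (cmod (f n))\<^sup>2) summable_on UNIV"

lemma square_summable_0: "square_summable (\<lambda>_. 0)"
  by (simp add: square_summable_def)

lemma square_summable_cmult:
  assumes "square_summable f" shows "square_summable (\<lambda>n. c * f n)"
  using summable_on_cmult_right[OF assms[unfolded square_summable_def], of "(cmod c)\<^sup>2"]
  by (simp add: square_summable_def norm_mult power_mult_distrib)

lemma square_summable_le:
  assumes "square_summable g" "\<And>n. cmod (f n) \<le> cmod (g n)"
  shows "square_summable f"
  using assms unfolding square_summable_def
  by (auto intro!: summable_on_comparison_test[where f = "\<lambda>n. (cmod (g n))\<^sup>2"] power_mono)

lemma square_summable_bounded_mult: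
  assumes "square_summable f" "\<And>n. cmod (c n) \<le> B"
  shows "square_summable (\<lambda>n. c n * f n)"
proof (rule square_summable_le)
  show "square_summable (\<lambda>n. of_real B * f n)"
    by (rule square_summable_cmult) fact
  fix n
  have "cmod (c n) \<le> \<bar>B\<bar>" using assms(2)[of n] by linarith
  then show "cmod (c n * f n) \<le> cmod (of_real B * f n)"
    by (simp add: norm_mult mult_right_mono)
qed

lemma square_summable_add:
  assumes "square_summable f" "square_summable g"
  shows "square_summable (\<lambda>n. f n + g n)"
  unfolding square_summable_def
proof (rule summable_on_comparison_test)
  show "(\<lambda>n. 2 * (cmod (f n))\<^sup>2 + 2 * (cmod (g n))\<^sup>2) summable_on UNIV"
    using assms unfolding square_summable_def
    by (intro summable_on_add summable_on_cmult_right)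
  fix n
  have "(cmod (f n + g n))\<^sup>2 \<le> (cmod (f n) + cmod (g n))\<^sup>2"
    by (intro power_mono norm_triangle_ineq) simp
  also have "\<dots> \<le> 2 * (cmod (f n))\<^sup>2 + 2 * (cmod (g n))\<^sup>2"
    using sum_squares_bound[of "cmod (f n)" "cmod (g n)"] by (simp add: power2_sum)
  finally show "(cmod (f n + g n))\<^sup>2 \<le> 2 * (cmod (f n))\<^sup>2 + 2 * (cmod (g n))\<^sup>2" .
qed simp

lemma square_summable_shift:
  assumes "square_summable f" shows "square_summable (\<lambda>n. f (n + k))"
proof -
  have "bij_betw (\<lambda>n::int. n + k) UNIV UNIV"
    by (rule bij_betwI[where g = "\<lambda>n. n - k"]) auto
  from summable_on_reindex_bij_betw[OF this, of "\<lambda>n. (cmod (f n))\<^sup>2"] assms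
  show ?thesis by (simp add: square_summable_def)
qed

lemma square_summable_prod_abs:
  assumes "square_summable f" "square_summable g"
  shows "(\<lambda>n. norm (cnj (f n) * g n)) summable_on UNIV"
proof (rule Infinite_Sum.abs_summable_on_comparison_test')
  show "(\<lambda>n. (cmod (f n))\<^sup>2 + (cmod (g n))\<^sup>2) summable_on UNIV"
    using assms unfolding square_summable_def by (intro summable_on_add)
  fix n
  have "0 \<le> cmod (f n) * cmod (g n)" by simp
  then have "cmod (f n) * cmod (g n) \<le> (cmod (f n))\<^sup>2 + (cmod (g n))\<^sup>2"
    using sum_squares_bound[of "cmod (f n)" "cmod (g n)"] by linarith
  then show "norm (cnj (f n) * g n) \<le> (cmod (f n))\<^sup>2 + (cmod (g n))\<^sup>2"
    by (simp add: norm_mult)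
qed

lemma square_summable_prod:
  assumes "square_summable f" "square_summable g"
  shows "(\<lambda>n. cnj (f n) * g n) summable_on UNIV"
  by (rule abs_summable_summable[OF square_summable_prod_abs[OF assms]])

typedef ell2 = "{f :: int \<Rightarrow> complex. square_summable f}"
  morphisms coord Ell2
  using square_summable_0 by blast

lemma square_summable_coord [simp]: "square_summable (coord \<phi>)"
  using coord[of \<phi>] by simp

lemma coord_Ell2: "square_summable f \<Longrightarrow> coord (Ell2 f) = f"
  by (simp add: Ell2_inverse)

lemma ell2_eqI: "(\<And>n. coord \<phi> n = coord \<psi> n) \<Longrightarrow> \<phi> = \<psi>"
  by (metis coord_inject ext)

text \<open>The inner product is antilinear in the first argument. The type class \<open>real_inner\<close>
  provides the underlying real Hilbert space, with the same norm.\<close>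

definition cinner :: "ell2 \<Rightarrow> ell2 \<Rightarrow> complex" where
  "cinner \<phi> \<psi> = (\<Sum>\<^sub>\<infinity>n. cnj (coord \<phi> n) * coord \<psi> n)"

definition cscale :: "complex \<Rightarrow> ell2 \<Rightarrow> ell2" where
  "cscale c \<phi> = Ell2 (\<lambda>n. c * coord \<phi> n)"

lemma coord_cscale [simp]: "coord (cscale c \<phi>) n = c * coord \<phi> n"
  by (simp add: cscale_def coord_Ell2 square_summable_cmult)

instantiation ell2 :: real_inner
begin

definition zero_ell2 :: ell2 where "0 = Ell2 (\<lambda>_. 0)"
definition plus_ell2 :: "ell2 \<Rightarrow> ell2 \<Rightarrow> ell2" where
  "\<phi> + \<psi> = Ell2 (\<lambda>n. coord \<phi> n + coord \<psi> n)"
definition uminus_ell2 :: "ell2 \<Rightarrow> ell2" where "- \<phi> = cscale (-1) \<phi>"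
definition minus_ell2 :: "ell2 \<Rightarrow> ell2 \<Rightarrow> ell2" where "\<phi> - \<psi> = \<phi> + - (\<psi> :: ell2)"
definition scaleR_ell2 :: "real \<Rightarrow> ell2 \<Rightarrow> ell2" where "r *\<^sub>R \<phi> = cscale (of_real r) \<phi>"
definition inner_ell2 :: "ell2 \<Rightarrow> ell2 \<Rightarrow> real" where "inner \<phi> \<psi> = Re (cinner \<phi> \<psi>)"
definition norm_ell2 :: "ell2 \<Rightarrow> real" where
  "norm \<phi> = sqrt (\<Sum>\<^sub>\<infinity>n. (cmod (coord \<phi> n))\<^sup>2)"
definition sgn_ell2 :: "ell2 \<Rightarrow> ell2" where "sgn \<phi> = inverse (norm \<phi>) *\<^sub>R (\<phi> :: ell2)"
definition dist_ell2 :: "ell2 \<Rightarrow> ell2 \<Rightarrow> real" where "dist \<phi> \<psi> = norm (\<phi> - \<psi> :: ell2)"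
definition uniformity_ell2 :: "(ell2 \<times> ell2) filter" where
  "uniformity = (INF e\<in>{0<..}. principal {(x, y :: ell2). dist x y < e})"
definition open_ell2 :: "ell2 set \<Rightarrow> bool" where
  "open U \<longleftrightarrow> (\<forall>x\<in>(U :: ell2 set). eventually (\<lambda>(x', y). x' = x \<longrightarrow> y \<in> U) uniformity)"

lemma coord_zero [simp]: "coord 0 n = 0"
  by (simp add: zero_ell2_def coord_Ell2 square_summable_0)
lemma coord_add [simp]: "coord (\<phi> + \<psi>) n = coord \<phi> n + coord \<psi> n"
  by (simp add: plus_ell2_def coord_Ell2 square_summable_add)
lemma coord_uminus [simp]: "coord (- \<phi>) n = - coord \<phi> n"
  by (simp add: uminus_ell2_def)
lemma coord_diff [simp]: "coord (\<phi> - \<psi>) n = coord \<phi> n - coord \<psi> n"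
  by (simp add: minus_ell2_def)
lemma coord_scaleR [simp]: "coord (r *\<^sub>R \<phi>) n = of_real r * coord \<phi> n"
  by (simp add: scaleR_ell2_def)

lemma inner_ell2_alt: "inner \<phi> \<psi> = (\<Sum>\<^sub>\<infinity>n. Re (cnj (coord \<phi> n) * coord \<psi> n))"
  unfolding inner_ell2_def cinner_def
  by (rule infsum_Re[symmetric]) (simp add: square_summable_prod)

lemma inner_self_ell2: "inner \<phi> \<phi> = (\<Sum>\<^sub>\<infinity>n. (cmod (coord \<phi> n))\<^sup>2)"
proof -
  have "Re (cnj z * z) = (cmod z)\<^sup>2" for z
    by (simp add: cmod_power2) (simp add: power2_eq_square)
  then show ?thesis by (simp only: inner_ell2_alt)
qed

lemma summable_Re_prod: "(\<lambda>n. Re (cnj (coord \<phi> n) * coord \<psi> n)) summable_on UNIV"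
  by (intro summable_on_Re square_summable_prod square_summable_coord)

instance
proof
  fix x y z :: ell2 and a b r :: real
  show "x + y + z = x + (y + z)" "x + y = y + x" "0 + x = x" "- x + x = 0"
    "x - y = x + - y" "a *\<^sub>R (x + y) = a *\<^sub>R x + a *\<^sub>R y"
    "(a + b) *\<^sub>R x = a *\<^sub>R x + b *\<^sub>R x" "a *\<^sub>R b *\<^sub>R x = (a * b) *\<^sub>R x" "1 *\<^sub>R x = x"
    by (auto intro!: ell2_eqI simp: algebra_simps)
  show "sgn x = inverse (norm x) *\<^sub>R x" by (simp add: sgn_ell2_def)
  show "dist x y = norm (x - y)" by (simp add: dist_ell2_def)
  show "uniformity = (INF e\<in>{0<..}. principal {(x, y :: ell2). dist x y < e})"
    by (simp add: uniformity_ell2_def)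
  show "open U \<longleftrightarrow> (\<forall>x\<in>U. eventually (\<lambda>(x', y). x' = x \<longrightarrow> y \<in> U) uniformity)" for U :: "ell2 set"
    by (simp add: open_ell2_def)
  show "inner x y = inner y x"
    unfolding inner_ell2_alt by (intro infsum_cong) (simp add: mult.commute)
  show "inner (x + y) z = inner x z + inner y z"
    unfolding inner_ell2_alt infsum_add[OF summable_Re_prod summable_Re_prod, symmetric]
    by (intro infsum_cong) (simp add: algebra_simps)
  show "inner (r *\<^sub>R x) y = r * inner x y"
    unfolding inner_ell2_alt infsum_cmult_right'[symmetric]
    by (intro infsum_cong) (simp add: algebra_simps)
  show "0 \<le> inner x x"
    unfolding inner_self_ell2 by (intro infsum_nonneg) simp
  show "inner x x = 0 \<longleftrightarrow> x = 0"
  proof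
    assume *: "inner x x = 0"
    have "(cmod (coord x n))\<^sup>2 = 0" for n
      by (rule nonneg_infsum_le_0D[where A = UNIV and f = "\<lambda>n. (cmod (coord x n))\<^sup>2"])
        (use * square_summable_coord[of x] in
          \<open>auto simp: inner_self_ell2 square_summable_def\<close>)
    then show "x = 0" by (auto intro: ell2_eqI)
  next
    assume "x = 0"
    then show "inner x x = 0" by (simp add: inner_self_ell2)
  qed
  show "norm x = sqrt (inner x x)" by (simp add: norm_ell2_def inner_self_ell2)
qed

end

lemma sum_coord_le_norm:
  assumes "finite F" shows "(\<Sum>n\<in>F. (cmod (coord \<phi> n))\<^sup>2) \<le> (norm \<phi>)\<^sup>2"
proof -
  have "(\<Sum>n\<in>F. (cmod (coord \<phi> n))\<^sup>2) \<le> (\<Sum>\<^sub>\<infinity>n. (cmod (coord \<phi> n))\<^sup>2)"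
    using square_summable_coord[of \<phi>] assms
    by (intro finite_sum_le_infsum) (auto simp: square_summable_def)
  then show ?thesis
    by (simp add: norm_ell2_def infsum_nonneg)
qed

lemma norm_coord_le: "cmod (coord \<phi> n) \<le> norm \<phi>"
  using sum_coord_le_norm[of "{n}" \<phi>] by (simp add: power2_le_iff_abs_le)

lemma ell2_boundI:
  assumes "\<And>F. finite F \<Longrightarrow> (\<Sum>n\<in>F. (cmod (f n))\<^sup>2) \<le> B\<^sup>2" "0 \<le> B"
  shows "square_summable f" "norm (Ell2 f) \<le> B"
proof -
  show *: "square_summable f"
    unfolding square_summable_def
    by (rule nonneg_bdd_above_summable_on) (use assms in \<open>auto simp: bdd_above_def\<close>)
  have "(\<Sum>\<^sub>\<infinity>n. (cmod (f n))\<^sup>2) \<le> B\<^sup>2"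
    using * assms by (intro infsum_le_finite_sums) (auto simp: square_summable_def)
  then show "norm (Ell2 f) \<le> B"
    using assms(2) * by (simp add: norm_ell2_def coord_Ell2 real_le_lsqrt infsum_nonneg)
qed

lemma bounded_linear_coord: "bounded_linear (\<lambda>\<phi>. coord \<phi> n)"
  by (rule bounded_linear_intro[where K = 1])
    (auto simp: norm_coord_le scaleR_conv_of_real)

instance ell2 :: complete_space
proof
  fix X :: "nat \<Rightarrow> ell2"
  assume X: "Cauchy X"
  have "Cauchy (\<lambda>k. coord (X k) n)" for n
    by (rule bounded_linear.Cauchy[OF bounded_linear_coord X])
  then have "\<exists>l. (\<lambda>k. coord (X k) n) \<longlonglongrightarrow> l" for n
    by (simp add: Cauchy_convergent_iff convergent_def)
  then obtain l where l: "\<And>n. (\<lambda>k. coord (X k) n) \<longlonglongrightarrow> l n" by metis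
  have key: "\<exists>M. \<forall>k\<ge>M. square_summable (\<lambda>n. l n - coord (X k) n) \<and>
      norm (Ell2 (\<lambda>n. l n - coord (X k) n)) \<le> e" if "e > 0" for e
  proof -
    obtain M where M: "\<And>m k. m \<ge> M \<Longrightarrow> k \<ge> M \<Longrightarrow> norm (X m - X k) < e"
      using X \<open>e > 0\<close> by (meson CauchyD)
    have "(\<Sum>n\<in>F. (cmod (l n - coord (X k) n))\<^sup>2) \<le> e\<^sup>2" if "k \<ge> M" "finite F" for k F
    proof (rule LIMSEQ_le_const2)
      show "(\<lambda>m. \<Sum>n\<in>F. (cmod (coord (X m) n - coord (X k) n))\<^sup>2)
              \<longlonglongrightarrow> (\<Sum>n\<in>F. (cmod (l n - coord (X k) n))\<^sup>2)"
        by (intro tendsto_intros l)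
      show "\<exists>N. \<forall>m\<ge>N. (\<Sum>n\<in>F. (cmod (coord (X m) n - coord (X k) n))\<^sup>2) \<le> e\<^sup>2"
      proof (intro exI allI impI)
        fix m assume "m \<ge> M"
        have "(\<Sum>n\<in>F. (cmod (coord (X m) n - coord (X k) n))\<^sup>2) \<le> (norm (X m - X k))\<^sup>2"
          using sum_coord_le_norm[OF \<open>finite F\<close>, of "X m - X k"] by simp
        also have "\<dots> \<le> e\<^sup>2"
          using M[OF \<open>m \<ge> M\<close> \<open>k \<ge> M\<close>] by (intro power_mono) auto
        finally show "(\<Sum>n\<in>F. (cmod (coord (X m) n - coord (X k) n))\<^sup>2) \<le> e\<^sup>2" .
      qed
    qed
    then show ?thesis using ell2_boundI \<open>e > 0\<close> by (meson less_imp_le)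
  qed
  obtain M where "square_summable (\<lambda>n. l n - coord (X M) n)"
    using key[of 1] by auto
  from square_summable_add[OF this square_summable_coord[of "X M"]]
  have ls: "square_summable l" by simp
  have eq: "Ell2 l - X k = Ell2 (\<lambda>n. l n - coord (X k) n)"
    if "square_summable (\<lambda>n. l n - coord (X k) n)" for k
    by (rule ell2_eqI) (simp add: coord_Ell2 ls that)
  have "X \<longlonglongrightarrow> Ell2 l"
  proof (rule LIMSEQ_I)
    fix e :: real assume "e > 0"
    then obtain M where M: "\<And>k. k \<ge> M \<Longrightarrow> square_summable (\<lambda>n. l n - coord (X k) n) \<and>
      norm (Ell2 (\<lambda>n. l n - coord (X k) n)) \<le> e / 2"
      using key[of "e/2"] by auto
    have "norm (X k - Ell2 l) < e" if "k \<ge> M" for k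
      using M[OF that] eq[of k] \<open>e > 0\<close> by (simp add: norm_minus_commute)
    then show "\<exists>M. \<forall>k\<ge>M. norm (X k - Ell2 l) < e" by blast
  qed
  then show "convergent X" by (auto simp: convergent_def)
qed

instance ell2 :: banach ..

definition delta :: "int \<Rightarrow> ell2" where
  "delta n = Ell2 (\<lambda>m. if m = n then 1 else 0)"

definition ell1 :: "ell2 set" where
  "ell1 = {\<phi>. (\<lambda>n. cmod (coord \<phi> n)) summable_on UNIV}"


section \<open>Operators\<close>

text \<open>An operator is a function on the whole space; an unbounded operator comes with its domain,
  and its values off the domain are irrelevant. The last clause says that the graph of the
  operator equals the graph of its adjoint.\<close>

definition selfadjoint_on :: "ell2 set \<Rightarrow> (ell2 \<Rightarrow> ell2) \<Rightarrow> bool" where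
  "selfadjoint_on D A \<longleftrightarrow>
     0 \<in> D \<and> (\<forall>\<phi>\<in>D. \<forall>\<psi>\<in>D. \<phi> + \<psi> \<in> D) \<and> (\<forall>c. \<forall>\<phi>\<in>D. cscale c \<phi> \<in> D) \<and>
     closure D = UNIV \<and>
     (\<forall>\<phi>\<in>D. \<forall>\<psi>\<in>D. A (\<phi> + \<psi>) = A \<phi> + A \<psi>) \<and> (\<forall>c. \<forall>\<phi>\<in>D. A (cscale c \<phi>) = cscale c (A \<phi>)) \<and>
     (\<forall>\<phi> \<psi>. (\<forall>\<xi>\<in>D. cinner \<phi> (A \<xi>) = cinner \<psi> \<xi>) \<longleftrightarrow> \<phi> \<in> D \<and> A \<phi> = \<psi>)"

definition op_exp :: "complex \<Rightarrow> (ell2 \<Rightarrow> ell2) \<Rightarrow> ell2 \<Rightarrow> ell2" where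
  "op_exp z A \<phi> = (\<Sum>k. cscale (z ^ k / fact k) ((A ^^ k) \<phi>))"

definition position_dom :: "ell2 set" where
  "position_dom = {\<phi>. square_summable (\<lambda>n. of_int n * coord \<phi> n)}"

text \<open>Only meaningful on \<open>position_dom\<close>.\<close>

definition position :: "ell2 \<Rightarrow> ell2" where
  "position \<phi> = Ell2 (\<lambda>n. of_int n * coord \<phi> n)"

text \<open>\<open>heisenberg A t = exp(i t A) X exp(- i t A)\<close>, meaningful where \<open>exp(- i t A)\<close> takes values
  in \<open>position_dom\<close>; see \<open>op_exp_jacobi_position_dom\<close> below.\<close>

definition heisenberg :: "(ell2 \<Rightarrow> ell2) \<Rightarrow> real \<Rightarrow> ell2 \<Rightarrow> ell2" where
  "heisenberg A t \<phi> =
     op_exp (\<i> * of_real t) A (position (op_exp (- \<i> * of_real t) A \<phi>))"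


section \<open>Jacobi matrices\<close>

definition jacobi_coeffs :: "(int \<Rightarrow> real) \<Rightarrow> (int \<Rightarrow> real) \<Rightarrow> bool" where
  "jacobi_coeffs a b \<longleftrightarrow> bounded (range a) \<and> bounded (range b) \<and> (INF n. a n) > 0"

definition jacobi :: "(int \<Rightarrow> real) \<Rightarrow> (int \<Rightarrow> real) \<Rightarrow> ell2 \<Rightarrow> ell2" where
  "jacobi a b \<phi> = Ell2 (\<lambda>n. of_real (a (n - 1)) * coord \<phi> (n - 1) + of_real (b n) * coord \<phi> n
                          + of_real (a n) * coord \<phi> (n + 1))"

definition is_jacobi :: "(ell2 \<Rightarrow> ell2) \<Rightarrow> bool" where
  "is_jacobi J \<longleftrightarrow> (\<exists>a b. jacobi_coeffs a b \<and> J = jacobi a b)"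

definition periodic_jacobi :: "nat \<Rightarrow> (ell2 \<Rightarrow> ell2) \<Rightarrow> bool" where
  "periodic_jacobi q J \<longleftrightarrow> q > 0 \<and>
     (\<exists>a b. jacobi_coeffs a b \<and> J = jacobi a b \<and>
            (\<forall>n. a (n + int q) = a n \<and> b (n + int q) = b n))"

definition limit_periodic :: "(ell2 \<Rightarrow> ell2) \<Rightarrow> bool" where
  "limit_periodic J \<longleftrightarrow> is_jacobi J \<and>
     (\<exists>P. (\<forall>n::nat. \<exists>q. periodic_jacobi q (P n)) \<and>
          (\<lambda>n. onorm (\<lambda>\<phi>. J \<phi> - P n \<phi>)) \<longlonglongrightarrow> 0)"

text \<open>The sequences are indexed from 0 instead of 1.\<close>

definition EC :: "real \<Rightarrow> (ell2 \<Rightarrow> ell2) set" where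
  "EC \<eta> = {J. limit_periodic J \<and>
     (\<exists>(q :: nat \<Rightarrow> nat) P.
        (\<forall>n. periodic_jacobi (q n) (P n)) \<and>
        (\<lambda>n. exp (\<eta> * real (q (Suc n))) * onorm (\<lambda>\<phi>. J \<phi> - P n \<phi>)) \<longlonglongrightarrow> 0 \<and>
        (\<forall>n. q n dvd q (Suc n) \<and> q n \<noteq> q (Suc n)))}"

definition jacobi_class :: "real \<Rightarrow> (ell2 \<Rightarrow> ell2) set" where
  "jacobi_class R = {J. \<exists>a b. jacobi_coeffs a b \<and> J = jacobi a b \<and>
                       onorm J \<le> R \<and> (INF n. a n) \<ge> inverse R}"


section \<open>Transport exponents\<close>

definition schwartz :: "ell2 set" where
  "schwartz = {\<phi>. \<forall>p::real. p > 0 \<longrightarrow>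
                 (\<lambda>n. real_of_int \<bar>n\<bar> powr p * cmod (coord \<phi> n)) summable_on UNIV}"

text \<open>For \<open>\<phi> \<in> schwartz\<close> and a Jacobi matrix \<open>A\<close> the series converges, since
  \<open>exp(- i t A) \<phi>\<close> is again in \<open>schwartz\<close>.\<close>

definition moment :: "(ell2 \<Rightarrow> ell2) \<Rightarrow> real \<Rightarrow> ell2 \<Rightarrow> real \<Rightarrow> real" where
  "moment A p \<phi> t =
     (\<Sum>\<^sub>\<infinity>n. (real_of_int \<bar>n\<bar> powr p + 1) *
            (cmod (cinner (delta n) (op_exp (- \<i> * of_real t) A \<phi>)))\<^sup>2)"

definition beta_plus :: "(ell2 \<Rightarrow> ell2) \<Rightarrow> ell2 \<Rightarrow> real \<Rightarrow> ereal" where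
  "beta_plus A \<phi> p = Limsup at_top (\<lambda>t. ereal (ln (moment A p \<phi> t) / (p * ln t)))"

definition beta_minus :: "(ell2 \<Rightarrow> ell2) \<Rightarrow> ell2 \<Rightarrow> real \<Rightarrow> ereal" where
  "beta_minus A \<phi> p = Liminf at_top (\<lambda>t. ereal (ln (moment A p \<phi> t) / (p * ln t)))"


section \<open>Well-definedness\<close>

lemma jacobi_bounds:
  assumes "jacobi_coeffs a b"
  shows "\<exists>B\<ge>0. \<forall>n. \<bar>a n\<bar> \<le> B \<and> \<bar>b n\<bar> \<le> B"
proof -
  obtain A B where "\<And>n. \<bar>a n\<bar> \<le> A" "\<And>n. \<bar>b n\<bar> \<le> B"
    using assms unfolding jacobi_coeffs_def bounded_iff by auto
  moreover from this(1)[of 0] have "0 \<le> max A B" by linarith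
  ultimately show ?thesis
    by (intro exI[of _ "max A B"]) (simp add: le_max_iff_disj)
qed

definition weighted_shift :: "(int \<Rightarrow> real) \<Rightarrow> int \<Rightarrow> ell2 \<Rightarrow> ell2" where
  "weighted_shift c k \<phi> = Ell2 (\<lambda>n. of_real (c n) * coord \<phi> (n + k))"

lemma coord_weighted_shift:
  assumes "\<And>n. \<bar>c n\<bar> \<le> B"
  shows "coord (weighted_shift c k \<phi>) n = of_real (c n) * coord \<phi> (n + k)"
  using square_summable_bounded_mult[OF square_summable_shift[OF square_summable_coord[of \<phi>], of k],
      of "\<lambda>n. of_real (c n)" B] assms
  by (simp add: weighted_shift_def coord_Ell2)

lemma norm_weighted_shift_le:
  assumes "\<And>n. \<bar>c n\<bar> \<le> B"
  shows "norm (weighted_shift c k \<phi>) \<le> B * norm \<phi>"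
  unfolding weighted_shift_def
proof (rule ell2_boundI)
  have "B \<ge> 0" using assms[of 0] by linarith
  then show "0 \<le> B * norm \<phi>" by simp
  fix F :: "int set" assume F: "finite F"
  have "(\<Sum>n\<in>F. (cmod (of_real (c n) * coord \<phi> (n + k)))\<^sup>2)
      \<le> (\<Sum>n\<in>F. B\<^sup>2 * (cmod (coord \<phi> (n + k)))\<^sup>2)"
  proof (intro sum_mono)
    fix n
    have "(c n)\<^sup>2 \<le> B\<^sup>2"
      using power_mono[OF assms[of n], of 2] by simp
    then show "(cmod (of_real (c n) * coord \<phi> (n + k)))\<^sup>2 \<le> B\<^sup>2 * (cmod (coord \<phi> (n + k)))\<^sup>2"
      by (simp add: norm_mult power_mult_distrib mult_right_mono)
  qed
  also have "\<dots> = B\<^sup>2 * (\<Sum>n\<in>(\<lambda>n. n + k) ` F. (cmod (coord \<phi> n))\<^sup>2)"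
    by (subst sum.reindex) (auto simp: inj_on_def sum_distrib_left)
  also have "\<dots> \<le> B\<^sup>2 * (norm \<phi>)\<^sup>2"
    using F by (intro mult_left_mono sum_coord_le_norm) auto
  finally show "(\<Sum>n\<in>F. (cmod (of_real (c n) * coord \<phi> (n + k)))\<^sup>2) \<le> (B * norm \<phi>)\<^sup>2"
    by (simp add: power_mult_distrib)
qed

lemma jacobi_eq_shifts:
  assumes "jacobi_coeffs a b"
  shows "jacobi a b \<phi> = weighted_shift (\<lambda>n. a (n - 1)) (- 1) \<phi> + weighted_shift b 0 \<phi>
           + weighted_shift a 1 \<phi>"
proof -
  obtain B where "B \<ge> 0" "\<forall>n. \<bar>a n\<bar> \<le> B \<and> \<bar>b n\<bar> \<le> B"
    using jacobi_bounds[OF assms] by blast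
  then have B: "\<And>n. \<bar>a n\<bar> \<le> B" "\<And>n. \<bar>b n\<bar> \<le> B"
    by auto
  note a' = coord_weighted_shift[of "\<lambda>n. a (n - 1)" B, OF B(1)]
  note b' = coord_weighted_shift[of b B, OF B(2)]
  note c' = coord_weighted_shift[of a B, OF B(1)]
  have "(\<lambda>n. of_real (a (n - 1)) * coord \<phi> (n - 1)
      + of_real (b n) * coord \<phi> n + of_real (a n) * coord \<phi> (n + 1))
      = coord (weighted_shift (\<lambda>n. a (n - 1)) (- 1) \<phi> + weighted_shift b 0 \<phi>
          + weighted_shift a 1 \<phi>)"
    by (rule ext) (simp add: a' b' c')
  then show ?thesis
    unfolding jacobi_def by (rule trans[OF arg_cong[of _ _ Ell2] coord_inverse])
qed

lemma coord_jacobi: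
  assumes "jacobi_coeffs a b"
  shows "coord (jacobi a b \<phi>) n = of_real (a (n - 1)) * coord \<phi> (n - 1)
           + of_real (b n) * coord \<phi> n + of_real (a n) * coord \<phi> (n + 1)"
proof -
  obtain B where "B \<ge> 0" "\<forall>n. \<bar>a n\<bar> \<le> B \<and> \<bar>b n\<bar> \<le> B"
    using jacobi_bounds[OF assms] by blast
  then have B: "\<And>n. \<bar>a n\<bar> \<le> B" "\<And>n. \<bar>b n\<bar> \<le> B"
    by auto
  note a' = coord_weighted_shift[of "\<lambda>n. a (n - 1)" B, OF B(1)]
  note b' = coord_weighted_shift[of b B, OF B(2)]
  note c' = coord_weighted_shift[of a B, OF B(1)]
  show ?thesis
    by (simp add: jacobi_eq_shifts[OF assms] a' b' c')
qed

lemma bounded_linear_jacobi: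
  assumes "jacobi_coeffs a b"
  shows "bounded_linear (jacobi a b)"
proof -
  obtain B where "B \<ge> 0" "\<forall>n. \<bar>a n\<bar> \<le> B \<and> \<bar>b n\<bar> \<le> B"
    using jacobi_bounds[OF assms] by blast
  then have B: "\<And>n. \<bar>a n\<bar> \<le> B" "\<And>n. \<bar>b n\<bar> \<le> B"
    by auto
  show ?thesis
  proof (rule bounded_linear_intro[where K = "3 * B"])
    fix x
    have "norm (jacobi a b x) \<le> B * norm x + B * norm x + B * norm x"
      unfolding jacobi_eq_shifts[OF assms]
      by (intro norm_triangle_mono norm_weighted_shift_le B)
    then show "norm (jacobi a b x) \<le> norm x * (3 * B)" by (simp add: algebra_simps)
  qed (auto intro!: ell2_eqI simp: coord_jacobi[OF assms] algebra_simps)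
qed

lemma coord_delta: "coord (delta n) m = (if m = n then 1 else 0)"
proof -
  have "(\<lambda>m. (cmod (if m = n then 1 else 0))\<^sup>2) summable_on (UNIV :: int set)"
    by (rule finite_nonzero_values_imp_summable_on) simp
  then show ?thesis by (simp add: delta_def coord_Ell2 square_summable_def)
qed

lemma cinner_delta: "cinner (delta n) \<phi> = coord \<phi> n"
proof -
  have "cinner (delta n) \<phi> = (\<Sum>\<^sub>\<infinity>m\<in>{n}. coord \<phi> m)"
    unfolding cinner_def by (rule infsum_cong_neutral) (auto simp: coord_delta)
  then show ?thesis by simp
qed

lemma coord_position: "\<phi> \<in> position_dom \<Longrightarrow> coord (position \<phi>) n = of_int n * coord \<phi> n"
  by (simp add: position_def position_dom_def coord_Ell2)

lemma norm_cscale: "norm (cscale c \<phi>) = cmod c * norm \<phi>"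
  by (simp add: norm_ell2_def norm_mult power_mult_distrib infsum_cmult_right' real_sqrt_mult)

lemma summable_exp_weights:
  assumes "\<And>k. norm (v k) \<le> C * K ^ k"
  shows "summable (\<lambda>k. cscale (z ^ k / fact k) (v k))"
proof (rule summable_comparison_test')
  show "summable (\<lambda>k. C * ((cmod z * K) ^ k /\<^sub>R fact k))"
    by (intro summable_mult summable_exp_generic)
  fix k :: nat assume "k \<ge> 0"
  have "norm (cscale (z ^ k / fact k) (v k)) \<le> (cmod z ^ k / fact k) * (C * K ^ k)"
    unfolding norm_cscale norm_divide norm_power norm_fact
    by (intro mult_left_mono assms) simp
  then show "norm (cscale (z ^ k / fact k) (v k)) \<le> C * ((cmod z * K) ^ k /\<^sub>R fact k)"
    by (simp add: power_mult_distrib field_simps)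
qed

lemma summable_op_exp:
  fixes A :: "ell2 \<Rightarrow> ell2"
  assumes "bounded_linear A"
  shows "summable (\<lambda>k. cscale (z ^ k / fact k) ((A ^^ k) \<phi>))"
proof (rule summable_exp_weights[where C = "norm \<phi>" and K = "onorm A"])
  fix k show "norm ((A ^^ k) \<phi>) \<le> norm \<phi> * onorm A ^ k"
  proof (induction k)
    case (Suc k)
    have "norm (A ((A ^^ k) \<phi>)) \<le> onorm A * norm ((A ^^ k) \<phi>)" by (rule onorm[OF assms])
    also have "\<dots> \<le> onorm A * (norm \<phi> * onorm A ^ k)"
      using Suc onorm_pos_le[OF assms] by (intro mult_left_mono)
    finally show ?case by (simp add: algebra_simps)
  qed simp
qed

text \<open>Boundedness of the commutator of \<open>X\<close> and \<open>J\<close>, in graph norm form.\<close>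

lemma position_jacobi:
  assumes "jacobi_coeffs a b"
  shows "\<exists>K\<ge>1. \<forall>\<phi>\<in>position_dom. jacobi a b \<phi> \<in> position_dom \<and>
     norm (jacobi a b \<phi>) + norm (position (jacobi a b \<phi>)) \<le> K * (norm \<phi> + norm (position \<phi>))"
proof -
  obtain B where "B \<ge> 0" "\<forall>n. \<bar>a n\<bar> \<le> B \<and> \<bar>b n\<bar> \<le> B"
    using jacobi_bounds[OF assms] by blast
  then have B: "B \<ge> 0" "\<And>n. \<bar>a n\<bar> \<le> B" "\<And>n. \<bar>b n\<bar> \<le> B"
    by auto
  let ?J = "jacobi a b"
  have main: "?J \<phi> \<in> position_dom \<and>
     norm (?J \<phi>) + norm (position (?J \<phi>)) \<le> (1 + 2 * B + onorm ?J) * (norm \<phi> + norm (position \<phi>))"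
    if \<phi>: "\<phi> \<in> position_dom" for \<phi>
  proof -
    define \<psi> where "\<psi> = ?J (position \<phi>) + weighted_shift (\<lambda>n. a (n - 1)) (- 1) \<phi>
      + weighted_shift (\<lambda>n. - a n) 1 \<phi>"
    have c: "coord \<psi> n = of_int n * coord (?J \<phi>) n" for n
      using B by (simp add: \<psi>_def coord_jacobi[OF assms] coord_position[OF \<phi>]
          coord_weighted_shift[where B = B] algebra_simps)
    then have c': "coord \<psi> = (\<lambda>n. of_int n * coord (?J \<phi>) n)" by auto
    then have dom: "?J \<phi> \<in> position_dom"
      unfolding position_dom_def using square_summable_coord[of \<psi>] by simp
    have "norm (position (?J \<phi>)) = norm \<psi>"
      unfolding position_def c'[symmetric] by (simp add: coord_inverse)
    moreover have "norm \<psi> \<le> onorm ?J * norm (position \<phi>) + B * norm \<phi> + B * norm \<phi>"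
      unfolding \<psi>_def using B
      by (intro norm_triangle_mono norm_weighted_shift_le onorm bounded_linear_jacobi assms) auto
    moreover have "norm (?J \<phi>) \<le> onorm ?J * norm \<phi>"
      by (intro onorm bounded_linear_jacobi assms)
    moreover have "0 \<le> B * norm (position \<phi>)" using B by simp
    moreover have "(1 + 2 * B + onorm ?J) * (norm \<phi> + norm (position \<phi>))
        = norm \<phi> + norm (position \<phi>) + 2 * (B * norm \<phi>) + 2 * (B * norm (position \<phi>))
          + onorm ?J * norm \<phi> + onorm ?J * norm (position \<phi>)"
      by (simp add: algebra_simps)
    ultimately have "norm (?J \<phi>) + norm (position (?J \<phi>))
        \<le> (1 + 2 * B + onorm ?J) * (norm \<phi> + norm (position \<phi>))"
      using norm_ge_zero[of \<phi>] norm_ge_zero[of "position \<phi>"] by linarith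
    with dom show ?thesis ..
  qed
  have "0 \<le> onorm ?J" by (intro onorm_pos_le bounded_linear_jacobi assms)
  then show ?thesis using main B(1) by (intro exI[of _ "1 + 2 * B + onorm ?J"]) auto
qed

lemma op_exp_jacobi_position_dom:
  assumes J: "jacobi_coeffs a b" and \<phi>: "\<phi> \<in> position_dom"
  shows "op_exp z (jacobi a b) \<phi> \<in> position_dom"
proof -
  let ?J = "jacobi a b"
  obtain K where K: "K \<ge> 1" "\<And>\<phi>. \<phi> \<in> position_dom \<Longrightarrow> ?J \<phi> \<in> position_dom \<and>
     norm (?J \<phi>) + norm (position (?J \<phi>)) \<le> K * (norm \<phi> + norm (position \<phi>))"
    using position_jacobi[OF J] by meson
  have pow: "(?J ^^ k) \<phi> \<in> position_dom \<and>
      norm ((?J ^^ k) \<phi>) + norm (position ((?J ^^ k) \<phi>)) \<le> (norm \<phi> + norm (position \<phi>)) * K ^ k" for k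
  proof (induction k)
    case (Suc k)
    have "norm (?J ((?J ^^ k) \<phi>)) + norm (position (?J ((?J ^^ k) \<phi>)))
        \<le> K * (norm ((?J ^^ k) \<phi>) + norm (position ((?J ^^ k) \<phi>)))"
      using K(2) Suc by blast
    also have "\<dots> \<le> K * ((norm \<phi> + norm (position \<phi>)) * K ^ k)"
      using Suc K(1) by (intro mult_left_mono) auto
    finally show ?case using K(2) Suc by (simp add: algebra_simps)
  qed (use \<phi> in simp)
  have "norm (position ((?J ^^ k) \<phi>)) \<le> (norm \<phi> + norm (position \<phi>)) * K ^ k" for k
    using pow[of k] norm_ge_zero[of "(?J ^^ k) \<phi>"] by linarith
  note sX = summable_exp_weights[of "\<lambda>k. position ((?J ^^ k) \<phi>)", OF this, of z]
  note s = summable_op_exp[OF bounded_linear_jacobi[OF J], of z \<phi>]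
  define \<psi> where "\<psi> = (\<Sum>k. cscale (z ^ k / fact k) (position ((?J ^^ k) \<phi>)))"
  have "coord \<psi> n = of_int n * coord (op_exp z ?J \<phi>) n" for n
  proof -
    have "coord \<psi> n = (\<Sum>k. of_int n * coord (cscale (z ^ k / fact k) ((?J ^^ k) \<phi>)) n)"
      unfolding \<psi>_def bounded_linear.suminf[OF bounded_linear_coord sX]
      by (intro suminf_cong) (use pow in \<open>simp add: coord_position\<close>)
    also have "\<dots> = of_int n * coord (op_exp z ?J \<phi>) n"
      unfolding op_exp_def bounded_linear.suminf[OF bounded_linear_coord s]
      by (intro suminf_mult bounded_linear.summable[OF bounded_linear_coord s])
    finally show ?thesis .
  qed
  then have "coord \<psi> = (\<lambda>n. of_int n * coord (op_exp z ?J \<phi>) n)" by auto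
  then show ?thesis
    unfolding position_dom_def using square_summable_coord[of \<psi>] by simp
qed

end

theory Submission
  imports Defs "HOL-Computational_Algebra.Polynomial"
begin

text \<open>With \<open>K = \<i> J\<close> and \<open>D = [K, X]\<close>, the position at time \<open>t\<close> is \<open>X\<close> plus the integral of
  \<open>exp (s K) D exp (- s K)\<close> over \<open>[0, t]\<close>, so the theorem concerns the means \<open>N t\<close> of the evolved
  \<open>D\<close>. For a matrix \<open>P\<close> of period \<open>q\<close> with discriminant \<open>r\<close> one has \<open>r (P) = S\<^sup>q + S\<^sup>-\<^sup>q\<close>, where \<open>S\<close> is
  the shift. Commuting with \<open>X\<close> and averaging gives \<open>r' (P) N t = B + O (C\<^sup>q / t)\<close> with
  \<open>B = \<i> q (S\<^sup>q - S\<^sup>-\<^sup>q)\<close>. Since \<open>N t\<close> is bounded by the norm of \<open>D\<close>, this identity also bounds \<open>B\<close> by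
  \<open>r' (P)\<close>; hence \<open>B (N t - N s)\<close> is small, and averaging over shifts shows that \<open>N t - N s\<close> is
  small on \<open>\<ell>\<^sup>1\<close> once \<open>s\<close> and \<open>t\<close> exceed a power of \<open>C\<^sup>q\<close>. The same identity bounds \<open>N t \<phi>\<close> from below
  by \<open>C\<^sup>-\<^sup>q\<close> times the norm of \<open>S\<^sup>2\<^sup>q \<phi> - \<phi>\<close>, which stays away from 0 as \<open>q\<close> grows. For a limit-periodic
  matrix of large exponential class the approximants control consecutive time scales, with errors
  of smaller order than this lower bound. The transport exponents follow by
  interpolating moments between the resulting lower bound on the second moment and the
  ballistic upper bounds.\<close>

text \<open>Two divisions must be avoided. \<open>r' (P)\<close> can be nearly singular, since
  nothing keeps the zeros of \<open>r'\<close> away from the spectrum; so it is cancelled only up to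
  \<open>B\<close>. But \<open>B\<close> has no bounded inverse either, because
  \<open>S\<^sup>2\<^sup>q - 1\<close> has none. Averaging over shifts makes up for this on single
  basis vectors, hence on l1; only there is a rate obtained, and the rest of l2 is reached by
  density. The constants: averaging over \<open>L\<close> shifts, from time \<open>T\<close> on,
  leaves an error of order \<open>L * C^q / T + 1 / sqrt L\<close>. To stay below the lower bound
  \<open>C^(-q)\<close>, both terms are made \<open>C^(-2q)\<close>, which leads to
  \<open>L = C^(4q)\<close> and \<open>T = C^(7q)\<close>. The approximant of period
  \<open>q\<close> has to serve until the one of the next period \<open>q'\<close> takes over at
  \<open>C^(7q')\<close>. Perturbing the matrix costs a factor linear in time, so the distance
  \<open>C^(-14q')\<close> suffices. This gives \<open>\<eta>\<^sub>0 = 14 * ln C\<close> and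
  explains \<open>q (Suc n)\<close> in \<open>EC\<close>. The algebra is real: multiplication by i
  is an element of it, and complex linearity means commuting with that element. The unbounded
  \<open>X\<close> enters the algebra only through its resolvent.\<close>

section \<open>The Banach algebra of bounded operators\<close>

text \<open>Endomorphisms get a type of their own so that composition becomes a multiplication, and
  \<open>exp\<close>, powers and vector-valued integrals are those of a Banach algebra.\<close>

typedef (overloaded) 'a bop = "UNIV :: ('a::real_normed_vector \<Rightarrow>\<^sub>L 'a) set"
  morphisms blinfun_of_bop Bop
  by simp

definition app :: "'a::real_normed_vector bop \<Rightarrow> 'a \<Rightarrow> 'a" where
  "app T = blinfun_apply (blinfun_of_bop T)"

definition bop :: "('a::real_normed_vector \<Rightarrow> 'a) \<Rightarrow> 'a bop" where
  "bop f = Bop (Blinfun f)"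

lemma app_bop: "bounded_linear f \<Longrightarrow> app (bop f) = f"
  by (simp add: app_def bop_def Bop_inverse bounded_linear_Blinfun_apply)

lemma bop_eqI: "(\<And>x. app S x = app T x) \<Longrightarrow> S = T"
  by (metis app_def blinfun_eqI blinfun_of_bop_inject)

lemma bounded_linear_app: "bounded_linear (app T)"
  by (simp add: app_def blinfun.bounded_linear_right)

instantiation bop :: (real_normed_vector) real_normed_vector
begin

definition "0 = Bop (0 :: 'a \<Rightarrow>\<^sub>L 'a)"
definition "S + T = Bop (blinfun_of_bop S + blinfun_of_bop T :: 'a \<Rightarrow>\<^sub>L 'a)"
definition "S - T = Bop (blinfun_of_bop S - blinfun_of_bop T :: 'a \<Rightarrow>\<^sub>L 'a)"
definition "- T = Bop (- blinfun_of_bop T :: 'a \<Rightarrow>\<^sub>L 'a)"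
definition "r *\<^sub>R T = Bop (r *\<^sub>R blinfun_of_bop T :: 'a \<Rightarrow>\<^sub>L 'a)"
definition "norm T = norm (blinfun_of_bop T :: 'a \<Rightarrow>\<^sub>L 'a)"
definition "sgn T = inverse (norm T) *\<^sub>R (T :: 'a bop)"
definition "dist S T = norm (S - T :: 'a bop)"
definition [code del]:
  "uniformity = (INF e\<in>{0<..}. principal {(x, y :: 'a bop). dist x y < e})"
definition [code del]:
  "open U \<longleftrightarrow> (\<forall>x\<in>(U :: 'a bop set). eventually (\<lambda>(x', y). x' = x \<longrightarrow> y \<in> U) uniformity)"

instance
  by standard
    (auto simp: zero_bop_def plus_bop_def minus_bop_def uminus_bop_def scaleR_bop_def norm_bop_def
      sgn_bop_def dist_bop_def uniformity_bop_def open_bop_def Bop_inverse algebra_simps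
      blinfun_of_bop_inject[symmetric] norm_triangle_ineq)

end

lemma app_zero [simp]: "app 0 x = 0"
  and app_add [simp]: "app (S + T) x = app S x + app T x"
  and app_diff [simp]: "app (S - T) x = app S x - app T x"
  and app_uminus [simp]: "app (- T) x = - app T x"
  and app_scaleR [simp]: "app (r *\<^sub>R T) x = r *\<^sub>R app T x"
  by (simp_all add: app_def zero_bop_def plus_bop_def minus_bop_def uminus_bop_def scaleR_bop_def
      Bop_inverse blinfun.bilinear_simps)

lemma norm_app_le: "norm (app T x) \<le> norm T * norm x"
  by (simp add: app_def norm_bop_def norm_blinfun)

lemma norm_bop_eq_onorm: "norm T = onorm (app T)"
  by (simp add: app_def norm_bop_def norm_blinfun.rep_eq)

lemma norm_bop_bound: "0 \<le> B \<Longrightarrow> (\<And>x. norm (app T x) \<le> B * norm x) \<Longrightarrow> norm T \<le> B"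
  by (simp add: app_def norm_bop_def norm_blinfun_bound)

interpretation app: bounded_bilinear app
  by (rule bounded_bilinear.intro)
    (auto simp: linear_simps[OF bounded_linear_app] intro!: exI[of _ 1] norm_app_le)

instance bop :: (banach) banach
proof
  fix X :: "nat \<Rightarrow> 'a bop"
  assume X: "Cauchy X"
  have "Cauchy (\<lambda>n. blinfun_of_bop (X n))"
    using X by (simp add: Cauchy_def dist_bop_def norm_bop_def minus_bop_def Bop_inverse dist_norm)
  then obtain L where "(\<lambda>n. blinfun_of_bop (X n)) \<longlonglongrightarrow> L"
    by (auto simp: Cauchy_convergent_iff convergent_def)
  then have "X \<longlonglongrightarrow> Bop L"
    by (simp add: tendsto_iff dist_bop_def norm_bop_def minus_bop_def Bop_inverse dist_norm)
  then show "convergent X" by (auto simp: convergent_def)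
qed

text \<open>\<open>perfect_space\<close> excludes the zero space, on which the identity would have
  norm 0.\<close>

instantiation bop :: ("{real_normed_vector, perfect_space}") real_normed_algebra_1
begin

definition "1 = Bop (id_blinfun :: 'a \<Rightarrow>\<^sub>L 'a)"
definition "S * T = Bop (blinfun_of_bop S o\<^sub>L blinfun_of_bop T :: 'a \<Rightarrow>\<^sub>L 'a)"

lemma app_one [simp]: "app 1 x = x"
  and app_mult [simp]: "app (S * T) x = app S (app T x)"
  by (simp_all add: app_def one_bop_def times_bop_def Bop_inverse)

instance
proof
  fix S T U :: "'a bop" and r :: real
  show "S * T * U = S * (T * U)" "(S + T) * U = S * U + T * U" "S * (T + U) = S * T + S * U"
    "1 * S = S" "S * 1 = S" "r *\<^sub>R S * T = r *\<^sub>R (S * T)" "S * r *\<^sub>R T = r *\<^sub>R (S * T)"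
    by (auto intro!: bop_eqI simp: app.add_right app.scaleR_right)
  show "norm (S * T) \<le> norm S * norm T"
    by (simp add: norm_bop_def times_bop_def Bop_inverse norm_blinfun_compose)
  show *: "norm (1 :: 'a bop) = 1"
    by (simp add: norm_bop_def one_bop_def Bop_inverse)
  show "(0 :: 'a bop) \<noteq> 1"
    using * by (metis norm_zero zero_neq_one)
qed

end

instance ell2 :: perfect_space
proof
  fix x :: ell2
  show "\<not> open {x}"
  proof
    assume "open {x}"
    then obtain e where "e > 0" and e: "\<And>y. dist y x < e \<Longrightarrow> y = x"
      by (auto simp: open_dist)
    have "dist (x + (e/2) *\<^sub>R sgn (delta 0)) x < e"
      using \<open>e > 0\<close> by (simp add: dist_norm norm_sgn)
    then have "(e/2) *\<^sub>R sgn (delta 0) = 0" using e by fastforce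
    then have "delta 0 = 0" using \<open>e > 0\<close> by (simp add: sgn_zero_iff)
    then show False using coord_delta[of 0 0] by simp
  qed
qed

section \<open>Evolution in a Banach algebra\<close>

lemma norm_mult3_le:
  fixes x y z :: "'b::real_normed_algebra"
  assumes "norm x \<le> a" "norm y \<le> b" "norm z \<le> c"
  shows "norm (x * y * z) \<le> a * b * c"
proof -
  have nn: "0 \<le> a" "0 \<le> b" "0 \<le> c"
    using assms norm_ge_zero order_trans by blast+
  have "norm (x * y * z) \<le> norm (x * y) * norm z" by (rule norm_mult_ineq)
  also have "\<dots> \<le> norm x * norm y * norm z"
    by (intro mult_right_mono norm_mult_ineq) simp
  also have "\<dots> \<le> a * b * c"
    using nn by (intro mult_mono assms) auto
  finally show ?thesis .
qed

lemma exp_scaleR_commute: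
  fixes K :: "'b::{real_normed_algebra_1,banach}"
  shows "K * exp (t *\<^sub>R K) = exp (t *\<^sub>R K) * K"
  using exp_times_scaleR_commute[of t K] by simp

text \<open>Two generators are allowed because the resolvent of \<open>X\<close> carries the group
  of \<open>K\<close> to the group of a different operator.\<close>

lemma exp_intertwine:
  fixes S T :: "'b::{real_normed_algebra_1,banach}"
  assumes "S * R = R * T" shows "exp S * R = R * exp T"
proof -
  have pow: "S ^ n * R = R * T ^ n" for n
    by (induction n) (simp_all add: assms mult.assoc, metis assms mult.assoc)
  have "exp S * R = (\<Sum>n. S ^ n /\<^sub>R fact n * R)"
    unfolding exp_def
    by (rule suminf_mult2[OF summable_exp_generic])
  also have "\<dots> = (\<Sum>n. R * (T ^ n /\<^sub>R fact n))"
    by (simp add: pow)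
  also have "\<dots> = R * exp T"
    unfolding exp_def by (rule suminf_mult[OF summable_exp_generic])
  finally show ?thesis .
qed

lemma exp_scaleR_intertwine:
  fixes S T :: "'b::{real_normed_algebra_1,banach}"
  assumes "S * R = R * T" shows "exp (t *\<^sub>R S) * R = R * exp (t *\<^sub>R T)"
  by (rule exp_intertwine) (simp add: assms)

lemma exp_scaleR_inverse [simp]:
  fixes K :: "'b::{real_normed_algebra_1,banach}"
  shows "exp (- (t *\<^sub>R K)) * exp (t *\<^sub>R K) = 1" "exp (t *\<^sub>R K) * exp (- (t *\<^sub>R K)) = 1"
  using exp_minus_inverse[of "t *\<^sub>R K"] exp_minus_inverse[of "- (t *\<^sub>R K)"] by simp_all

lemma exp_left_deriv:
  fixes K :: "'b::{real_normed_algebra_1,banach}"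
  shows "((\<lambda>t. exp (t *\<^sub>R K)) has_vector_derivative exp (t *\<^sub>R K) * K) (at t within U)"
  by (rule exp_scaleR_has_vector_derivative_right)

lemma exp_minus_deriv:
  fixes K :: "'b::{real_normed_algebra_1,banach}"
  shows "((\<lambda>t. exp (- (t *\<^sub>R K))) has_vector_derivative - (K * exp (- (t *\<^sub>R K)))) (at t within U)"
  using exp_left_deriv[of "- K" t U] exp_scaleR_commute[of "-K" t] by simp

text \<open>With \<open>K = L\<close> this is the Heisenberg equation, with \<open>D = 1\<close> it
  is Duhamel's formula; the general form serves \<open>heisenberg_eq_accumulated\<close>.\<close>

lemma conj_deriv:
  fixes K L D :: "'b::{real_normed_algebra_1,banach}"
  shows "((\<lambda>t. exp (t *\<^sub>R K) * D * exp (- (t *\<^sub>R L))) has_vector_derivative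
     exp (t *\<^sub>R K) * (K * D - D * L) * exp (- (t *\<^sub>R L))) (at t within U)"
proof -
  have "((\<lambda>t. exp (t *\<^sub>R K) * D) has_vector_derivative exp (t *\<^sub>R K) * K * D) (at t within U)"
    by (intro bounded_linear.has_vector_derivative[OF bounded_linear_mult_left] exp_left_deriv)
  from has_vector_derivative_mult[OF this exp_minus_deriv[of L t U]]
  show ?thesis by (simp add: algebra_simps)
qed

definition evolved :: "'b::{real_normed_algebra_1,banach} \<Rightarrow> 'b \<Rightarrow> real \<Rightarrow> 'b" where
  "evolved K D t = exp (t *\<^sub>R K) * D * exp (- (t *\<^sub>R K))"

definition accumulated :: "'b::{real_normed_algebra_1,banach} \<Rightarrow> 'b \<Rightarrow> real \<Rightarrow> 'b" where
  "accumulated K D t = integral {0..t} (evolved K D)"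

lemma continuous_evolved: "continuous_on U (evolved K D)"
  unfolding continuous_on_eq_continuous_within evolved_def[abs_def]
  using has_vector_derivative_continuous[OF conj_deriv] by blast

lemma has_integral_accumulated:
  "(evolved K D has_integral accumulated K D t) {0..t}"
  unfolding accumulated_def
  by (intro integrable_integral integrable_continuous_interval continuous_evolved)

lemma norm_accumulated_diff_le:
  assumes "t \<ge> 0" "\<And>s. s \<in> {0..t} \<Longrightarrow> norm (evolved K D s - evolved K' D' s) \<le> B"
  shows "norm (accumulated K D t - accumulated K' D' t) \<le> B * t"
proof -
  have i: "((\<lambda>s. evolved K D s - evolved K' D' s) has_integral
      accumulated K D t - accumulated K' D' t) {0..t}"
    by (intro has_integral_diff has_integral_accumulated)
  have "0 \<le> norm (evolved K D 0 - evolved K' D' 0)" by simp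
  also have "\<dots> \<le> B" using assms by simp
  finally show ?thesis
    using has_integral_bound[of B "\<lambda>s. evolved K D s - evolved K' D' s" _ 0 t] i assms by simp
qed

text \<open>The commutator of \<open>K\<close> with the evolved operator is a time derivative, so
  its integral telescopes and stays bounded in \<open>t\<close>. This is why time means almost
  commute with \<open>K\<close>.\<close>

lemma accumulated_commutator:
  assumes "t \<ge> 0"
  shows "K * accumulated K D t - accumulated K D t * K = evolved K D t - D"
proof -
  have "((\<lambda>s. K * evolved K D s - evolved K D s * K) has_integral
      K * accumulated K D t - accumulated K D t * K) {0..t}"
    by (intro has_integral_diff has_integral_mult_right has_integral_mult_left
        has_integral_accumulated)
  moreover have "((\<lambda>s. K * evolved K D s - evolved K D s * K) has_integral
      evolved K D t - evolved K D 0) {0..t}"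
  proof (rule fundamental_theorem_of_calculus[OF assms])
    fix s assume "s \<in> {0..t}"
    have "exp (s *\<^sub>R K) * (K * D - D * K) * exp (- (s *\<^sub>R K)) = K * evolved K D s - evolved K D s * K"
      using exp_scaleR_commute[of K s] exp_scaleR_commute[of K "-s"]
      by (simp add: evolved_def algebra_simps) (metis mult.assoc)
    then show "(evolved K D has_vector_derivative K * evolved K D s - evolved K D s * K) (at s within {0..t})"
      using conj_deriv[of K D K s "{0..t}"] by (simp add: evolved_def[abs_def])
  qed
  ultimately have "K * accumulated K D t - accumulated K D t * K = evolved K D t - evolved K D 0"
    by (rule has_integral_unique)
  then show ?thesis by (simp add: evolved_def)
qed

lemma evolved_commute:
  assumes "S * K = K * S" "S * D = D * S"
  shows "S * evolved K D t = evolved K D t * S"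
proof -
  have "S * exp (t *\<^sub>R K) = exp (t *\<^sub>R K) * S" for t
    using exp_scaleR_intertwine[of K S K t] assms by simp
  from this[of t] this[of "- t"] assms(2) show ?thesis
    by (simp add: evolved_def) (metis mult.assoc)
qed

lemma accumulated_commute:
  assumes "S * K = K * S" "S * D = D * S"
  shows "S * accumulated K D t = accumulated K D t * S"
proof (rule has_integral_unique)
  show "((\<lambda>s. S * evolved K D s) has_integral S * accumulated K D t) {0..t}"
    by (intro has_integral_mult_right has_integral_accumulated)
  show "((\<lambda>s. S * evolved K D s) has_integral accumulated K D t * S) {0..t}"
    unfolding evolved_commute[OF assms]
    by (intro has_integral_mult_left has_integral_accumulated)
qed

lemma bounded_linear_accumulated:
  assumes "bounded_linear h" "\<And>s. h (evolved K D s) = B" "t \<ge> 0"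
  shows "h (accumulated K D t) = t *\<^sub>R B"
proof -
  have "((h \<circ> evolved K D) has_integral h (accumulated K D t)) {0..t}"
    by (intro has_integral_linear has_integral_accumulated assms)
  then have "((\<lambda>_. B) has_integral h (accumulated K D t)) {0..t}"
    by (simp add: assms(2) o_def)
  moreover have "((\<lambda>_. B) has_integral t *\<^sub>R B) {0..t}"
    using has_integral_const_real[of B 0 t] assms(3) by simp
  ultimately show ?thesis by (rule has_integral_unique)
qed

text \<open>Duhamel: the derivative of \<open>exp (s *\<^sub>R K) * exp (- (s *\<^sub>R L))\<close>
  has norm at most \<open>norm (K - L)\<close>, as both groups are contractive. Hence the error
  grows linearly in time, not exponentially.\<close>

lemma norm_exp_diff_le:
  fixes K L :: "'b::{real_normed_algebra_1,banach}"
  assumes "\<And>s. norm (exp (s *\<^sub>R K)) \<le> 1" "\<And>s. norm (exp (s *\<^sub>R L)) \<le> 1" "t \<ge> 0"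
  shows "norm (exp (t *\<^sub>R K) - exp (t *\<^sub>R L)) \<le> norm (K - L) * t"
proof -
  let ?h = "\<lambda>s. exp (s *\<^sub>R K) * 1 * exp (- (s *\<^sub>R L))"
  let ?h' = "\<lambda>s. exp (s *\<^sub>R K) * (K * 1 - 1 * L) * exp (- (s *\<^sub>R L))"
  have m: "norm (exp (- (s *\<^sub>R L))) \<le> 1" for s
    using assms(2)[of "- s"] by simp
  have "(?h' has_integral ?h t - ?h 0) {0..t}"
    by (intro fundamental_theorem_of_calculus conj_deriv assms(3))
  moreover have "norm (?h' s) \<le> norm (K - L)" for s
  proof -
    show ?thesis
      using norm_mult3_le[OF assms(1) order_refl m] by simp
  qed
  ultimately have "norm (?h t - ?h 0) \<le> norm (K - L) * t"
    using has_integral_bound[of "norm (K - L)" ?h' "?h t - ?h 0" 0 t] assms(3) by simp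
  then have b: "norm (exp (t *\<^sub>R K) * exp (- (t *\<^sub>R L)) - 1) \<le> norm (K - L) * t" by simp
  have "exp (t *\<^sub>R K) - exp (t *\<^sub>R L) = (exp (t *\<^sub>R K) * exp (- (t *\<^sub>R L)) - 1) * exp (t *\<^sub>R L)"
    by (simp add: algebra_simps)
  then have "norm (exp (t *\<^sub>R K) - exp (t *\<^sub>R L))
      \<le> norm (exp (t *\<^sub>R K) * exp (- (t *\<^sub>R L)) - 1) * norm (exp (t *\<^sub>R L))"
    by (simp only: norm_mult_ineq)
  also have "\<dots> \<le> norm (K - L) * t * 1"
    using assms(3) by (intro mult_mono b assms(2)) auto
  finally show ?thesis by simp
qed

lemma norm_evolved_le:
  assumes "\<And>s. norm (exp (s *\<^sub>R K)) \<le> 1"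
  shows "norm (evolved K D t) \<le> norm D"
proof -
  have "norm (exp (- (t *\<^sub>R K))) \<le> 1"
    using assms[of "- t"] by simp
  from norm_mult3_le[OF assms order_refl this] show ?thesis
    by (simp add: evolved_def)
qed

lemma norm_accumulated_le:
  assumes "\<And>s. norm (exp (s *\<^sub>R K)) \<le> 1" "t \<ge> 0"
  shows "norm (accumulated K D t) \<le> norm D * t"
proof -
  have 0: "evolved K 0 = (\<lambda>_. 0)" by (auto simp: evolved_def)
  then have "accumulated K 0 t = 0" by (simp add: accumulated_def)
  then show ?thesis
    using norm_accumulated_diff_le[OF assms(2), of K D K 0 "norm D"] norm_evolved_le[OF assms(1), of D]
    unfolding 0 by simp
qed

lemma norm_evolved_diff_le:
  assumes K: "\<And>s. norm (exp (s *\<^sub>R K)) \<le> 1" and L: "\<And>s. norm (exp (s *\<^sub>R L)) \<le> 1" and "t \<ge> 0"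
  shows "norm (evolved K D t - evolved L E t) \<le> 2 * norm (K - L) * norm D * t + norm (D - E)"
proof -
  let ?u = "exp (t *\<^sub>R K)" and ?v = "exp (t *\<^sub>R L)" and ?u' = "exp (- (t *\<^sub>R K))" and ?v' = "exp (- (t *\<^sub>R L))"
  have n: "norm ?u' \<le> 1" "norm ?v' \<le> 1" "norm ?v \<le> 1"
    using K[of "- t"] L[of "- t"] L[of t] by simp_all
  have d: "norm (?u - ?v) \<le> norm (K - L) * t"
    by (intro norm_exp_diff_le assms)
  have d': "norm (?u' - ?v') \<le> norm (K - L) * t"
  proof -
    have "norm (exp (s *\<^sub>R - K)) \<le> 1" "norm (exp (s *\<^sub>R - L)) \<le> 1" for s
      using K[of "- s"] L[of "- s"] by simp_all
    from norm_exp_diff_le[OF this assms(3)] show ?thesis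
      by (simp add: norm_minus_commute)
  qed
  have "evolved K D t - evolved L E t
      = (?u - ?v) * D * ?u' + ?v * D * (?u' - ?v') + ?v * (D - E) * ?v'"
    by (simp add: evolved_def algebra_simps)
  moreover have "norm ((?u - ?v) * D * ?u') \<le> norm (K - L) * t * norm D * 1"
    by (intro norm_mult3_le d n order_refl)
  moreover have "norm (?v * D * (?u' - ?v')) \<le> 1 * norm D * (norm (K - L) * t)"
    by (intro norm_mult3_le d' n order_refl)
  moreover have "norm (?v * (D - E) * ?v') \<le> 1 * norm (D - E) * 1"
    by (intro norm_mult3_le n order_refl)
  ultimately have "norm (evolved K D t - evolved L E t)
      \<le> norm (K - L) * t * norm D * 1 + 1 * norm D * (norm (K - L) * t) + 1 * norm (D - E) * 1"
    by (simp only:) (intro norm_triangle_mono)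
  then show ?thesis by (simp add: algebra_simps)
qed

section \<open>Polynomials of an operator and their derivations\<close>

definition poly_op :: "'b::real_algebra_1 \<Rightarrow> real poly \<Rightarrow> 'b" where
  "poly_op P r = fold_coeffs (\<lambda>c y. of_real c + P * y) r 0"

text \<open>\<open>poly_variation P T r\<close> is the derivative at \<open>\<epsilon> = 0\<close> of \<open>r (P + \<epsilon> T)\<close>, computed
  by Horner's scheme over the dual numbers.\<close>

definition poly_variation :: "'b::real_algebra_1 \<Rightarrow> 'b \<Rightarrow> real poly \<Rightarrow> 'b" where
  "poly_variation P T r =
     snd (fold_coeffs (\<lambda>c (y, d). (of_real c + P * y, T * y + P * d)) r (0, 0))"

text \<open>The value at \<rho> of the polynomial with the absolute values of the coefficients: a
  majorant for \<open>poly_op P r\<close> when \<open>norm P \<le> \<rho>\<close>.\<close>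

definition poly_weight :: "real \<Rightarrow> real poly \<Rightarrow> real" where
  "poly_weight \<rho> r = fold_coeffs (\<lambda>c y. \<bar>c\<bar> + \<rho> * y) r 0"

lemma commute_mult:
  fixes S :: "'b::semigroup_mult"
  shows "S * x = x * S \<Longrightarrow> S * y = y * S \<Longrightarrow> S * (x * y) = x * y * S"
  by (metis mult.assoc)

lemma poly_op_0 [simp]: "poly_op P 0 = 0"
  and poly_variation_0 [simp]: "poly_variation P T 0 = 0"
  and poly_weight_0 [simp]: "poly_weight \<rho> 0 = 0"
  by (simp_all add: poly_op_def poly_variation_def poly_weight_def)

lemma poly_op_pCons [simp]: "poly_op P (pCons c r) = of_real c + P * poly_op P r"
  by (cases "c = 0 \<and> r = 0") (auto simp: poly_op_def)

lemma poly_weight_pCons [simp]: "poly_weight \<rho> (pCons c r) = \<bar>c\<bar> + \<rho> * poly_weight \<rho> r"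
  by (cases "c = 0 \<and> r = 0") (auto simp: poly_weight_def)

lemma poly_variation_pCons [simp]:
  "poly_variation P T (pCons c r) = T * poly_op P r + P * poly_variation P T r"
proof -
  define f where "f = (\<lambda>c (y, d). (of_real c + P * y, T * y + P * d))"
  have step: "fold_coeffs f (pCons c r) (0, 0) = f c (fold_coeffs f r (0, 0))" for c r
    by (cases "c = 0 \<and> r = 0") (auto simp: f_def)
  have step': "fst (fold_coeffs f (pCons c r) (0, 0)) = of_real c + P * fst (fold_coeffs f r (0, 0))" for c r
    by (simp add: step) (simp add: f_def case_prod_beta)
  have "fst (fold_coeffs f r (0, 0)) = poly_op P r" for r
    by (induction r) (simp_all add: step')
  then show ?thesis
    unfolding poly_variation_def f_def[symmetric] step by (simp add: f_def case_prod_beta)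
qed

lemma poly_op_1 [simp]: "poly_op P 1 = 1"
  by (simp add: one_pCons)

lemma poly_op_add: "poly_op P (r + s) = poly_op P r + poly_op P s"
  by (induction r s rule: poly_induct2) (simp_all add: algebra_simps)

lemma poly_op_smult: "poly_op P (smult c r) = c *\<^sub>R poly_op P r"
  by (induction r) (simp_all add: of_real_def algebra_simps)

lemma poly_op_minus: "poly_op P (- r) = - poly_op P r"
  using poly_op_smult[of P "-1" r] by simp

lemma poly_op_diff: "poly_op P (r - s) = poly_op P r - poly_op P s"
  using poly_op_add[of P r "- s"] by (simp add: poly_op_minus)

lemma poly_op_commute:
  assumes "S * P = P * S" shows "S * poly_op P r = poly_op P r * S"
proof (induction r)
  case (pCons c r)
  have "S * (P * poly_op P r) = P * (S * poly_op P r)"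
    using assms by (metis mult.assoc)
  with pCons show ?case by (simp add: algebra_simps of_real_def)
qed simp

lemma poly_op_mult: "poly_op P (r * s) = poly_op P r * poly_op P s"
  by (induction r) (simp_all add: poly_op_add poly_op_smult algebra_simps of_real_def)

lemma poly_weight_nonneg: "0 \<le> \<rho> \<Longrightarrow> 0 \<le> poly_weight \<rho> r"
  by (induction r) auto

lemma poly_weight_mono: "0 \<le> \<rho> \<Longrightarrow> \<rho> \<le> \<sigma> \<Longrightarrow> poly_weight \<rho> r \<le> poly_weight \<sigma> r"
proof (induction r)
  case (pCons c r)
  then have "\<rho> * poly_weight \<rho> r \<le> \<sigma> * poly_weight \<sigma> r"
    by (intro mult_mono poly_weight_nonneg) auto
  then show ?case by simp
qed simp

lemma poly_weight_add_le: "0 \<le> \<rho> \<Longrightarrow> poly_weight \<rho> (r + s) \<le> poly_weight \<rho> r + poly_weight \<rho> s"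
proof (induction r s rule: poly_induct2)
  case (pCons a r b s)
  then have "\<rho> * poly_weight \<rho> (r + s) \<le> \<rho> * (poly_weight \<rho> r + poly_weight \<rho> s)"
    by (intro mult_left_mono) auto
  moreover have "\<bar>a + b\<bar> \<le> \<bar>a\<bar> + \<bar>b\<bar>" by (rule abs_triangle_ineq)
  ultimately show ?case unfolding add_pCons poly_weight_pCons distrib_left by linarith
qed simp

lemma poly_weight_smult: "poly_weight \<rho> (smult c r) = \<bar>c\<bar> * poly_weight \<rho> r"
  by (induction r) (simp_all add: abs_mult algebra_simps)

lemma norm_poly_op_le:
  fixes P :: "'b::real_normed_algebra_1"
  assumes "norm P \<le> \<rho>" shows "norm (poly_op P r) \<le> poly_weight \<rho> r"
proof (induction r)
  case (pCons c r)
  have "norm (P * poly_op P r) \<le> \<rho> * poly_weight \<rho> r"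
    by (intro order_trans[OF norm_mult_ineq] mult_mono assms pCons)
      (use assms norm_ge_zero order_trans in \<open>blast+\<close>)
  then show ?case
    using norm_triangle_ineq[of "of_real c" "P * poly_op P r"] by simp
qed simp

context
  fixes P T :: "'b::real_normed_algebra_1" and \<rho> :: real
  assumes P: "norm P \<le> \<rho>" and \<rho>: "1 \<le> \<rho>"
begin

text \<open>Evaluating weights at \<open>2 * \<rho>\<close> pays for the product rule: a Horner step
  multiplies by \<open>2 * \<rho>\<close>, which is at least \<open>1 + \<rho>\<close>. No factor
  for the degree appears in the bounds below.\<close>

lemma poly_weight_step:
  "x \<le> poly_weight (2 * \<rho>) r \<Longrightarrow> y \<le> poly_weight (2 * \<rho>) r \<Longrightarrow>
    x + \<rho> * y \<le> poly_weight (2 * \<rho>) (pCons c r)"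
proof -
  assume xy: "x \<le> poly_weight (2 * \<rho>) r" "y \<le> poly_weight (2 * \<rho>) r"
  have "\<rho> * y \<le> \<rho> * poly_weight (2 * \<rho>) r"
    using xy \<rho> by (intro mult_left_mono) auto
  moreover have "1 * poly_weight (2 * \<rho>) r \<le> \<rho> * poly_weight (2 * \<rho>) r"
    using \<rho> by (intro mult_right_mono poly_weight_nonneg) auto
  ultimately show ?thesis
    using xy(1) abs_ge_zero[of c] by simp
qed

lemma norm_poly_op_le': "norm (poly_op P r) \<le> poly_weight (2 * \<rho>) r"
  using norm_poly_op_le[OF P, of r] poly_weight_mono[of \<rho> "2 * \<rho>" r] \<rho> by linarith

lemma norm_mult_P_le: "norm x \<le> y \<Longrightarrow> norm (P * x) \<le> \<rho> * y"
  using P \<rho> by (intro order_trans[OF norm_mult_ineq] mult_mono) auto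

lemma norm_poly_op_pderiv_le: "norm (poly_op P (pderiv r)) \<le> poly_weight (2 * \<rho>) r"
proof (induction r)
  case (pCons c r)
  have "norm (poly_op P r + P * poly_op P (pderiv r))
      \<le> poly_weight (2 * \<rho>) r + \<rho> * poly_weight (2 * \<rho>) r"
    by (intro norm_triangle_mono norm_mult_P_le norm_poly_op_le' pCons)
  also have "\<dots> \<le> poly_weight (2 * \<rho>) (pCons c r)"
    by (rule poly_weight_step) auto
  finally show ?case by (simp add: pderiv_pCons poly_op_add)
qed simp

lemma norm_commutator_poly_op_le:
  "norm (T * poly_op P r - poly_op P r * T) \<le> poly_weight (2 * \<rho>) r * norm (T * P - P * T)"
proof (induction r)
  case (pCons c r)
  let ?W = "poly_weight (2 * \<rho>) r" and ?d = "norm (T * P - P * T)"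
  have "T * poly_op P (pCons c r) - poly_op P (pCons c r) * T
      = (T * P - P * T) * poly_op P r + P * (T * poly_op P r - poly_op P r * T)"
    by (simp add: algebra_simps of_real_def)
  also have "norm \<dots> \<le> ?d * ?W + \<rho> * (?W * ?d)"
    by (intro norm_triangle_mono norm_mult_P_le pCons
        order_trans[OF norm_mult_ineq] mult_left_mono norm_poly_op_le') auto
  also have "\<dots> = (?W + \<rho> * ?W) * ?d" by (simp add: algebra_simps)
  also have "\<dots> \<le> poly_weight (2 * \<rho>) (pCons c r) * ?d"
    by (intro mult_right_mono poly_weight_step) auto
  finally show ?case .
qed simp

text \<open>If \<open>T\<close> commuted with \<open>P\<close>, the variation would be
  \<open>r' (P) T\<close> exactly; each exchange of \<open>T\<close> with a factor \<open>P\<close>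
  costs one commutator. The version with \<open>T\<close> on the left is used to dominate
  \<open>B\<close> by \<open>r' (P)\<close>, this one to compare averages at two times.\<close>

lemma norm_poly_variation_left_le:
  "norm (poly_variation P T r - poly_op P (pderiv r) * T)
     \<le> poly_weight (2 * \<rho>) r * norm (T * P - P * T)"
proof (induction r)
  case (pCons c r)
  let ?W = "poly_weight (2 * \<rho>) r" and ?d = "norm (T * P - P * T)"
  have "poly_variation P T (pCons c r) - poly_op P (pderiv (pCons c r)) * T
      = (T * poly_op P r - poly_op P r * T)
        + P * (poly_variation P T r - poly_op P (pderiv r) * T)"
    by (simp add: algebra_simps pderiv_pCons poly_op_add)
  also have "norm \<dots> \<le> ?W * ?d + \<rho> * (?W * ?d)"
    by (intro norm_triangle_mono norm_mult_P_le pCons norm_commutator_poly_op_le)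
  also have "\<dots> = (?W + \<rho> * ?W) * ?d" by (simp add: algebra_simps)
  also have "\<dots> \<le> poly_weight (2 * \<rho>) (pCons c r) * ?d"
    by (intro mult_right_mono poly_weight_step) auto
  finally show ?case .
qed simp

lemma norm_poly_variation_right_le:
  "norm (poly_variation P T r - T * poly_op P (pderiv r))
     \<le> poly_weight (2 * \<rho>) r * norm (T * P - P * T)"
proof (induction r)
  case (pCons c r)
  let ?W = "poly_weight (2 * \<rho>) r" and ?d = "norm (T * P - P * T)"
  have "poly_variation P T (pCons c r) - T * poly_op P (pderiv (pCons c r))
      = (P * T - T * P) * poly_op P (pderiv r)
        + P * (poly_variation P T r - T * poly_op P (pderiv r))"
    by (simp add: algebra_simps pderiv_pCons poly_op_add)
  also have "norm \<dots> \<le> norm (P * T - T * P) * ?W + \<rho> * (?W * ?d)"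
    by (intro norm_triangle_mono norm_mult_P_le pCons
        order_trans[OF norm_mult_ineq] mult_left_mono norm_poly_op_pderiv_le) auto
  also have "\<dots> = (?W + \<rho> * ?W) * ?d" by (simp add: algebra_simps norm_minus_commute)
  also have "\<dots> \<le> poly_weight (2 * \<rho>) (pCons c r) * ?d"
    by (intro mult_right_mono poly_weight_step) auto
  finally show ?case .
qed simp

end

text \<open>With \<open>E\<close> from the evolution group, the derivation along the evolved
  \<open>D\<close> is the conjugate of the one along \<open>D\<close>. It is constant in time as
  soon as its initial value commutes with the group.\<close>

lemma poly_variation_conj:
  assumes "E * P = P * E" "E' * E = 1" "E' * P = P * E'"
  shows "poly_variation P (E * T * E') r = E * poly_variation P T r * E'"
proof (induction r)
  case (pCons c r)
  have "E' * poly_op P r = poly_op P r * E'"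
    by (rule poly_op_commute) fact
  then have "E * T * E' * poly_op P r = E * (T * poly_op P r) * E'"
    by (simp add: mult.assoc)
  moreover have "P * (E * poly_variation P T r * E') = E * (P * poly_variation P T r) * E'"
    by (simp add: mult.assoc[symmetric] assms(1))
  ultimately show ?case
    by (simp add: pCons distrib_left distrib_right)
qed simp

lemma poly_variation_scale:
  assumes "S * P = P * S"
  shows "poly_variation P (S * T) r = S * poly_variation P T r"
proof (induction r)
  case (pCons c r)
  moreover have "P * (S * poly_variation P T r) = S * (P * poly_variation P T r)"
    using assms by (metis mult.assoc)
  ultimately show ?case by (simp add: distrib_left mult.assoc)
qed simp

lemma bounded_linear_poly_variation:
  fixes P :: "'b::real_normed_algebra_1"
  shows "bounded_linear (\<lambda>T. poly_variation P T r)"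
proof (induction r)
  case (pCons c r)
  then show ?case
    by (auto intro!: bounded_linear_add bounded_linear_mult_left
        bounded_linear_compose[OF bounded_linear_mult_right, of _ P])
qed simp

text \<open>When \<open>R = (X + \<i>)\<^bsup>-1\<^esup>\<close>, the relation \<open>has_commutator R T T'\<close> says that
  \<open>T' = T X - X T\<close>; in terms of the resolvent it involves bounded operators only.\<close>

definition has_commutator :: "'b::ring_1 \<Rightarrow> 'b \<Rightarrow> 'b \<Rightarrow> bool" where
  "has_commutator R T T' \<longleftrightarrow> R * T - T * R = R * T' * R"

text \<open>The Leibniz rule for the commutator with \<open>X\<close>. Moving \<open>R\<close> past
  \<open>S\<close> and past \<open>T\<close> produces two terms \<open>R * S' * R * T' * R\<close>
  of opposite sign, which cancel.\<close>

lemma has_commutator_mult: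
  assumes "has_commutator R S S'" "has_commutator R T T'"
  shows "has_commutator R (S * T) (S' * T + S * T')"
proof -
  have S: "S * R = R * S - R * S' * R" and T: "R * T = T * R + R * T' * R"
    using assms by (simp_all add: has_commutator_def algebra_simps)
  have "(R * S - S * R) * T = R * S' * (R * T)" "S * (R * T - T * R) = (S * R) * T' * R"
    using assms by (simp_all add: has_commutator_def mult.assoc)
  then have "R * S * T - S * T * R = R * S' * (R * T) + (S * R) * T' * R"
    by (simp add: algebra_simps)
  also have "\<dots> = R * (S' * T + S * T') * R"
    unfolding S T by (simp add: algebra_simps)
  finally show ?thesis by (simp add: has_commutator_def algebra_simps)
qed

lemma has_commutator_add:
  "has_commutator R S S' \<Longrightarrow> has_commutator R T T' \<Longrightarrow> has_commutator R (S + T) (S' + T')"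
  by (simp add: has_commutator_def algebra_simps)

text \<open>The commutator with \<open>X\<close> is a derivation, so on \<open>r (P)\<close> it is
  determined by its value \<open>C\<close> on \<open>P\<close>.\<close>

lemma has_commutator_poly_op:
  fixes R :: "'b::real_algebra_1"
  assumes "has_commutator R P C"
  shows "has_commutator R (poly_op P r) (poly_variation P C r)"
proof (induction r)
  case (pCons c r)
  have "has_commutator R (of_real c) 0"
    by (simp add: has_commutator_def of_real_def)
  from has_commutator_add[OF this has_commutator_mult[OF assms pCons(2)]] show ?case
    by simp
qed (simp add: has_commutator_def)

section \<open>Averages over the evolution of a periodic operator\<close>

text \<open>Since the derivation along \<open>D\<close> of \<open>r (P)\<close> is a constant of motion \<open>B\<close>, averaging it gives
  \<open>r' (P) N \<approx> B\<close> for the average \<open>N\<close> of the evolved \<open>D\<close>. The bound \<open>norm N \<le> norm D\<close> then shows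
  that \<open>B\<close> is dominated by \<open>norm D\<close> times \<open>r' (P)\<close>, so that \<open>r' (P)\<close> can be cancelled up to
  the factor \<open>B\<close>, with no information on the zeros of \<open>r'\<close>.\<close>

locale conserved_derivation =
  fixes I P D B :: "'b::{real_normed_algebra_1,banach}" and r :: "real poly" and \<rho> :: real
  assumes I: "I * I = - 1" "norm I = 1" "I * P = P * I" "I * D = D * I"
    and isometric: "\<And>s. norm (exp (s *\<^sub>R (I * P))) \<le> 1"
    and norm_P: "norm P \<le> \<rho>" and \<rho>: "1 \<le> \<rho>"
    and variation: "poly_variation P D r = B"
    and B: "B * P = P * B" "B * D = D * B" "B * I = I * B"
begin

definition average :: "real \<Rightarrow> 'b" where
  "average t = (1 / t) *\<^sub>R accumulated (I * P) D t"

abbreviation "W \<equiv> poly_weight (2 * \<rho>) r"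
abbreviation "r' \<equiv> poly_op P (pderiv r)"

lemma W_nonneg: "0 \<le> W"
  using \<rho> by (intro poly_weight_nonneg) simp

lemma norm_average_le: "t > 0 \<Longrightarrow> norm (average t) \<le> norm D"
  using norm_accumulated_le[OF isometric, of t D] by (simp add: average_def field_simps)

lemma average_commute:
  "S * P = P * S \<Longrightarrow> S * I = I * S \<Longrightarrow> S * D = D * S \<Longrightarrow> S * average t = average t * S"
  using accumulated_commute[of S "I * P" D t] commute_mult[of S I P] by (simp add: average_def)

lemma norm_commutator_average_le:
  assumes "t > 0"
  shows "norm (average t * P - P * average t) \<le> 2 * norm D / t"
proof -
  \<comment> \<open>\<open>- I * I = 1\<close> trades the commutator with \<open>P\<close> for the
    one with the generator \<open>I * P\<close>, to which \<open>accumulated_commutator\<close>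
    applies.\<close>
  have "P * average t - average t * P = - I * (I * (P * average t - average t * P))"
    using I(1) by (simp add: mult.assoc[symmetric])
  also have "I * (P * average t - average t * P) = (I * P) * average t - average t * (I * P)"
  proof -
    have "I * average t = average t * I"
      by (rule average_commute) (simp_all add: I)
    then show ?thesis by (metis mult.assoc right_diff_distrib)
  qed
  also have "\<dots> = (1 / t) *\<^sub>R (evolved (I * P) D t - D)"
    using accumulated_commutator[of t "I * P" D] assms by (simp add: average_def algebra_simps flip: scaleR_diff_right)
  finally have "norm (average t * P - P * average t) \<le> norm I * norm ((1 / t) *\<^sub>R (evolved (I * P) D t - D))"
    using norm_mult_ineq[of I "(1 / t) *\<^sub>R (evolved (I * P) D t - D)"]
    by (simp add: norm_minus_commute)
  also have "\<dots> \<le> (1 / t) * (norm D + norm D)"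
    using assms norm_triangle_ineq4[of "evolved (I * P) D t" D] norm_evolved_le[OF isometric, of D t]
    by (simp add: I divide_right_mono)
  finally show ?thesis by (simp add: field_simps)
qed

lemma variation_average:
  assumes "t > 0"
  shows "poly_variation P (average t) r = B"
proof -
  let ?E = "\<lambda>t. exp (t *\<^sub>R (I * P))"
  have IP: "I * P * P = P * (I * P)" "I * P * B = B * (I * P)"
    using commute_mult[of P I P] commute_mult[of B I P] I(3) B by simp_all
  have "poly_variation P (evolved (I * P) D s) r = B" for s
  proof -
    have c: "?E s * P = P * ?E s" "?E s * B = B * ?E s" for s
      by (rule exp_scaleR_intertwine, rule IP)+
    have "poly_variation P (?E s * D * ?E (- s)) r = ?E s * poly_variation P D r * ?E (- s)"
      using exp_scaleR_inverse(1)[of s "I * P"] by (intro poly_variation_conj c) simp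
    also have "\<dots> = B * (?E s * ?E (- s))"
      using c(2)[of s] unfolding variation by (metis mult.assoc)
    finally show ?thesis by (simp add: evolved_def)
  qed
  from bounded_linear_accumulated[OF bounded_linear_poly_variation this, of t]
  have "poly_variation P (accumulated (I * P) D t) r = t *\<^sub>R B" using assms by simp
  then show ?thesis
    using assms linear_simps(5)[OF bounded_linear_poly_variation[of P r]]
    by (simp add: average_def)
qed

lemma pderiv_average_left:
  assumes "t > 0" shows "norm (r' * average t - B) \<le> 2 * W * norm D / t"
proof -
  have "norm (B - r' * average t) \<le> W * norm (average t * P - P * average t)"
    using norm_poly_variation_left_le[OF norm_P \<rho>, of "average t" r] variation_average[OF assms] by simp
  also have "\<dots> \<le> W * (2 * norm D / t)"
    by (intro mult_left_mono norm_commutator_average_le assms W_nonneg)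
  finally show ?thesis by (simp add: norm_minus_commute algebra_simps)
qed

lemma pderiv_average_right:
  assumes "t > 0" shows "norm (average t * r' - B) \<le> 2 * W * norm D / t"
proof -
  have "norm (B - average t * r') \<le> W * norm (average t * P - P * average t)"
    using norm_poly_variation_right_le[OF norm_P \<rho>, of "average t" r] variation_average[OF assms] by simp
  also have "\<dots> \<le> W * (2 * norm D / t)"
    by (intro mult_left_mono norm_commutator_average_le assms W_nonneg)
  finally show ?thesis by (simp add: norm_minus_commute algebra_simps)
qed

text \<open>Let \<open>t\<close> tend to infinity in \<open>average t * r'\<close>, which approaches
  \<open>B\<close>: the error vanishes while the averages stay bounded by \<open>norm D\<close>.
  Only their boundedness enters.\<close>

lemma norm_B_mult_le: "norm (B * S) \<le> norm D * norm (r' * S)"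
proof (rule tendsto_lowerbound)
  have "((\<lambda>t. norm D * norm (r' * S) + 2 * W * norm D / t * norm S)
      \<longlongrightarrow> norm D * norm (r' * S) + 0 * norm S) at_top"
    by (intro tendsto_intros tendsto_divide_0[OF tendsto_const] filterlim_at_top_imp_at_infinity filterlim_ident)
  then show "((\<lambda>t. norm D * norm (r' * S) + 2 * W * norm D / t * norm S)
      \<longlongrightarrow> norm D * norm (r' * S)) at_top" by simp
  show "\<forall>\<^sub>F t in at_top. norm (B * S) \<le> norm D * norm (r' * S) + 2 * W * norm D / t * norm S"
    using eventually_gt_at_top[of 0]
  proof eventually_elim
    case (elim t)
    have "B * S = average t * (r' * S) - (average t * r' - B) * S"
      by (simp add: algebra_simps)
    also have "norm \<dots> \<le> norm (average t) * norm (r' * S) + norm (average t * r' - B) * norm S"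
      by (intro norm_triangle_le_diff add_mono norm_mult_ineq)
    also have "\<dots> \<le> norm D * norm (r' * S) + 2 * W * norm D / t * norm S"
      by (intro add_mono mult_right_mono norm_average_le pderiv_average_right elim) auto
    finally show ?case .
  qed
qed simp_all

text \<open>At both times \<open>r'\<close> times the average is near \<open>B\<close>, so
  \<open>r'\<close> almost annihilates the difference; the domination of \<open>B\<close> by
  \<open>r'\<close> passes this on to \<open>B\<close>.\<close>

lemma norm_B_average_diff_le:
  assumes "T > 0" "s \<ge> T" "t \<ge> T"
  shows "norm (B * (average t - average s)) \<le> 4 * W * (norm D)\<^sup>2 / T"
proof -
  have *: "norm (r' * average t - B) \<le> 2 * W * norm D / T" if "t \<ge> T" for t
  proof -
    have "2 * W * norm D / t \<le> 2 * W * norm D / T"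
      using that assms(1) W_nonneg by (intro divide_left_mono) auto
    then show ?thesis using pderiv_average_left[of t] that assms(1) by linarith
  qed
  have "r' * (average t - average s) = (r' * average t - B) - (r' * average s - B)"
    by (simp add: algebra_simps)
  then have "norm (r' * (average t - average s)) \<le> 2 * W * norm D / T + 2 * W * norm D / T"
    using *[OF assms(2)] *[OF assms(3)] by (metis norm_triangle_le_diff add_mono)
  then have "norm (B * (average t - average s)) \<le> norm D * (2 * W * norm D / T + 2 * W * norm D / T)"
    using norm_B_mult_le[of "average t - average s"]
    by (meson mult_left_mono norm_ge_zero order_trans)
  then show ?thesis by (simp add: power2_eq_square algebra_simps)
qed

end

section \<open>Operators on \<open>\<ell>\<^sup>2(\<int>)\<close>\<close>

text \<open>The imaginary unit as an element of the real operator algebra.\<close>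

definition iop :: "ell2 bop" where
  "iop = bop (cscale \<i>)"

definition wshift :: "(int \<Rightarrow> real) \<Rightarrow> int \<Rightarrow> ell2 bop" where
  "wshift c k = bop (weighted_shift c k)"

abbreviation shift :: "int \<Rightarrow> ell2 bop" where
  "shift \<equiv> wshift (\<lambda>_. 1)"

definition resolvent :: "ell2 bop" where
  "resolvent = bop (\<lambda>\<phi>. Ell2 (\<lambda>n. inverse (of_int n + \<i>) * coord \<phi> n))"

definition jac :: "(int \<Rightarrow> real) \<Rightarrow> (int \<Rightarrow> real) \<Rightarrow> ell2 bop" where
  "jac a b = bop (jacobi a b)"

text \<open>The commutator \<open>J X - X J\<close>: the part of \<open>J\<close> that shifts by
  \<open>k\<close> is multiplied by \<open>k\<close>, so the diagonal drops out.\<close>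

definition jac_comm :: "(int \<Rightarrow> real) \<Rightarrow> ell2 bop" where
  "jac_comm a = wshift a 1 - wshift (\<lambda>n. a (n - 1)) (- 1)"

lemma bounded_range_iff: "bounded (range c) \<longleftrightarrow> (\<exists>B. \<forall>n. \<bar>c n\<bar> \<le> (B::real))"
  by (auto simp: bounded_iff)

lemma bounded_linear_cscale: "bounded_linear (cscale c)"
  by (rule bounded_linear_intro[where K = "cmod c"])
    (auto intro!: ell2_eqI simp: norm_cscale algebra_simps)

lemma coord_iop [simp]: "coord (app iop \<phi>) n = \<i> * coord \<phi> n"
  by (simp add: iop_def app_bop bounded_linear_cscale)

lemma coord_wshift:
  assumes "bounded (range c)"
  shows "coord (app (wshift c k) \<phi>) n = of_real (c n) * coord \<phi> (n + k)"
proof -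
  obtain B where B: "\<And>n. \<bar>c n\<bar> \<le> B" using assms bounded_range_iff by blast
  have "bounded_linear (weighted_shift c k)"
    using norm_weighted_shift_le[of c B, OF B]
    by (intro bounded_linear_intro[where K = B])
      (auto intro!: ell2_eqI simp: coord_weighted_shift[of c B, OF B] algebra_simps)
  then show ?thesis
    by (simp add: wshift_def app_bop coord_weighted_shift[of c B, OF B])
qed

lemma coord_shift [simp]: "coord (app (shift k) \<phi>) n = coord \<phi> (n + k)"
  by (simp add: coord_wshift)

lemma norm_wshift_le:
  assumes "\<And>n. \<bar>c n\<bar> \<le> B"
  shows "norm (wshift c k) \<le> B"
proof (rule norm_bop_bound)
  show "0 \<le> B" using assms[of 0] by linarith
  have "bounded (range c)" using assms bounded_range_iff by blast
  then have "app (wshift c k) \<phi> = weighted_shift c k \<phi>" for \<phi>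
    by (intro ell2_eqI) (simp add: coord_wshift coord_weighted_shift[of c B, OF assms])
  then show "norm (app (wshift c k) \<phi>) \<le> B * norm \<phi>" for \<phi>
    using norm_weighted_shift_le[of c B, OF assms] by simp
qed

lemma coord_jac:
  assumes "jacobi_coeffs a b"
  shows "coord (app (jac a b) \<phi>) n = of_real (a (n - 1)) * coord \<phi> (n - 1)
           + of_real (b n) * coord \<phi> n + of_real (a n) * coord \<phi> (n + 1)"
  by (simp add: jac_def app_bop bounded_linear_jacobi coord_jacobi assms)

lemma app_jac: "jacobi_coeffs a b \<Longrightarrow> app (jac a b) = jacobi a b"
  by (simp add: jac_def app_bop bounded_linear_jacobi)

lemma bounded_range_compose: "bounded (range c) \<Longrightarrow> bounded (range (\<lambda>n. c (g n)))"
  by (rule bounded_subset) auto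

lemma jacobi_coeffs_bounded:
  assumes "jacobi_coeffs a b"
  shows "bounded (range a)" "bounded (range b)" "bounded (range (\<lambda>n. a (n - 1)))"
  using assms bounded_range_compose by (auto simp: jacobi_coeffs_def)

lemma jac_eq:
  assumes "jacobi_coeffs a b"
  shows "jac a b = wshift (\<lambda>n. a (n - 1)) (- 1) + wshift b 0 + wshift a 1"
  by (intro bop_eqI ell2_eqI)
    (simp add: coord_jac coord_wshift jacobi_coeffs_bounded[OF assms] assms)

lemma iop_mult_iop [simp]: "iop * iop = - 1"
  by (intro bop_eqI ell2_eqI) simp

lemma norm_app_iop [simp]: "norm (app iop \<phi>) = norm \<phi>"
  by (simp add: iop_def app_bop bounded_linear_cscale norm_cscale)

lemma norm_iop [simp]: "norm iop = 1"
proof -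
  have "norm iop \<le> 1" by (rule norm_bop_bound) simp_all
  moreover have "1 \<le> norm iop * norm iop"
    using norm_mult_ineq[of iop iop] by simp
  ultimately show ?thesis
    using mult_left_le_one_le[of "norm iop" "norm iop"] by fastforce
qed

lemma iop_wshift: "bounded (range c) \<Longrightarrow> iop * wshift c k = wshift c k * iop"
  by (intro bop_eqI ell2_eqI) (simp add: coord_wshift)

lemma iop_jac: "jacobi_coeffs a b \<Longrightarrow> iop * jac a b = jac a b * iop"
  by (simp add: jac_eq iop_wshift jacobi_coeffs_bounded algebra_simps)

lemma iop_jac_comm: "jacobi_coeffs a b \<Longrightarrow> iop * jac_comm a = jac_comm a * iop"
  by (simp add: jac_comm_def iop_wshift jacobi_coeffs_bounded algebra_simps)

lemma of_int_plus_ii_neq_0: "of_int n + \<i> \<noteq> 0"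
  by (simp add: complex_eq_iff)

lemma coord_resolvent: "coord (app resolvent \<phi>) n = inverse (of_int n + \<i>) * coord \<phi> n"
proof -
  have b: "cmod (inverse (of_int n + \<i>)) \<le> 1" for n
  proof -
    have "1 \<le> cmod (of_int n + \<i>)"
      using abs_Im_le_cmod[of "of_int n + \<i>"] by simp
    then show ?thesis by (simp add: norm_inverse inverse_le_1_iff)
  qed
  define f where "f \<phi> = Ell2 (\<lambda>n. inverse (of_int n + \<i>) * coord \<phi> n)" for \<phi>
  have c: "coord (f \<phi>) n = inverse (of_int n + \<i>) * coord \<phi> n" for \<phi> n
    unfolding f_def by (subst coord_Ell2[OF square_summable_bounded_mult[OF square_summable_coord b]]) simp
  have "norm (f \<phi>) \<le> norm \<phi>" for \<phi>
    unfolding f_def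
  proof (rule ell2_boundI(2))
    fix F :: "int set" assume "finite F"
    have "(\<Sum>n\<in>F. (cmod (inverse (of_int n + \<i>) * coord \<phi> n))\<^sup>2) \<le> (\<Sum>n\<in>F. (cmod (coord \<phi> n))\<^sup>2)"
      unfolding norm_mult
      by (intro sum_mono power_mono mult_left_le_one_le b) auto
    also have "\<dots> \<le> (norm \<phi>)\<^sup>2" by (rule sum_coord_le_norm) fact
    finally show "(\<Sum>n\<in>F. (cmod (inverse (of_int n + \<i>) * coord \<phi> n))\<^sup>2) \<le> (norm \<phi>)\<^sup>2" .
  qed simp
  then have "bounded_linear f"
    by (intro bounded_linear_intro[where K = 1]) (auto intro!: ell2_eqI simp: c algebra_simps)
  then show ?thesis
    using c by (simp add: resolvent_def app_bop f_def[abs_def])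
qed

lemma has_commutator_wshift:
  assumes "bounded (range c)"
  shows "has_commutator resolvent (wshift c k) (of_int k *\<^sub>R wshift c k)"
  unfolding has_commutator_def
proof (intro bop_eqI ell2_eqI)
  fix \<phi> n
  have "of_int (n + k) + \<i> \<noteq> 0" "of_int n + \<i> \<noteq> 0"
    by (rule of_int_plus_ii_neq_0)+
  then show "coord (app (resolvent * wshift c k - wshift c k * resolvent) \<phi>) n
      = coord (app (resolvent * (of_int k *\<^sub>R wshift c k) * resolvent) \<phi>) n"
    by (simp add: coord_resolvent coord_wshift assms field_simps)
qed

lemma has_commutator_jac:
  assumes "jacobi_coeffs a b"
  shows "has_commutator resolvent (jac a b) (jac_comm a)"
proof -
  have "has_commutator resolvent (jac a b)
      (of_int (- 1) *\<^sub>R wshift (\<lambda>n. a (n - 1)) (- 1) + of_int 0 *\<^sub>R wshift b 0 + of_int 1 *\<^sub>R wshift a 1)"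
    unfolding jac_eq[OF assms]
    by (intro has_commutator_add has_commutator_wshift jacobi_coeffs_bounded[OF assms])
  then show ?thesis by (simp add: jac_comm_def)
qed

lemma has_commutator_iop: "has_commutator resolvent iop 0"
  unfolding has_commutator_def by (intro bop_eqI ell2_eqI) (simp add: coord_resolvent)

lemma resolvent_surj: "\<psi> \<in> position_dom \<Longrightarrow> \<exists>\<phi>. app resolvent \<phi> = \<psi>"
proof
  assume \<psi>: "\<psi> \<in> position_dom"
  show "app resolvent (position \<psi> + app iop \<psi>) = \<psi>"
    using of_int_plus_ii_neq_0
    by (intro ell2_eqI) (simp add: coord_resolvent coord_position[OF \<psi>] distrib_right[symmetric])
qed

lemma resolvent_in_position_dom [simp]: "app resolvent \<phi> \<in> position_dom"
  and position_resolvent: "position (app resolvent \<phi>) = \<phi> - app iop (app resolvent \<phi>)"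
proof -
  have c: "of_int n * coord (app resolvent \<phi>) n = coord (\<phi> - app iop (app resolvent \<phi>)) n" for n
    using of_int_plus_ii_neq_0[of n] by (simp add: coord_resolvent field_simps)
  show d: "app resolvent \<phi> \<in> position_dom"
    unfolding position_dom_def mem_Collect_eq c by (rule square_summable_coord)
  show "position (app resolvent \<phi>) = \<phi> - app iop (app resolvent \<phi>)"
    using c by (intro ell2_eqI) (simp add: coord_position[OF d])
qed

lemma cscale_eq: "cscale c \<phi> = Re c *\<^sub>R \<phi> + Im c *\<^sub>R app iop \<phi>"
  by (intro ell2_eqI) (simp add: complex_eq_iff)

lemma app_cscale:
  assumes "iop * T = T * iop"
  shows "app T (cscale c \<phi>) = cscale c (app T \<phi>)"
proof -
  have "app T (app iop \<phi>) = app iop (app T \<phi>)"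
    using assms by (metis app_mult)
  then show ?thesis by (simp add: cscale_eq app.add_right app.scaleR_right)
qed

section \<open>Basis vectors, truncations and density\<close>

lemma coord_sum [simp]: "coord (sum f A) n = (\<Sum>x\<in>A. coord (f x) n)"
  by (rule linear_sum[OF bounded_linear.linear[OF bounded_linear_coord]])

lemma norm_delta [simp]: "norm (delta n) = 1"
proof -
  have "(\<Sum>\<^sub>\<infinity>m. (cmod (coord (delta n) m))\<^sup>2) = (\<Sum>\<^sub>\<infinity>m\<in>{n}. 1 :: real)"
    by (rule infsum_cong_neutral) (auto simp: coord_delta)
  then show ?thesis by (simp add: norm_ell2_def)
qed

definition trunc :: "int set \<Rightarrow> ell2 \<Rightarrow> ell2" where
  "trunc F \<phi> = Ell2 (\<lambda>n. if n \<in> F then coord \<phi> n else 0)"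

lemma coord_trunc [simp]: "coord (trunc F \<phi>) n = (if n \<in> F then coord \<phi> n else 0)"
proof -
  have "square_summable (\<lambda>n. if n \<in> F then coord \<phi> n else 0)"
    by (rule square_summable_le[OF square_summable_coord[of \<phi>]]) auto
  then show ?thesis by (simp add: trunc_def coord_Ell2)
qed

lemma trunc_finite: "finite F \<Longrightarrow> trunc F \<phi> = (\<Sum>n\<in>F. cscale (coord \<phi> n) (delta n))"
  by (intro ell2_eqI) (simp add: coord_delta if_distrib cong: if_cong)

lemma norm_power2_ell2: "(norm \<phi>)\<^sup>2 = (\<Sum>\<^sub>\<infinity>n. (cmod (coord \<phi> n))\<^sup>2)"
  by (simp add: norm_ell2_def infsum_nonneg)

lemma summable_norm_coord: "(\<lambda>n. (cmod (coord \<phi> n))\<^sup>2) summable_on A"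
  using square_summable_coord[of \<phi>] summable_on_subset_banach
  unfolding square_summable_def by blast

lemma norm_trunc_power2: "(norm (trunc A \<phi>))\<^sup>2 = (\<Sum>\<^sub>\<infinity>n\<in>A. (cmod (coord \<phi> n))\<^sup>2)"
  unfolding norm_power2_ell2 by (rule infsum_cong_neutral) auto

lemma norm_trunc_le: "norm (trunc A \<phi>) \<le> norm \<phi>"
proof (rule power2_le_imp_le)
  show "(norm (trunc A \<phi>))\<^sup>2 \<le> (norm \<phi>)\<^sup>2"
    unfolding norm_trunc_power2 norm_power2_ell2[of \<phi>]
    by (intro infsum_mono2 summable_norm_coord) auto
qed simp

lemma trunc_tendsto: "((\<lambda>F. trunc F \<phi>) \<longlongrightarrow> \<phi>) (finite_subsets_at_top UNIV)"
proof -
  have "((\<lambda>F. \<Sum>n\<in>F. (cmod (coord \<phi> n))\<^sup>2) \<longlongrightarrow> (norm \<phi>)\<^sup>2) (finite_subsets_at_top UNIV)"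
    unfolding norm_power2_ell2
    using has_sum_infsum[OF summable_norm_coord[of \<phi> UNIV]] by (simp add: has_sum_def)
  then have "((\<lambda>F. sqrt ((norm \<phi>)\<^sup>2 - (\<Sum>n\<in>F. (cmod (coord \<phi> n))\<^sup>2))) \<longlongrightarrow> sqrt ((norm \<phi>)\<^sup>2 - (norm \<phi>)\<^sup>2))
      (finite_subsets_at_top UNIV)"
    by (intro tendsto_intros)
  moreover have "\<forall>\<^sub>F F in finite_subsets_at_top UNIV.
      sqrt ((norm \<phi>)\<^sup>2 - (\<Sum>n\<in>F. (cmod (coord \<phi> n))\<^sup>2)) = norm (trunc F \<phi> - \<phi>)"
  proof (rule eventually_finite_subsets_at_top_weakI)
    fix F :: "int set" assume F: "finite F"
    have "(norm (trunc F \<phi> - \<phi>))\<^sup>2 = (norm (trunc (UNIV - F) \<phi>))\<^sup>2"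
      unfolding norm_power2_ell2 by (intro infsum_cong) auto
    also have "\<dots> = (norm \<phi>)\<^sup>2 - (\<Sum>n\<in>F. (cmod (coord \<phi> n))\<^sup>2)"
      unfolding norm_trunc_power2 norm_power2_ell2[of \<phi>]
      using infsum_Diff[OF summable_norm_coord[of \<phi> UNIV] summable_norm_coord[of \<phi> F]] F by simp
    finally show "sqrt ((norm \<phi>)\<^sup>2 - (\<Sum>n\<in>F. (cmod (coord \<phi> n))\<^sup>2)) = norm (trunc F \<phi> - \<phi>)"
      by (metis norm_ge_zero real_sqrt_unique)
  qed
  ultimately have "((\<lambda>F. norm (trunc F \<phi> - \<phi>)) \<longlongrightarrow> 0) (finite_subsets_at_top UNIV)"
    by (simp add: tendsto_cong)
  then show ?thesis by (simp add: tendsto_norm_zero_iff LIM_zero_iff)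
qed

text \<open>The triangle inequality over the expansion in basis vectors; commuting with
  \<open>iop\<close> lets the complex coefficients through. Bounds on basis vectors that are uniform
  in \<open>n\<close> thus become bounds on l1.\<close>

lemma norm_app_ell1_le:
  assumes T: "iop * T = T * iop" and \<mu>: "\<And>n. norm (app T (delta n)) \<le> \<mu>" and \<phi>: "\<phi> \<in> ell1"
  shows "norm (app T \<phi>) \<le> \<mu> * (\<Sum>\<^sub>\<infinity>n. cmod (coord \<phi> n))"
proof (rule tendsto_upperbound)
  show "((\<lambda>F. norm (app T (trunc F \<phi>))) \<longlongrightarrow> norm (app T \<phi>)) (finite_subsets_at_top UNIV)"
    by (intro tendsto_norm bounded_linear.tendsto[OF bounded_linear_app] trunc_tendsto)
  show "\<forall>\<^sub>F F in finite_subsets_at_top UNIV.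
      norm (app T (trunc F \<phi>)) \<le> \<mu> * (\<Sum>\<^sub>\<infinity>n. cmod (coord \<phi> n))"
  proof (rule eventually_finite_subsets_at_top_weakI)
    fix F :: "int set" assume F: "finite F"
    have "0 \<le> \<mu>" using \<mu>[of 0] norm_ge_zero order_trans by blast
    have "norm (app T (trunc F \<phi>)) \<le> (\<Sum>n\<in>F. norm (cscale (coord \<phi> n) (app T (delta n))))"
      unfolding trunc_finite[OF F] app.sum_right app_cscale[OF T] by (rule norm_sum)
    also have "\<dots> \<le> (\<Sum>n\<in>F. cmod (coord \<phi> n) * \<mu>)"
      unfolding norm_cscale by (intro sum_mono mult_left_mono \<mu>) simp
    also have "\<dots> = \<mu> * (\<Sum>n\<in>F. cmod (coord \<phi> n))"
      by (simp add: sum_distrib_left mult.commute)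
    also have "\<dots> \<le> \<mu> * (\<Sum>\<^sub>\<infinity>n. cmod (coord \<phi> n))"
      using \<phi> \<open>0 \<le> \<mu>\<close> F
      by (intro mult_left_mono finite_sum_le_infsum) (auto simp: ell1_def)
    finally show "norm (app T (trunc F \<phi>)) \<le> \<mu> * (\<Sum>\<^sub>\<infinity>n. cmod (coord \<phi> n))" .
  qed
qed simp

lemma trunc_finite_ell1: "finite F \<Longrightarrow> trunc F \<phi> \<in> ell1"
  unfolding ell1_def mem_Collect_eq by (rule finite_nonzero_values_imp_summable_on) (auto elim: rev_finite_subset)

lemma norm_le_ell1:
  assumes "\<phi> \<in> ell1" shows "norm \<phi> \<le> (\<Sum>\<^sub>\<infinity>n. cmod (coord \<phi> n))"
  using norm_app_ell1_le[of 1 1 \<phi>] assms by simp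

lemma trunc_finite_position_dom: "finite F \<Longrightarrow> trunc F \<phi> \<in> position_dom"
  unfolding position_dom_def square_summable_def mem_Collect_eq
  by (rule finite_nonzero_values_imp_summable_on) (auto elim: rev_finite_subset)

lemma bop_eqI_position_dom:
  assumes "\<And>\<phi>. \<phi> \<in> position_dom \<Longrightarrow> app S \<phi> = app T \<phi>"
  shows "S = T"
proof (rule bop_eqI)
  fix \<phi>
  have l: "((\<lambda>F. app U (trunc F \<phi>)) \<longlongrightarrow> app U \<phi>) (finite_subsets_at_top UNIV)" for U
    by (intro bounded_linear.tendsto[OF bounded_linear_app] trunc_tendsto)
  have "\<forall>\<^sub>F F in finite_subsets_at_top UNIV. app T (trunc F \<phi>) = app S (trunc F \<phi>)"
    by (rule eventually_finite_subsets_at_top_weakI) (simp add: assms trunc_finite_position_dom)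
  from tendsto_cong[OF this] l[of T] have "((\<lambda>F. app S (trunc F \<phi>)) \<longlongrightarrow> app T \<phi>) (finite_subsets_at_top UNIV)"
    by simp
  from tendsto_unique[OF _ l[of S] this] show "app S \<phi> = app T \<phi>" by simp
qed

text \<open>The resolvent is injective and its range, the domain of \<open>X\<close>, is dense, so
  \<open>R * T * R\<close> determines \<open>T\<close>.\<close>

lemma has_commutator_unique:
  assumes "has_commutator resolvent S T" "has_commutator resolvent S T'"
  shows "T = T'"
proof (rule bop_eqI_position_dom)
  fix \<phi> assume "\<phi> \<in> position_dom"
  then obtain \<psi> where \<psi>: "app resolvent \<psi> = \<phi>" using resolvent_surj by blast
  have "resolvent * T * resolvent = resolvent * T' * resolvent"
    using assms by (simp add: has_commutator_def)
  then have "app resolvent (app T \<phi>) = app resolvent (app T' \<phi>)"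
    by (metis app_mult \<psi>)
  then have "inverse (of_int n + \<i>) * coord (app T \<phi>) n = inverse (of_int n + \<i>) * coord (app T' \<phi>) n" for n
    by (metis coord_resolvent)
  then show "app T \<phi> = app T' \<phi>"
    using of_int_plus_ii_neq_0 by (intro ell2_eqI) simp
qed

section \<open>Adjoints and the unitary group\<close>

text \<open>Adjoints refer to the real inner product, for which multiplication by i is skew. For
  operators commuting with \<open>iop\<close> they agree with complex adjoints.\<close>

definition adjoint_pair :: "'a::real_inner bop \<Rightarrow> 'a bop \<Rightarrow> bool" where
  "adjoint_pair S T \<longleftrightarrow> (\<forall>x y. inner (app S x) y = inner x (app T y))"

lemma adjoint_pair_mult:
  fixes S T :: "'a::{real_inner, perfect_space} bop"
  shows "adjoint_pair S S' \<Longrightarrow> adjoint_pair T T' \<Longrightarrow> adjoint_pair (S * T) (T' * S')"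
  by (simp add: adjoint_pair_def)

lemma adjoint_pair_add:
  "adjoint_pair S S' \<Longrightarrow> adjoint_pair T T' \<Longrightarrow> adjoint_pair (S + T) (S' + T')"
  by (simp add: adjoint_pair_def inner_add_left inner_add_right)

lemma adjoint_pair_scaleR: "adjoint_pair S S' \<Longrightarrow> adjoint_pair (r *\<^sub>R S) (r *\<^sub>R S')"
  by (simp add: adjoint_pair_def)

lemma adjoint_pair_minus: "adjoint_pair S S' \<Longrightarrow> adjoint_pair (- S) (- S')"
  using adjoint_pair_scaleR[of S S' "-1"] by simp

lemma adjoint_pair_power:
  fixes S :: "'a::{real_inner, perfect_space} bop"
  assumes "adjoint_pair S T" shows "adjoint_pair (S ^ n) (T ^ n)"
proof (induction n)
  case (Suc n)
  have "T ^ Suc n = T ^ n * T" by (metis power_Suc2)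
  then show ?case using adjoint_pair_mult[OF assms Suc] by simp
qed (simp add: adjoint_pair_def)

lemma bounded_linear_inner_app_left: "bounded_linear (\<lambda>S. inner (app S x) y)"
  by (intro bounded_linear_compose[OF bounded_linear_inner_left] app.bounded_linear_left)

lemma bounded_linear_inner_app_right: "bounded_linear (\<lambda>S. inner x (app S y))"
  by (intro bounded_linear_compose[OF bounded_linear_inner_right] app.bounded_linear_left)

lemma adjoint_pair_exp:
  fixes S :: "'a::{real_inner, banach, perfect_space} bop"
  assumes "adjoint_pair S T" shows "adjoint_pair (exp S) (exp T)"
  unfolding adjoint_pair_def
proof (intro allI)
  fix x y
  have "(\<lambda>n. inner (app (S ^ n /\<^sub>R fact n) x) y) sums inner (app (exp S) x) y"
    by (intro bounded_linear.sums[OF bounded_linear_inner_app_left] exp_converges)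
  moreover have "(\<lambda>n. inner x (app (T ^ n /\<^sub>R fact n) y)) sums inner x (app (exp T) y)"
    by (intro bounded_linear.sums[OF bounded_linear_inner_app_right] exp_converges)
  moreover have "inner (app (S ^ n /\<^sub>R fact n) x) y = inner x (app (T ^ n /\<^sub>R fact n) y)" for n
    using adjoint_pair_power[OF assms, of n] by (simp add: adjoint_pair_def)
  ultimately show "inner (app (exp S) x) y = inner x (app (exp T) y)"
    by (simp add: sums_unique2)
qed

lemma norm_app_exp_skew:
  fixes K :: "'a::{real_inner, banach, perfect_space} bop"
  assumes "adjoint_pair K (- K)"
  shows "norm (app (exp (s *\<^sub>R K)) x) = norm x"
proof -
  have "adjoint_pair (exp (s *\<^sub>R K)) (exp (- (s *\<^sub>R K)))"
    using adjoint_pair_exp[OF adjoint_pair_scaleR[OF assms, of s]] by simp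
  then have "inner (app (exp (s *\<^sub>R K)) x) (app (exp (s *\<^sub>R K)) x)
      = inner x (app (exp (- (s *\<^sub>R K)) * exp (s *\<^sub>R K)) x)"
    by (simp add: adjoint_pair_def del: exp_scaleR_inverse)
  then show ?thesis by (simp add: norm_eq_sqrt_inner del: app_mult)
qed

lemma norm_exp_skew_le:
  fixes K :: "'a::{real_inner, banach, perfect_space} bop"
  assumes "adjoint_pair K (- K)"
  shows "norm (exp (s *\<^sub>R K)) \<le> 1"
  by (rule norm_bop_bound) (simp_all add: norm_app_exp_skew[OF assms])

lemma adjoint_pair_accumulated:
  fixes K :: "'a::{real_inner, banach, perfect_space} bop"
  assumes "adjoint_pair K (- K)" "adjoint_pair D D"
  shows "adjoint_pair (accumulated K D t) (accumulated K D t)"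
  unfolding adjoint_pair_def
proof (intro allI)
  fix x y
  have e: "adjoint_pair (exp (s *\<^sub>R K)) (exp (- (s *\<^sub>R K)))" for s
    using adjoint_pair_exp[OF adjoint_pair_scaleR[OF assms(1), of s]] by simp
  have "adjoint_pair (evolved K D s) (evolved K D s)" for s
    using adjoint_pair_mult[OF adjoint_pair_mult[OF e[of s] assms(2)] e[of "- s"]]
    by (simp add: evolved_def mult.assoc)
  then have eq: "inner (app (evolved K D s) x) y = inner x (app (evolved K D s) y)" for s
    by (simp add: adjoint_pair_def)
  have "((\<lambda>s. inner (app (evolved K D s) x) y) has_integral inner (app (accumulated K D t) x) y) {0..t}"
    using has_integral_linear[OF has_integral_accumulated bounded_linear_inner_app_left] by (simp add: o_def)
  moreover have "((\<lambda>s. inner x (app (evolved K D s) y)) has_integral inner x (app (accumulated K D t) y)) {0..t}"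
    using has_integral_linear[OF has_integral_accumulated bounded_linear_inner_app_right] by (simp add: o_def)
  ultimately show "inner (app (accumulated K D t) x) y = inner x (app (accumulated K D t) y)"
    unfolding eq by (rule has_integral_unique)
qed

lemma adjoint_pair_iop: "adjoint_pair iop (- iop)"
  unfolding adjoint_pair_def inner_ell2_alt
  by (intro allI infsum_cong) simp

lemma adjoint_pair_wshift:
  assumes "bounded (range c)"
  shows "adjoint_pair (wshift c k) (wshift (\<lambda>n. c (n - k)) (- k))"
  unfolding adjoint_pair_def inner_ell2_alt
proof (intro allI)
  fix x y
  have b: "bij_betw (\<lambda>n::int. n + k) UNIV UNIV"
    by (rule bij_betwI[where g = "\<lambda>n. n - k"]) auto
  show "(\<Sum>\<^sub>\<infinity>n. Re (cnj (coord (app (wshift c k) x) n) * coord y n))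
      = (\<Sum>\<^sub>\<infinity>n. Re (cnj (coord x n) * coord (app (wshift (\<lambda>n. c (n - k)) (- k)) y) n))"
    using infsum_reindex_bij_betw[OF b,
        of "\<lambda>n. Re (cnj (coord x n) * coord (app (wshift (\<lambda>n. c (n - k)) (- k)) y) n)"]
    by (simp add: coord_wshift assms bounded_range_compose[OF assms, of "\<lambda>n. n - k"] algebra_simps)
qed

lemma adjoint_pair_jac:
  assumes "jacobi_coeffs a b" shows "adjoint_pair (jac a b) (jac a b)"
proof -
  note adjoint_pair_add[OF adjoint_pair_add[OF
      adjoint_pair_wshift[of "\<lambda>n. a (n - 1)" "-1"] adjoint_pair_wshift[of b 0]] adjoint_pair_wshift[of a 1]]
  then show ?thesis
    unfolding jac_eq[OF assms] using jacobi_coeffs_bounded[OF assms] by (simp add: algebra_simps)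
qed

lemma adjoint_pair_jac_comm:
  assumes "jacobi_coeffs a b" shows "adjoint_pair (jac_comm a) (- jac_comm a)"
proof -
  note adjoint_pair_add[OF adjoint_pair_wshift[of a 1]
      adjoint_pair_minus[OF adjoint_pair_wshift[of "\<lambda>n. a (n - 1)" "-1"]]]
  then show ?thesis
    unfolding jac_comm_def using jacobi_coeffs_bounded[OF assms] by (simp add: algebra_simps)
qed

lemma adjoint_pair_iop_jac:
  assumes "jacobi_coeffs a b" shows "adjoint_pair (iop * jac a b) (- (iop * jac a b))"
  using adjoint_pair_mult[OF adjoint_pair_iop adjoint_pair_jac[OF assms]] iop_jac[OF assms] by simp

lemma adjoint_pair_iop_jac_comm:
  assumes "jacobi_coeffs a b" shows "adjoint_pair (iop * jac_comm a) (iop * jac_comm a)"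
  using adjoint_pair_mult[OF adjoint_pair_iop adjoint_pair_jac_comm[OF assms]] iop_jac_comm[OF assms] by simp

lemmas norm_exp_jac_le = norm_exp_skew_le[OF adjoint_pair_iop_jac]

section \<open>The Heisenberg evolution of the position\<close>

lemma op_exp_jacobi:
  assumes J: "jacobi_coeffs a b"
  shows "op_exp (\<i> * of_real t) (jacobi a b) \<phi> = app (exp (t *\<^sub>R (iop * jac a b))) \<phi>"
proof -
  let ?T = "t *\<^sub>R (iop * jac a b)"
  have pow: "app (?T ^ k) \<phi> = cscale ((\<i> * of_real t) ^ k) ((jacobi a b ^^ k) \<phi>)" for k
  proof (induction k)
    case (Suc k)
    have "app (?T ^ Suc k) \<phi> = t *\<^sub>R app iop (app (jac a b) (cscale ((\<i> * of_real t) ^ k) ((jacobi a b ^^ k) \<phi>)))"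
      unfolding power_Suc app_mult Suc by simp
    also have "app (jac a b) (cscale ((\<i> * of_real t) ^ k) ((jacobi a b ^^ k) \<phi>))
        = cscale ((\<i> * of_real t) ^ k) ((jacobi a b ^^ Suc k) \<phi>)"
      using app_cscale[OF iop_jac[OF J]] by (simp add: app_jac[OF J])
    finally show ?case by (auto intro!: ell2_eqI)
  qed (auto intro!: ell2_eqI)
  have "app (exp ?T) \<phi> = (\<Sum>k. app (?T ^ k /\<^sub>R fact k) \<phi>)"
    unfolding exp_def by (rule bounded_linear.suminf[OF app.bounded_linear_left summable_exp_generic])
  also have "\<dots> = op_exp (\<i> * of_real t) (jacobi a b) \<phi>"
    unfolding op_exp_def app_scaleR pow
    by (intro suminf_cong ell2_eqI) (simp add: field_simps)
  finally show ?thesis ..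
qed

text \<open>With \<open>R = (X + \<i>)\<^bsup>-1\<^esup>\<close>, the operator \<open>X R = 1 - \<i> R\<close> is bounded and \<open>K R = R (K - D R)\<close>.
  Hence \<open>X exp (- t K) R = (1 - \<i> R) exp (- t (K - D R))\<close>, which can be differentiated in the
  Banach algebra.\<close>

lemma heisenberg_eq_accumulated:
  assumes J: "jacobi_coeffs a b" and \<phi>: "\<phi> \<in> position_dom" and t: "t \<ge> 0"
  shows "heisenberg (jacobi a b) t \<phi>
    = position \<phi> + app (accumulated (iop * jac a b) (iop * jac_comm a) t) \<phi>"
proof -
  define K where "K = iop * jac a b"
  define D where "D = iop * jac_comm a"
  define L where "L = K - D * resolvent"
  define V where "V = 1 - iop * resolvent"
  obtain \<psi> where \<psi>: "\<phi> = app resolvent \<psi>" using resolvent_surj[OF \<phi>] by blast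
  have "has_commutator resolvent K D"
    using has_commutator_mult[OF has_commutator_iop has_commutator_jac[OF J]] by (simp add: K_def D_def)
  then have KR: "K * resolvent = resolvent * L"
    by (simp add: has_commutator_def L_def algebra_simps)
  have "K * iop = iop * K"
    unfolding K_def using commute_mult[of iop iop "jac a b"] iop_jac[OF J] by simp
  then have "K * iop * resolvent = iop * resolvent * L"
    by (simp add: mult.assoc KR)
  then have KV: "K * V - V * L = D * resolvent"
    by (simp add: V_def L_def algebra_simps)
  \<comment> \<open>Here \<open>V\<close> is \<open>X R\<close>, so \<open>?f s\<close> is
    \<open>exp (s K) X exp (- s K) R\<close> with the resolvent already moved to the left of the
    right-hand group. \<open>KV\<close> makes its derivative the evolved \<open>D\<close> times the
    resolvent.\<close>
  let ?f = "\<lambda>s. exp (s *\<^sub>R K) * V * exp (- (s *\<^sub>R L))"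
  have exR: "exp (- (s *\<^sub>R K)) * resolvent = resolvent * exp (- (s *\<^sub>R L))" for s
    using exp_scaleR_intertwine[OF KR, of "- s"] by simp
  have "((\<lambda>s. evolved K D s * resolvent) has_integral ?f t - ?f 0) {0..t}"
  proof (rule fundamental_theorem_of_calculus[OF t])
    fix s
    have "exp (s *\<^sub>R K) * (K * V - V * L) * exp (- (s *\<^sub>R L)) = evolved K D s * resolvent"
      unfolding KV evolved_def by (simp add: mult.assoc exR)
    then show "(?f has_vector_derivative evolved K D s * resolvent) (at s within {0..t})"
      using conj_deriv[of K V L s "{0..t}"] by simp
  qed
  moreover have "((\<lambda>s. evolved K D s * resolvent) has_integral accumulated K D t * resolvent) {0..t}"
    by (intro has_integral_mult_left has_integral_accumulated)
  ultimately have "?f t - ?f 0 = accumulated K D t * resolvent"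
    by (rule has_integral_unique)
  then have f: "?f t = V + accumulated K D t * resolvent"
    by (simp add: algebra_simps)
  have XR: "position (app resolvent x) = app V x" for x
    by (simp add: position_resolvent V_def)
  have "op_exp (- \<i> * of_real t) (jacobi a b) \<phi> = app (exp (- (t *\<^sub>R K)) * resolvent) \<psi>"
    using op_exp_jacobi[OF J, of "- t" \<phi>] by (simp add: K_def \<psi>)
  also have "\<dots> = app resolvent (app (exp (- (t *\<^sub>R L))) \<psi>)"
    by (simp add: exR)
  finally have "heisenberg (jacobi a b) t \<phi> = app (?f t) \<psi>"
    unfolding heisenberg_def by (simp add: XR op_exp_jacobi[OF J] K_def)
  then show ?thesis
    unfolding f by (simp add: \<psi> XR K_def D_def)
qed

section \<open>Averages over shifts\<close>

lemma shift_add: "shift j * shift k = shift (j + k)"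
  by (intro bop_eqI ell2_eqI) (simp add: add.assoc)

lemma shift_0: "shift 0 = 1"
  by (intro bop_eqI ell2_eqI) simp

lemma norm_shift_le: "norm (shift k) \<le> 1"
  by (rule norm_wshift_le) simp

lemma norm_app_shift [simp]: "norm (app (shift k) \<phi>) = norm \<phi>"
proof (rule antisym)
  have le: "norm (app (shift k) \<phi>) \<le> norm \<phi>" for k \<phi>
    using norm_app_le[of "shift k" \<phi>] norm_shift_le[of k]
    by (meson mult_left_le_one_le norm_ge_zero order_trans)
  then show "norm (app (shift k) \<phi>) \<le> norm \<phi>" .
  have "app (shift (- k)) (app (shift k) \<phi>) = \<phi>"
    using shift_add[of "- k" k] by (metis add.left_inverse app_mult app_one shift_0)
  then show "norm \<phi> \<le> norm (app (shift k) \<phi>)"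
    using le[of "- k" "app (shift k) \<phi>"] by simp
qed

lemma app_shift_delta: "app (shift k) (delta m) = delta (m - k)"
  by (intro ell2_eqI) (auto simp: coord_delta)

lemma norm_sum_delta:
  assumes "finite A" "inj_on f A"
  shows "norm (\<Sum>j\<in>A. delta (f j)) = sqrt (card A)"
proof -
  have "pairwise (\<lambda>i j. orthogonal (delta (f i)) (delta (f j))) A"
    using assms(2) by (auto simp: pairwise_def orthogonal_def inner_ell2_def cinner_delta coord_delta inj_on_def)
  from norm_sum_Pythagorean[OF assms(1) this]
  have "(norm (\<Sum>j\<in>A. delta (f j)))\<^sup>2 = card A" by simp
  then show ?thesis by (metis norm_ge_zero real_sqrt_unique)
qed

text \<open>If \<open>E\<close> is nearly annihilated by \<open>S - 1\<close>, then \<open>E \<delta>\<^sub>m\<close> is close to the average of the vectors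
  \<open>S\<^sup>j E \<delta>\<^sub>m = E S\<^sup>j \<delta>\<^sub>m\<close>, and the average of \<open>L\<close> orthonormal vectors has norm \<open>1 / sqrt L\<close>.\<close>

lemma norm_app_delta_le:
  assumes comm: "shift k * E = E * shift k" and "k \<noteq> 0" and L: "L > 0"
    and \<kappa>: "norm ((shift k - 1) * E) \<le> \<kappa>"
  shows "norm (app E (delta m)) \<le> real L * \<kappa> + norm E / sqrt (real L)"
proof -
  define y where "y = app E (delta m)"
  have \<kappa>0: "0 \<le> \<kappa>" using \<kappa> norm_ge_zero order_trans by blast
  have step: "norm (app (shift k) y - y) \<le> \<kappa>"
    using norm_app_le[of "(shift k - 1) * E" "delta m"] \<kappa> by (simp add: y_def)
  have iter: "norm (app (shift (int j * k)) y - y) \<le> real j * \<kappa>" for j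
  proof (induction j)
    case (Suc j)
    have "app (shift (int (Suc j) * k)) y - y
        = app (shift (int j * k)) (app (shift k) y - y) + (app (shift (int j * k)) y - y)"
      by (simp add: app.diff_right app_mult[symmetric] shift_add algebra_simps del: app_mult)
    also have "norm \<dots> \<le> \<kappa> + real j * \<kappa>"
      by (intro norm_triangle_mono Suc) (simp add: step)
    finally show ?case by (simp add: algebra_simps)
  qed (simp add: shift_0)
  have commj: "shift (int j * k) * E = E * shift (int j * k)" for j
  proof (induction j)
    case (Suc j)
    have "shift (int (Suc j) * k) = shift k * shift (int j * k)"
      by (simp add: shift_add algebra_simps)
    then show ?case using commute_mult[of E "shift k" "shift (int j * k)"] comm Suc by simp
  qed (simp add: shift_0)
  have sh: "app (shift (int j * k)) y = app E (delta (m - int j * k))" for j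
    using commj[of j] unfolding y_def by (metis app_mult app_shift_delta)
  have "real L *\<^sub>R y = (\<Sum>j<L. y - app (shift (int j * k)) y) + app E (\<Sum>j<L. delta (m - int j * k))"
    by (simp add: app.sum_right sh[symmetric] sum_subtractf sum_constant_scaleR)
  also have "norm \<dots> \<le> real L * (real L * \<kappa>) + norm E * sqrt (real L)"
  proof (rule norm_triangle_mono)
    have "norm (y - app (shift (int j * k)) y) \<le> real L * \<kappa>" if "j \<in> {..<L}" for j
    proof -
      have "real j * \<kappa> \<le> real L * \<kappa>" using \<kappa>0 that by (intro mult_right_mono) auto
      then show ?thesis using iter[of j] by (simp add: norm_minus_commute)
    qed
    from sum_norm_le[of "{..<L}", OF this]
    show "norm (\<Sum>j<L. y - app (shift (int j * k)) y) \<le> real L * (real L * \<kappa>)" by simp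
    have "inj_on (\<lambda>j. m - int j * k) {..<L}"
      using \<open>k \<noteq> 0\<close> by (auto simp: inj_on_def)
    then show "norm (app E (\<Sum>j<L. delta (m - int j * k))) \<le> norm E * sqrt (real L)"
      using norm_app_le[of E "\<Sum>j<L. delta (m - int j * k)"] by (simp add: norm_sum_delta)
  qed
  finally have "real L * norm y \<le> real L * (real L * \<kappa>) + norm E * sqrt (real L)"
    by simp
  then have "norm y \<le> (real L * (real L * \<kappa>) + norm E * sqrt (real L)) / real L"
    using L by (simp add: field_simps)
  also have "\<dots> = real L * \<kappa> + norm E / sqrt (real L)"
    using L by (simp add: add_divide_distrib real_div_sqrt) (simp add: field_simps)
  finally show ?thesis by (simp add: y_def)
qed

section \<open>The discriminant of a periodic Jacobi matrix\<close>

text \<open>The one-step transfer matrix, with the spectral parameter as polynomial variable. It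
  acts on the pairs \<open>(u n, a (n - 1) * u (n - 1))\<close>; the factor \<open>a (n - 1)\<close>
  normalizes the determinant to 1.\<close>

definition step_mat :: "(int \<Rightarrow> real) \<Rightarrow> (int \<Rightarrow> real) \<Rightarrow> int \<Rightarrow> real poly^2^2" where
  "step_mat a b n = vector [vector [[:- b n / a n, 1 / a n:], [:- 1 / a n:]], vector [[:a n:], 0]]"

primrec transfer :: "(int \<Rightarrow> real) \<Rightarrow> (int \<Rightarrow> real) \<Rightarrow> int \<Rightarrow> nat \<Rightarrow> real poly^2^2" where
  "transfer a b n 0 = mat 1"
| "transfer a b n (Suc j) = step_mat a b (n + int j) ** transfer a b n j"

lemma matrix_2_eq_iff: "(A = B) \<longleftrightarrow> A$1$1 = B$1$1 \<and> A$1$2 = B$1$2 \<and> A$2$1 = B$2$1 \<and> A$2$2 = B$2$2"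
  for A B :: "'a^2^2"
  by (auto simp: vec_eq_iff forall_2)

lemma transfer_Suc_right:
  "transfer a b n (Suc j) = transfer a b (n + 1) j ** step_mat a b n"
proof (induction j)
  case (Suc j)
  have "transfer a b n (Suc (Suc j)) = step_mat a b (n + 1 + int j) ** transfer a b n (Suc j)"
    by (simp add: add.commute add.left_commute)
  also have "\<dots> = transfer a b (n + 1) (Suc j) ** step_mat a b n"
    unfolding Suc by (simp add: matrix_mul_assoc)
  finally show ?case .
qed simp

lemma transfer_Suc_entries:
  "transfer a b n (Suc j) $ 1 $ k = [:- b (n + int j) / a (n + int j), 1 / a (n + int j):] * transfer a b n j $ 1 $ k
     + [:- 1 / a (n + int j):] * transfer a b n j $ 2 $ k"
  "transfer a b n (Suc j) $ 2 $ k = [:a (n + int j):] * transfer a b n j $ 1 $ k"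
  by (simp_all add: matrix_matrix_mult_def sum_2 step_mat_def)

lemma det_step_mat: "a n \<noteq> 0 \<Longrightarrow> det (step_mat a b n) = 1"
  by (simp add: det_2 step_mat_def one_pCons)

lemma det_transfer: "(\<And>n. a n \<noteq> 0) \<Longrightarrow> det (transfer a b n j) = 1"
  by (induction j) (simp_all add: det_mul det_step_mat)

lemma step_mat_inverse:
  assumes "a n \<noteq> 0"
  shows "\<exists>B. step_mat a b n ** B = mat 1 \<and> B ** step_mat a b n = mat 1"
  using assms
  by (intro exI[of _ "vector [vector [0, [:1 / a n:]], vector [[:- a n:], [:- b n / a n, 1 / a n:]]]"])
    (simp add: matrix_2_eq_iff step_mat_def matrix_matrix_mult_def sum_2 mat_def one_pCons)

text \<open>By periodicity, moving the starting point by one conjugates the matrix over a period by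
  a single step matrix.\<close>

lemma trace_transfer_const:
  assumes "\<And>n. a n \<noteq> 0" and per: "\<And>n. a (n + int q) = a n" "\<And>n. b (n + int q) = b n"
  shows "trace (transfer a b n q) = trace (transfer a b 0 q)"
proof -
  have step: "trace (transfer a b (n + 1) q) = trace (transfer a b n q)" for n
  proof -
    let ?A = "step_mat a b n"
    obtain B where B: "?A ** B = mat 1" "B ** ?A = mat 1"
      using step_mat_inverse[of a n b, OF assms(1)] by blast
    have "transfer a b (n + 1) q ** ?A = step_mat a b (n + int q) ** transfer a b n q"
      using transfer_Suc_right[of a b n q] by simp
    also have "step_mat a b (n + int q) = ?A" by (simp add: step_mat_def per)
    finally have "transfer a b (n + 1) q ** ?A ** B = ?A ** (transfer a b n q ** B)"
      by (simp add: matrix_mul_assoc)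
    then have "transfer a b (n + 1) q = ?A ** (transfer a b n q ** B)"
      by (metis B(1) matrix_mul_assoc matrix_mul_rid)
    then have "trace (transfer a b (n + 1) q) = trace (transfer a b n q ** B ** ?A)"
      by (metis trace_mul_sym)
    then show ?thesis by (metis B(2) matrix_mul_assoc matrix_mul_rid)
  qed
  show ?thesis
  proof (induction n rule: int_induct[where k = 0])
    case (step2 i)
    then show ?case using step[of "i - 1"] by simp
  qed (simp_all add: step)
qed

lemma poly_op_pCons_0_right:
  assumes "S = poly_op P r" shows "poly_op P (pCons 0 r) = S * P"
  using poly_op_commute[of P P r] assms by simp

text \<open>Every sequence solves the eigenvalue recursion once multiplication by the spectral
  parameter is read as application of \<open>jac a b\<close>. So the transfer matrices, evaluated at
  the operator, carry coordinates from \<open>n\<close> to \<open>n + j\<close>.\<close>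

lemma coord_transfer:
  assumes J: "jacobi_coeffs a b" and a: "\<And>n. a n \<noteq> 0"
  defines "act \<equiv> \<lambda>r \<phi> n. coord (app (poly_op (jac a b) r) \<phi>) n"
  shows "coord \<phi> (n + int j) = act (transfer a b n j $ 1 $ 1) \<phi> n
      + of_real (a (n - 1)) * act (transfer a b n j $ 1 $ 2) \<phi> (n - 1)"
    and "of_real (a (n + int j - 1)) * coord \<phi> (n + int j - 1) = act (transfer a b n j $ 2 $ 1) \<phi> n
      + of_real (a (n - 1)) * act (transfer a b n j $ 2 $ 2) \<phi> (n - 1)"
proof (induction j arbitrary: \<phi>)
  case 0
  {
    case 1
    show ?case by (simp add: act_def mat_def)
  next
    case 2
    show ?case by (simp add: act_def mat_def)
  }
next
  case (Suc j)
  let ?P = "jac a b" and ?T = "transfer a b n j" and ?m = "n + int j"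
  have act: "act ([:x, y:] * r + [:u:] * s) \<phi> k
      = of_real x * act r \<phi> k + of_real y * act r (app ?P \<phi>) k + of_real u * act s \<phi> k" for x y u r s k \<phi>
  proof -
    have "poly_op ?P ([:x, y:] * r + [:u:] * s)
        = x *\<^sub>R poly_op ?P r + y *\<^sub>R (poly_op ?P r * ?P) + u *\<^sub>R poly_op ?P s"
      by (simp add: poly_op_add poly_op_smult poly_op_pCons_0_right[OF refl] del: poly_op_pCons)
    then show ?thesis by (simp add: act_def)
  qed
  {
    case 1
    have "of_real (a ?m) * coord \<phi> (?m + 1) = coord (app ?P \<phi>) ?m - of_real (b ?m) * coord \<phi> ?m
        - of_real (a (?m - 1)) * coord \<phi> (?m - 1)"
      by (simp add: coord_jac[OF J])
    then have "coord \<phi> (?m + 1) = of_real (- b ?m / a ?m) * coord \<phi> ?m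
        + of_real (1 / a ?m) * coord (app ?P \<phi>) ?m
        + of_real (- 1 / a ?m) * (of_real (a (?m - 1)) * coord \<phi> (?m - 1))"
    proof -
      assume *: "of_real (a ?m) * coord \<phi> (?m + 1) = coord (app ?P \<phi>) ?m - of_real (b ?m) * coord \<phi> ?m
        - of_real (a (?m - 1)) * coord \<phi> (?m - 1)"
      have "coord \<phi> (?m + 1) = of_real (a ?m) * coord \<phi> (?m + 1) / of_real (a ?m)"
        using a[of ?m] by simp
      then show ?thesis unfolding * by (simp add: diff_divide_distrib)
    qed
    then show ?case
      unfolding Suc transfer_Suc_entries act by (simp add: algebra_simps)
  next
    case 2
    have "act ([:u:] * s) \<phi> k = of_real u * act s \<phi> k" for u s k
      by (simp add: act_def poly_op_smult)
    then show ?case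
      unfolding transfer_Suc_entries by (simp add: Suc(1) algebra_simps)
  }
qed

lemma poly_weight_linear_mult_le:
  assumes "0 \<le> \<sigma>"
  shows "poly_weight \<sigma> ([:x, y:] * r) \<le> (\<bar>x\<bar> + \<sigma> * \<bar>y\<bar>) * poly_weight \<sigma> r"
  using poly_weight_add_le[OF assms, of "smult x r" "pCons 0 (smult y r)"]
  by (simp add: poly_weight_smult algebra_simps)

lemma poly_weight_const_mult: "poly_weight \<sigma> ([:x:] * r) = \<bar>x\<bar> * poly_weight \<sigma> r"
  by (simp add: poly_weight_smult)

lemma poly_weight_transfer_le:
  assumes M: "1 \<le> M" "\<And>n. 1 / M \<le> a n" "\<And>n. a n \<le> M" "\<And>n. \<bar>b n\<bar> \<le> M" and \<sigma>: "0 \<le> \<sigma>"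
  shows "poly_weight \<sigma> (transfer a b n j $ i $ k) \<le> (M * (M + \<sigma> + 1)) ^ j"
proof (induction j arbitrary: i k)
  case 0
  then show ?case by (simp add: mat_def one_pCons)
next
  case (Suc j)
  let ?c = "(M * (M + \<sigma> + 1)) ^ j" and ?T = "transfer a b n j" and ?m = "n + int j"
  have a: "0 < a ?m" "\<bar>a ?m\<bar> \<le> M" "1 / a ?m \<le> M"
  proof -
    have "0 < 1 / M" using M(1) by simp
    then show "0 < a ?m" using M(2)[of ?m] by linarith
    then show "\<bar>a ?m\<bar> \<le> M" "1 / a ?m \<le> M"
      using M(1) M(2)[of ?m] M(3)[of ?m] by (simp_all add: field_simps)
  qed
  have w: "0 \<le> poly_weight \<sigma> r" for r by (rule poly_weight_nonneg) fact
  have top: "poly_weight \<sigma> ([:- b ?m / a ?m, 1 / a ?m:] * ?T $ 1 $ k + [:- 1 / a ?m:] * ?T $ 2 $ k)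
      \<le> M * (M + \<sigma> + 1) * ?c" for k
  proof -
    have "\<bar>- b ?m / a ?m\<bar> + \<sigma> * \<bar>1 / a ?m\<bar> = (\<bar>b ?m\<bar> + \<sigma>) * (1 / a ?m)"
      using a(1) by (simp add: field_simps)
    also have "\<dots> \<le> (M + \<sigma>) * M"
      using M a \<sigma> by (intro mult_mono add_mono) auto
    finally have 1: "(\<bar>- b ?m / a ?m\<bar> + \<sigma> * \<bar>1 / a ?m\<bar>) * poly_weight \<sigma> (?T $ 1 $ k) \<le> (M + \<sigma>) * M * ?c"
      using M(1) \<sigma> by (intro mult_mono Suc w) auto
    have "\<bar>- 1 / a ?m\<bar> \<le> M" using a by simp
    then have 2: "\<bar>- 1 / a ?m\<bar> * poly_weight \<sigma> (?T $ 2 $ k) \<le> M * ?c"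
      using M(1) by (intro mult_mono Suc w) auto
    have "poly_weight \<sigma> ([:- b ?m / a ?m, 1 / a ?m:] * ?T $ 1 $ k + [:- 1 / a ?m:] * ?T $ 2 $ k)
        \<le> (M + \<sigma>) * M * ?c + M * ?c"
      using poly_weight_add_le[OF \<sigma>, of "[:- b ?m / a ?m, 1 / a ?m:] * ?T $ 1 $ k" "[:- 1 / a ?m:] * ?T $ 2 $ k"]
        poly_weight_linear_mult_le[OF \<sigma>, of "- b ?m / a ?m" "1 / a ?m" "?T $ 1 $ k"] 1 2
      unfolding poly_weight_const_mult by linarith
    then show ?thesis by (simp add: algebra_simps)
  qed
  have bot: "poly_weight \<sigma> ([:a ?m:] * ?T $ 1 $ k) \<le> M * (M + \<sigma> + 1) * ?c" for k
    unfolding poly_weight_const_mult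
    using M(1) \<sigma> by (intro mult_mono Suc w order_trans[OF a(2)]) auto
  show ?case
    using top[of k] bot[of k] exhaust_2[of i] unfolding power_Suc by (metis transfer_Suc_entries)
qed

text \<open>Cayley-Hamilton for the transfer matrix over one period, which has determinant 1.\<close>

lemma discriminant_exists:
  assumes J: "jacobi_coeffs a b" and q: "q > 0"
    and per: "\<And>n. a (n + int q) = a n" "\<And>n. b (n + int q) = b n"
    and M: "1 \<le> M" "\<And>n. 1 / M \<le> a n" "\<And>n. a n \<le> M" "\<And>n. \<bar>b n\<bar> \<le> M" and \<sigma>: "0 \<le> \<sigma>"
  shows "\<exists>r. poly_op (jac a b) r = shift (int q) + shift (- int q) \<and>
    poly_weight \<sigma> r \<le> (2 * M * (M + \<sigma> + 1)) ^ q"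
proof (intro exI conjI)
  have a: "a n \<noteq> 0" for n
    using M(1) M(2)[of n] by (smt (verit) divide_pos_pos)
  let ?r = "trace (transfer a b 0 q)"
  let ?act = "\<lambda>r \<phi> n. coord (app (poly_op (jac a b) r) \<phi>) n"
  have main: "coord \<phi> (n + 2 * int q) = ?act ?r \<phi> (n + int q) - coord \<phi> n" for \<phi> n
  proof -
    let ?T = "transfer a b n q"
    have tr: "?r = ?T $ 1 $ 1 + ?T $ 2 $ 2"
      using trace_transfer_const[of a q b n, OF a per] by (simp add: trace_def sum_2)
    have dt: "?T $ 1 $ 1 * ?T $ 2 $ 2 - ?T $ 1 $ 2 * ?T $ 2 $ 1 = 1"
      using det_transfer[of a b n q, OF a] by (simp add: det_2)
    have T': "transfer a b (n + int q) j = transfer a b n j" for j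
    proof (induction j)
      case (Suc j)
      have "step_mat a b (n + int q + int j) = step_mat a b (n + int j)"
        using per[of "n + int j"] by (simp add: step_mat_def add.commute add.left_commute)
      then show ?case by (simp add: Suc)
    qed simp
    note ct = coord_transfer[where a = a and b = b, OF J a]
    have "coord \<phi> (n + 2 * int q) = ?act (?T $ 1 $ 1) \<phi> (n + int q)
        + of_real (a (n + int q - 1)) * ?act (?T $ 1 $ 2) \<phi> (n + int q - 1)"
      using ct(1)[of \<phi> "n + int q" q] by (simp add: T' add.commute)
    also have "of_real (a (n + int q - 1)) * ?act (?T $ 1 $ 2) \<phi> (n + int q - 1)
        = ?act (?T $ 2 $ 1 * ?T $ 1 $ 2) \<phi> n + of_real (a (n - 1)) * ?act (?T $ 2 $ 2 * ?T $ 1 $ 2) \<phi> (n - 1)"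
      using ct(2)[where j = q and n = n and \<phi> = "app (poly_op (jac a b) (?T $ 1 $ 2)) \<phi>"]
      by (simp add: poly_op_mult)
    \<comment> \<open>The first row of the transfer relation, applied to
      \<open>T\<^sub>2\<^sub>2 \<phi>\<close> and solved for its term at \<open>n - 1\<close>. This
      completes the trace and leaves the determinant.\<close>
    also have "of_real (a (n - 1)) * ?act (?T $ 2 $ 2 * ?T $ 1 $ 2) \<phi> (n - 1)
        = ?act (?T $ 2 $ 2) \<phi> (n + int q) - ?act (?T $ 1 $ 1 * ?T $ 2 $ 2) \<phi> n"
      using ct(1)[where j = q and n = n and \<phi> = "app (poly_op (jac a b) (?T $ 2 $ 2)) \<phi>"]
      by (simp add: poly_op_mult[symmetric] app_mult[symmetric] mult.commute del: app_mult)
    finally have "coord \<phi> (n + 2 * int q) = ?act ?r \<phi> (n + int q)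
        - ?act (?T $ 1 $ 1 * ?T $ 2 $ 2 - ?T $ 1 $ 2 * ?T $ 2 $ 1) \<phi> n"
      by (simp add: tr poly_op_add poly_op_diff mult.commute)
    then show ?thesis by (simp add: dt)
  qed
  show "poly_op (jac a b) ?r = shift (int q) + shift (- int q)"
  proof (intro bop_eqI ell2_eqI)
    fix \<phi> n
    show "coord (app (poly_op (jac a b) ?r) \<phi>) n = coord (app (shift (int q) + shift (- int q)) \<phi>) n"
      using main[of \<phi> "n - int q"] by (simp add: algebra_simps)
  qed
  let ?c = "M * (M + \<sigma> + 1)"
  have t: "poly_weight \<sigma> (transfer a b 0 q $ i $ k) \<le> ?c ^ q" for i k
    using poly_weight_transfer_le[where a = a and b = b] M \<sigma> by blast
  have "poly_weight \<sigma> ?r \<le> ?c ^ q + ?c ^ q"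
    using poly_weight_add_le[OF \<sigma>, of "transfer a b 0 q $ 1 $ 1" "transfer a b 0 q $ 2 $ 2"]
      t[of 1 1] t[of 2 2]
    by (simp add: trace_def sum_2)
  \<comment> \<open>The factor 2 from the trace is enlarged to \<open>2 ^ q\<close> so that the
    bound is a pure \<open>q\<close>-th power.\<close>
  also have "\<dots> \<le> 2 ^ q * ?c ^ q"
  proof -
    have "(2::real) ^ 1 \<le> 2 ^ q" using q by (intro power_increasing) auto
    moreover have "0 \<le> ?c ^ q" using M(1) \<sigma> by (intro zero_le_power mult_nonneg_nonneg) auto
    ultimately show ?thesis using mult_right_mono[of 2 "2 ^ q" "?c ^ q"] by simp
  qed
  finally show "poly_weight \<sigma> ?r \<le> (2 * M * (M + \<sigma> + 1)) ^ q"
    by (simp add: power_mult_distrib mult.assoc)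
qed

section \<open>Quantitative averages for a periodic Jacobi matrix\<close>

definition mean :: "(int \<Rightarrow> real) \<Rightarrow> (int \<Rightarrow> real) \<Rightarrow> real \<Rightarrow> ell2 bop" where
  "mean a b t = (1 / t) *\<^sub>R accumulated (iop * jac a b) (iop * jac_comm a) t"

lemma norm_jac_le:
  assumes "jacobi_coeffs a b" "\<And>n. \<bar>a n\<bar> \<le> M" "\<And>n. \<bar>b n\<bar> \<le> M"
  shows "norm (jac a b) \<le> 3 * M"
proof -
  have "norm (wshift (\<lambda>n. a (n - 1)) (- 1) + wshift b 0 + wshift a 1) \<le> M + M + M"
    by (intro norm_triangle_mono norm_wshift_le assms)
  then show ?thesis by (simp add: jac_eq[OF assms(1)])
qed

lemma norm_jac_comm_le:
  assumes "\<And>n. \<bar>a n\<bar> \<le> M" shows "norm (jac_comm a) \<le> 2 * M"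
proof -
  have "norm (wshift a 1) + norm (wshift (\<lambda>n. a (n - 1)) (- 1)) \<le> M + M"
    by (intro add_mono norm_wshift_le assms)
  then show ?thesis
    unfolding jac_comm_def using norm_triangle_ineq4[of "wshift a 1" "wshift (\<lambda>n. a (n - 1)) (- 1)"] by linarith
qed

lemma norm_iop_mult [simp]: "norm (iop * T) = norm T"
proof (rule antisym)
  show "norm (iop * T) \<le> norm T" using norm_mult_ineq[of iop T] by simp
  show "norm T \<le> norm (iop * T)"
    using norm_mult_ineq[of iop "iop * T"] by (simp add: mult.assoc[symmetric])
qed

lemma shift_wshift:
  assumes "bounded (range c)" "\<And>n. c (n + k) = c n"
  shows "shift k * wshift c j = wshift c j * shift k"
  by (intro bop_eqI ell2_eqI) (simp add: coord_wshift assms algebra_simps)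

lemma has_commutator_shift_sum:
  "has_commutator resolvent (shift k + shift (- k)) (of_int k *\<^sub>R (shift k - shift (- k)))"
  using has_commutator_add[OF has_commutator_wshift[of "\<lambda>_. 1" k] has_commutator_wshift[of "\<lambda>_. 1" "- k"]]
  by (simp add: algebra_simps)

text \<open>\<open>S\<^sup>2\<^sup>q - 1 = S\<^sup>q (S\<^sup>q - S\<^sup>-\<^sup>q)\<close>: up to
  an isometry and the factor \<open>q\<close>, the conserved \<open>B\<close> is a single shift
  minus the identity, as the averaging over shifts requires.\<close>

lemma shift_minus_one_eq:
  assumes "q > 0"
  shows "shift (2 * int q) - 1
    = (1 / real q) *\<^sub>R (- (shift (int q) * iop) * (real q *\<^sub>R (iop * (shift (int q) - shift (- int q)))))"
  using assms by (intro bop_eqI ell2_eqI) (simp add: algebra_simps)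

lemma norm_shift_minus_one_le:
  assumes "q > 0"
  shows "norm ((shift (2 * int q) - 1) * T)
    \<le> norm (real q *\<^sub>R (iop * (shift (int q) - shift (- int q))) * T)"
    and "norm (app (shift (2 * int q) - 1) \<phi>)
    \<le> norm (app (real q *\<^sub>R (iop * (shift (int q) - shift (- int q)))) \<phi>)"
proof -
  define B where "B = real q *\<^sub>R (iop * (shift (int q) - shift (- int q)))"
  have eq: "shift (2 * int q) - 1 = (1 / real q) *\<^sub>R (- (shift (int q) * iop) * B)"
    unfolding B_def by (rule shift_minus_one_eq[OF assms])
  have q: "1 / real q \<le> 1" using assms by simp
  have "norm (shift (int q) * iop) \<le> 1"
    using norm_mult_ineq[of "shift (int q)" iop] norm_shift_le[of "int q"] by simp
  then have "norm (shift (int q) * iop * (B * T)) \<le> norm (B * T)"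
    using norm_mult_ineq[of "shift (int q) * iop" "B * T"]
    by (meson mult_left_le_one_le norm_ge_zero order_trans)
  then have "(1 / real q) * norm (shift (int q) * iop * (B * T)) \<le> 1 * norm (B * T)"
    using q by (intro mult_mono) auto
  then show "norm ((shift (2 * int q) - 1) * T) \<le> norm (B * T)"
    unfolding eq by (simp add: mult.assoc)
  have "(1 / real q) * norm (app B \<phi>) \<le> 1 * norm (app B \<phi>)"
    using q by (intro mult_mono) auto
  then show "norm (app (shift (2 * int q) - 1) \<phi>) \<le> norm (app B \<phi>)"
    unfolding eq by simp
qed

context
  fixes a b :: "int \<Rightarrow> real" and q :: nat and M :: real
  assumes J: "jacobi_coeffs a b" and q: "q > 0"
    and per: "\<And>n. a (n + int q) = a n" "\<And>n. b (n + int q) = b n"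
    and M: "1 \<le> M" "\<And>n. 1 / M \<le> a n" "\<And>n. a n \<le> M" "\<And>n. \<bar>b n\<bar> \<le> M"
begin

lemma abs_coeff_le: "\<bar>a n\<bar> \<le> M"
proof -
  have "0 < 1 / M" using M(1) by simp
  then show ?thesis using M(2,3)[of n] by linarith
qed

lemma shift_commute:
  "shift (int q) * jac a b = jac a b * shift (int q)"
  "shift (int q) * jac_comm a = jac_comm a * shift (int q)"
  "shift (int q) * iop = iop * shift (int q)"
proof -
  note c = jacobi_coeffs_bounded[OF J]
  have per': "a (n + int q - 1) = a (n - 1)" for n
    using per(1)[of "n - 1"] by (simp add: algebra_simps)
  show "shift (int q) * jac a b = jac a b * shift (int q)"
    "shift (int q) * jac_comm a = jac_comm a * shift (int q)"
    by (simp_all add: jac_eq[OF J] jac_comm_def shift_wshift c per per' distrib_left distrib_right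
        left_diff_distrib right_diff_distrib)
  show "shift (int q) * iop = iop * shift (int q)"
    by (simp add: iop_wshift)
qed

text \<open>The commutator with \<open>X\<close> of the discriminant is computed twice: as a
  derivation of a polynomial in \<open>P\<close>, and from
  \<open>S\<^sup>q + S\<^sup>-\<^sup>q\<close>. Uniqueness identifies the two.\<close>

lemma conserved:
  "\<exists>r. poly_weight (6 * M) r \<le> (2 * M * (7 * M + 1)) ^ q \<and>
    conserved_derivation iop (jac a b) (iop * jac_comm a)
      (real q *\<^sub>R (iop * (shift (int q) - shift (- int q)))) r (3 * M)"
proof -
  let ?P = "jac a b" and ?S = "shift (int q)" and ?S' = "shift (- int q)"
  \<comment> \<open>\<open>6 * M\<close> is twice the bound \<open>3 * M\<close> for the norm of
    \<open>?P\<close>, the radius at which \<open>conserved_derivation\<close> evaluates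
    weights.\<close>
  obtain r where r: "poly_op ?P r = ?S + ?S'" "poly_weight (6 * M) r \<le> (2 * M * (M + 6 * M + 1)) ^ q"
    using discriminant_exists[where a = a and b = b, OF J q per M, of "6 * M"] M(1) by auto
  have "has_commutator resolvent (?S + ?S') (poly_variation ?P (jac_comm a) r)"
    using has_commutator_poly_op[OF has_commutator_jac[OF J], of r] by (simp add: r)
  from has_commutator_unique[OF this has_commutator_shift_sum]
  have v: "poly_variation ?P (iop * jac_comm a) r = real q *\<^sub>R (iop * (?S - ?S'))"
    by (simp add: poly_variation_scale iop_jac[OF J])
  have "?S' * T = T * ?S'" if "?S * T = T * ?S" for T
  proof -
    have "?S' * (?S * T) * ?S' = ?S' * (T * ?S) * ?S'" using that by simp
    then have "(?S' * ?S) * T * ?S' = ?S' * T * (?S * ?S')" by (simp add: mult.assoc)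
    then show ?thesis by (simp add: shift_add shift_0)
  qed
  note c = shift_commute this[OF shift_commute(1)] this[OF shift_commute(2)] this[OF shift_commute(3)]
  have S_comm: "T * (iop * (?S - ?S')) = iop * (?S - ?S') * T"
    if "iop * T = T * iop" "?S * T = T * ?S" "?S' * T = T * ?S'" for T
    using that by (intro commute_mult) (simp_all add: algebra_simps)
  have "conserved_derivation iop ?P (iop * jac_comm a) (real q *\<^sub>R (iop * (?S - ?S'))) r (3 * M)"
  proof
    show "iop * (iop * jac_comm a) = iop * jac_comm a * iop"
      by (rule commute_mult[OF refl iop_jac_comm[OF J]])
    show "norm (exp (s *\<^sub>R (iop * ?P))) \<le> 1" for s by (rule norm_exp_jac_le[OF J])
    show "norm ?P \<le> 3 * M" by (intro norm_jac_le J abs_coeff_le M)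
    show "real q *\<^sub>R (iop * (?S - ?S')) * ?P = ?P * real q *\<^sub>R (iop * (?S - ?S'))"
      using S_comm[of ?P] c iop_jac[OF J] by simp
    show "real q *\<^sub>R (iop * (?S - ?S')) * iop = iop * real q *\<^sub>R (iop * (?S - ?S'))"
      using S_comm[of iop] c by simp
    have "iop * (iop * jac_comm a) = iop * jac_comm a * iop" "?S * (iop * jac_comm a) = iop * jac_comm a * ?S"
      "?S' * (iop * jac_comm a) = iop * jac_comm a * ?S'"
      by (intro commute_mult c iop_jac_comm[OF J] refl)+
    from S_comm[OF this]
    show "real q *\<^sub>R (iop * (?S - ?S')) * (iop * jac_comm a) = iop * jac_comm a * real q *\<^sub>R (iop * (?S - ?S'))"
      by simp
  qed (use v M(1) iop_jac[OF J] in simp_all)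
  then show ?thesis using r by (intro exI[of _ r]) (simp add: algebra_simps)
qed

text \<open>\<open>L\<close> is left free: the first error grows and the second shrinks with it.
  \<open>T\<close> bounds both times from below only, so the estimate holds for arbitrarily late
  times.\<close>

lemma periodic_mean_Cauchy:
  assumes "T > 0" "s \<ge> T" "t \<ge> T" "L > 0"
  shows "norm (app (mean a b t - mean a b s) (delta m))
    \<le> real L * (16 * M\<^sup>2 * (2 * M * (7 * M + 1)) ^ q / T) + 4 * M / sqrt (real L)"
proof -
  obtain r where r: "poly_weight (6 * M) r \<le> (2 * M * (7 * M + 1)) ^ q"
    and "conserved_derivation iop (jac a b) (iop * jac_comm a)
      (real q *\<^sub>R (iop * (shift (int q) - shift (- int q)))) r (3 * M)"
    using conserved by blast
  then interpret conserved_derivation iop "jac a b" "iop * jac_comm a"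
    "real q *\<^sub>R (iop * (shift (int q) - shift (- int q)))" r "3 * M" by simp
  have av: "mean a b t = average t" for t by (simp add: mean_def average_def)
  let ?E = "average t - average s"
  have D: "norm (iop * jac_comm a) \<le> 2 * M"
    using norm_jac_comm_le[of a M] abs_coeff_le by simp
  have "shift (int q) * average t = average t * shift (int q)" for t
    by (intro average_commute shift_commute commute_mult)
  then have SE: "shift (int q) * ?E = ?E * shift (int q)"
    by (simp add: algebra_simps)
  have "shift (int q) * shift (int q) * ?E = ?E * (shift (int q) * shift (int q))"
    by (rule commute_mult[OF SE[symmetric] SE[symmetric], symmetric])
  then have comm: "shift (2 * int q) * ?E = ?E * shift (2 * int q)"
    by (simp add: shift_add)
  have "norm ((shift (2 * int q) - 1) * ?E) \<le> 4 * W * (norm (iop * jac_comm a))\<^sup>2 / T"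
    using norm_shift_minus_one_le(1)[OF q, of ?E] norm_B_average_diff_le[OF assms(1-3)] by linarith
  also have "\<dots> \<le> 4 * (2 * M * (7 * M + 1)) ^ q * (2 * M)\<^sup>2 / T"
    using r W_nonneg M(1) assms(1) by (intro divide_right_mono mult_mono power_mono D) auto
  finally have \<kappa>: "norm ((shift (2 * int q) - 1) * ?E) \<le> 16 * M\<^sup>2 * (2 * M * (7 * M + 1)) ^ q / T"
    by (simp add: algebra_simps)
  have "norm ?E \<le> 2 * M + 2 * M"
    using assms D norm_average_le[of t] norm_average_le[of s] norm_triangle_ineq4[of "average t" "average s"]
    by linarith
  then have "norm ?E / sqrt (real L) \<le> 4 * M / sqrt (real L)"
    by (intro divide_right_mono) auto
  moreover have "norm (app ?E (delta m))
    \<le> real L * (16 * M\<^sup>2 * (2 * M * (7 * M + 1)) ^ q / T) + norm ?E / sqrt (real L)"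
    by (rule norm_app_delta_le[OF comm _ assms(4) \<kappa>]) (use q in simp)
  ultimately show ?thesis unfolding av by linarith
qed

text \<open>\<open>B\<close> is \<open>r'\<close> times the mean up to \<open>O(1 / t)\<close>, and
  \<open>r'\<close> is bounded by the weight of the discriminant; so the mean cannot be small where
  \<open>B\<close> is not.\<close>

lemma periodic_mean_lower_bound:
  assumes "t > 0"
  shows "norm (app (shift (2 * int q) - 1) \<phi>)
    \<le> (2 * M * (7 * M + 1)) ^ q * (norm (app (mean a b t) \<phi>) + 4 * M / t * norm \<phi>)"
proof -
  let ?B = "real q *\<^sub>R (iop * (shift (int q) - shift (- int q)))" and ?C = "(2 * M * (7 * M + 1)) ^ q"
  obtain r where r: "poly_weight (6 * M) r \<le> (2 * M * (7 * M + 1)) ^ q"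
    and "conserved_derivation iop (jac a b) (iop * jac_comm a) ?B r (3 * M)"
    using conserved by blast
  then interpret conserved_derivation iop "jac a b" "iop * jac_comm a" ?B r "3 * M" by simp
  have av: "mean a b t = average t" for t by (simp add: mean_def average_def)
  have D: "norm (iop * jac_comm a) \<le> 2 * M"
    using norm_jac_comm_le[of a M] abs_coeff_le by simp
  have "norm (r' * average t - ?B) \<le> 2 * W * norm (iop * jac_comm a) / t"
    by (rule pderiv_average_left) fact
  also have "\<dots> \<le> 2 * ?C * (2 * M) / t"
    using r W_nonneg M(1) assms by (intro divide_right_mono mult_mono D) auto
  finally have 1: "norm (r' * average t - ?B) \<le> ?C * (4 * M / t)" by (simp add: algebra_simps)
  have "norm r' \<le> ?C"
    using norm_poly_op_pderiv_le[OF norm_P \<rho>, of r] r by simp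
  then have 2: "norm (app r' (app (average t) \<phi>)) \<le> ?C * norm (app (average t) \<phi>)"
    by (intro order_trans[OF norm_app_le] mult_right_mono) auto
  have "app ?B \<phi> = app r' (app (average t) \<phi>) - app (r' * average t - ?B) \<phi>"
    by simp
  also have "norm \<dots> \<le> ?C * norm (app (average t) \<phi>) + ?C * (4 * M / t) * norm \<phi>"
    by (intro norm_triangle_le_diff add_mono 2 order_trans[OF norm_app_le] mult_right_mono 1) auto
  finally have "norm (app ?B \<phi>) \<le> ?C * (norm (app (average t) \<phi>) + 4 * M / t * norm \<phi>)"
    by (simp only: distrib_left mult.assoc)
  then show ?thesis
    using norm_shift_minus_one_le(2)[OF q, of \<phi>] unfolding av by linarith
qed

end

section \<open>Limit-periodic Jacobi matrices\<close>

lemma norm_coord_app_delta_le: "cmod (coord (app T (delta m)) n) \<le> norm T"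
  using norm_coord_le[of "app T (delta m)" n] norm_app_le[of T "delta m"] by simp

lemma coeffs_diff_le:
  assumes "jacobi_coeffs a b" "jacobi_coeffs a' b'"
  shows "\<bar>a n - a' n\<bar> \<le> norm (jac a b - jac a' b')" "\<bar>b n - b' n\<bar> \<le> norm (jac a b - jac a' b')"
proof -
  let ?T = "jac a b - jac a' b'"
  have "coord (app ?T (delta (n + 1))) n = of_real (a n - a' n)"
    "coord (app ?T (delta n)) n = of_real (b n - b' n)"
    by (simp_all add: coord_jac assms coord_delta)
  then show "\<bar>a n - a' n\<bar> \<le> norm ?T" "\<bar>b n - b' n\<bar> \<le> norm ?T"
    using norm_coord_app_delta_le[of ?T "n + 1" n] norm_coord_app_delta_le[of ?T n n]
    by (simp_all only: norm_of_real)
qed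

lemma coeffs_le:
  assumes "jacobi_coeffs a b"
  shows "\<bar>a n\<bar> \<le> norm (jac a b)" "\<bar>b n\<bar> \<le> norm (jac a b)"
proof -
  let ?T = "jac a b"
  have "coord (app ?T (delta (n + 1))) n = of_real (a n)"
    "coord (app ?T (delta n)) n = of_real (b n)"
    by (simp_all add: coord_jac assms coord_delta)
  then show "\<bar>a n\<bar> \<le> norm ?T" "\<bar>b n\<bar> \<le> norm ?T"
    using norm_coord_app_delta_le[of ?T "n + 1" n] norm_coord_app_delta_le[of ?T n n]
    by (simp_all only: norm_of_real)
qed

lemma norm_jac_comm_diff_le:
  assumes "jacobi_coeffs a b" "jacobi_coeffs a' b'"
  shows "norm (jac_comm a - jac_comm a') \<le> 2 * norm (jac a b - jac a' b')"
proof -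
  note c = jacobi_coeffs_bounded[OF assms(1)] jacobi_coeffs_bounded[OF assms(2)]
  have "bounded (range (\<lambda>n. a n - a' n))" "bounded (range (\<lambda>n. a (n - 1) - a' (n - 1)))"
    using c by (auto intro: bounded_minus_comp)
  then have "jac_comm a - jac_comm a' = jac_comm (\<lambda>n. a n - a' n)"
    unfolding jac_comm_def
    by (intro bop_eqI ell2_eqI) (simp add: coord_wshift c algebra_simps)
  then show ?thesis
    using norm_jac_comm_le[of "\<lambda>n. a n - a' n"] coeffs_diff_le[OF assms] by simp
qed

lemma norm_mean_diff_le:
  assumes J: "jacobi_coeffs a b" and J': "jacobi_coeffs a' b'" and t: "t > 0"
  shows "norm (mean a b t - mean a' b' t)
    \<le> (4 * norm (jac a b) * t + 2) * norm (jac a b - jac a' b')"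
proof -
  let ?e = "norm (jac a b - jac a' b')" and ?K = "iop * jac a b" and ?K' = "iop * jac a' b'"
  let ?D = "iop * jac_comm a" and ?D' = "iop * jac_comm a'"
  have "norm (accumulated ?K ?D t - accumulated ?K' ?D' t)
      \<le> ((4 * norm (jac a b) * t + 2) * ?e) * t"
  proof (rule norm_accumulated_diff_le)
    fix s assume s: "s \<in> {0..t}"
    have K: "norm (?K - ?K') = ?e" "norm (?D - ?D') = norm (jac_comm a - jac_comm a')"
      unfolding right_diff_distrib[symmetric] norm_iop_mult by simp_all
    have D: "norm ?D \<le> 2 * norm (jac a b)"
      using norm_jac_comm_le[of a] coeffs_le[OF J] by simp
    have "norm (evolved ?K ?D s - evolved ?K' ?D' s)
        \<le> 2 * norm (?K - ?K') * norm ?D * s + norm (?D - ?D')"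
      using s by (intro norm_evolved_diff_le norm_exp_jac_le J J') auto
    also have "\<dots> \<le> 2 * ?e * (2 * norm (jac a b)) * t + 2 * ?e"
      unfolding K using s D norm_jac_comm_diff_le[OF J J']
      by (intro add_mono mult_mono) auto
    finally show "norm (evolved ?K ?D s - evolved ?K' ?D' s) \<le> (4 * norm (jac a b) * t + 2) * ?e"
      by (simp add: algebra_simps)
  qed (use t in simp)
  moreover have "mean a b t - mean a' b' t = (1 / t) *\<^sub>R (accumulated ?K ?D t - accumulated ?K' ?D' t)"
    by (simp add: mean_def scaleR_diff_right)
  ultimately show ?thesis
    using t by (simp add: divide_le_eq)
qed

lemma iop_mean: "jacobi_coeffs a b \<Longrightarrow> iop * mean a b t = mean a b t * iop"
  using accumulated_commute[of iop "iop * jac a b" "iop * jac_comm a" t]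
    commute_mult[OF refl iop_jac, of a b] commute_mult[OF refl iop_jac_comm, of a b]
  by (simp add: mean_def)

lemma norm_mean_le:
  assumes "jacobi_coeffs a b" "t > 0"
  shows "norm (mean a b t) \<le> norm (jac_comm a)"
  using norm_accumulated_le[OF norm_exp_jac_le[OF assms(1)], of t "iop * jac_comm a"] assms(2)
  by (simp add: mean_def field_simps)

definition ell1_norm :: "ell2 \<Rightarrow> real" where
  "ell1_norm \<phi> = (\<Sum>\<^sub>\<infinity>n. cmod (coord \<phi> n))"

lemma ell1_norm_nonneg: "0 \<le> ell1_norm \<phi>"
  unfolding ell1_norm_def by (intro infsum_nonneg) simp

lemma norm_app_ell1_norm_le:
  "iop * T = T * iop \<Longrightarrow> (\<And>n. norm (app T (delta n)) \<le> \<mu>) \<Longrightarrow> \<phi> \<in> ell1 \<Longrightarrow>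
    norm (app T \<phi>) \<le> \<mu> * ell1_norm \<phi>"
  unfolding ell1_norm_def by (rule norm_app_ell1_le)

text \<open>One scale of the approximation: the matrix of period \<open>q\<close> controls the averages of the
  limit-periodic one on the time interval from \<open>C\<^sup>7\<^sup>q\<close> to \<open>C\<^sup>7\<^sup>q\<^sup>'\<close>, where \<open>q'\<close> is the next period.
  The shift average is taken over \<open>C\<^sup>4\<^sup>q\<close> terms. The errors are \<open>O(C\<^sup>-\<^sup>2\<^sup>q)\<close>, which is
  small compared with the lower bound \<open>C\<^sup>-\<^sup>q\<close> for the size of the averages.\<close>

lemma scale_estimates:
  fixes R :: real and q q' :: nat
  defines "C \<equiv> 4 * R * (14 * R + 1)" and "\<kappa> \<equiv> 128 * R\<^sup>2 + 8 * R + 2"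
  assumes J: "jacobi_coeffs a b" and P: "jacobi_coeffs a' b'" and q: "q > 0" "q < q'"
    and per: "\<And>n. a' (n + int q) = a' n" "\<And>n. b' (n + int q) = b' n"
    and R: "norm (jac a b) \<le> R" "\<And>n. 1 / R \<le> a n" "R > 0"
    and eps: "norm (jac a b - jac a' b') \<le> 1 / C ^ (14 * q')"
  shows "\<And>\<phi> s t. \<phi> \<in> ell1 \<Longrightarrow> s \<in> {C ^ (7 * q)..C ^ (7 * q')} \<Longrightarrow> t \<in> {C ^ (7 * q)..C ^ (7 * q')} \<Longrightarrow>
      norm (app (mean a b t - mean a b s) \<phi>) \<le> \<kappa> / C ^ (2 * q) * ell1_norm \<phi>"
    and "\<And>\<phi>. norm (app (shift (2 * int q) - 1) \<phi>)
      \<le> C ^ q * (norm (app (mean a b (C ^ (7 * q))) \<phi>) + \<kappa> / C ^ (2 * q) * norm \<phi>)"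
proof -
  let ?e = "norm (jac a b - jac a' b')"
  have aR: "\<bar>a n\<bar> \<le> R" "\<bar>b n\<bar> \<le> R" for n
    using coeffs_le[OF J, of n] R(1) by linarith+
  \<comment> \<open>\<open>1 / R \<le> a 0 \<le> R\<close> forces \<open>R \<ge> 1\<close>.\<close>
  have "1 / R \<le> R" using aR(1)[of 0] R(2)[of 0] by linarith
  then have "1 \<le> R\<^sup>2" using R(3) by (simp add: field_simps power2_eq_square)
  then have R1: "1 \<le> R" using R(3) power2_le_imp_le[of 1 R] by simp
  have "1 * 1 \<le> R * (14 * R + 1)" "R * 1 \<le> R * (14 * R + 1)" using R1 by (intro mult_mono; simp)+
  then have C: "4 \<le> C" "4 * R \<le> C" unfolding C_def by simp_all
  have RRC: "4 * R + 2 \<le> C"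
  proof -
    have "C = 56 * (R * R) + 4 * R" by (simp add: C_def algebra_simps)
    moreover have "1 * 1 \<le> R * R" using R1 by (intro mult_mono) auto
    ultimately show ?thesis by linarith
  qed
  have q': "1 \<le> q'" using q by linarith
  have Cq: "C ^ j \<le> C ^ k" if "j \<le> k" for j k
    using that C by (intro power_increasing) auto
  have Cpos: "0 < C ^ j" for j using C by simp
  have C1: "1 \<le> C ^ j" for j using C by (intro one_le_power) simp
  \<comment> \<open>Doubling leaves room for the approximant: its coefficients differ by at most
    \<open>1 / (2 * R)\<close>, so they stay between \<open>1 / (2 * R)\<close> and
    \<open>2 * R\<close>.\<close>
  define M where "M = 2 * R"
  have CM: "2 * M * (7 * M + 1) = C" by (simp add: M_def C_def)
  have "C ^ 1 \<le> C ^ (14 * q')" using q' by (intro Cq) simp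
  then have "1 / C ^ (14 * q') \<le> 1 / C"
    using C by (intro divide_left_mono) auto
  also have "1 / C \<le> 1 / (2 * R)"
    using C R1 by (intro divide_left_mono) auto
  finally have e: "?e \<le> 1 / (2 * R)" using eps by linarith
  have e1: "1 / (2 * R) \<le> R"
    using R1 \<open>1 / R \<le> R\<close> by (simp add: field_simps)
  have M: "1 \<le> M" "1 / M \<le> a' n" "a' n \<le> M" "\<bar>b' n\<bar> \<le> M" for n
  proof -
    have d: "\<bar>a n - a' n\<bar> \<le> 1 / (2 * R)" "\<bar>b n - b' n\<bar> \<le> 1 / (2 * R)"
      using coeffs_diff_le[OF J P, of n] e by linarith+
    show "1 \<le> M" using R1 by (simp add: M_def)
    have "1 / R - 1 / (2 * R) = 1 / M" using R1 by (simp add: M_def field_simps)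
    then show "1 / M \<le> a' n" using R(2)[of n] d(1) by linarith
    show "a' n \<le> M" "\<bar>b' n\<bar> \<le> M"
      using aR[of n] d e1 unfolding M_def by linarith+
  qed
  have close: "norm (mean a b t - mean a' b' t) \<le> 1 / C ^ (2 * q)"
    if t: "t \<in> {C ^ (7 * q)..C ^ (7 * q')}" for t
  proof -
    have t1: "1 \<le> t" using t C1[of "7 * q"] by simp
    have "norm (mean a b t - mean a' b' t) \<le> (4 * norm (jac a b) * t + 2) * ?e"
      using t1 by (intro norm_mean_diff_le J P) simp
    also have "\<dots> \<le> (4 * R * t + 2 * t) * (1 / C ^ (14 * q'))"
      using t1 R(1) R1 by (intro mult_mono add_mono eps) auto
    also have "\<dots> \<le> (C * C ^ (7 * q')) * (1 / C ^ (14 * q'))"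
    proof (intro mult_right_mono)
      have "(4 * R + 2) * t \<le> C * C ^ (7 * q')"
        using t t1 RRC R1 by (intro mult_mono) auto
      then show "4 * R * t + 2 * t \<le> C * C ^ (7 * q')" by (simp add: algebra_simps)
    qed (use Cpos in \<open>simp add: less_imp_le\<close>)
    also have "\<dots> \<le> 1 / C ^ (2 * q)"
    proof -
      have "C * C ^ (7 * q') * C ^ (2 * q) = C ^ (1 + 7 * q' + 2 * q)"
        by (simp add: power_add)
      \<comment> \<open>\<open>1 + 2 * q \<le> 7 * q'\<close> because \<open>q < q'\<close>.\<close>
      also have "\<dots> \<le> C ^ (14 * q')" using q by (intro Cq) simp
      finally show ?thesis using Cpos[of "14 * q'"] Cpos[of "2 * q"] by (simp add: field_simps)
    qed
    finally show ?thesis .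
  qed
  have cmean: "iop * mean a b t = mean a b t * iop" "iop * mean a' b' t = mean a' b' t * iop" for t
    by (rule iop_mean[OF J] iop_mean[OF P])+
  show "norm (app (mean a b t - mean a b s) \<phi>) \<le> \<kappa> / C ^ (2 * q) * ell1_norm \<phi>"
    if \<phi>: "\<phi> \<in> ell1" and s: "s \<in> {C ^ (7 * q)..C ^ (7 * q')}" and t: "t \<in> {C ^ (7 * q)..C ^ (7 * q')}" for \<phi> s t
  proof (rule norm_app_ell1_norm_le[OF _ _ \<phi>])
    show "iop * (mean a b t - mean a b s) = (mean a b t - mean a b s) * iop"
      by (simp add: left_diff_distrib right_diff_distrib cmean)
    fix m
    define L where "L = nat \<lceil>C ^ (4 * q)\<rceil>"
    have L: "C ^ (4 * q) \<le> real L" "real L \<le> 2 * C ^ (4 * q)"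
      using C1[of "4 * q"] by (auto simp: L_def) linarith
    then have L0: "L > 0" using C1[of "4 * q"] by (cases L) auto
    have pm: "norm (app (mean a' b' t - mean a' b' s) (delta m))
        \<le> real L * (16 * M\<^sup>2 * C ^ q / C ^ (7 * q)) + 4 * M / sqrt (real L)"
      using periodic_mean_Cauchy[where a = a' and b = b', OF P q(1) per M, of "C ^ (7 * q)" s t L m] s t L0 Cpos
      unfolding CM by simp
    have 1: "real L * (16 * M\<^sup>2 * C ^ q / C ^ (7 * q)) \<le> 32 * M\<^sup>2 / C ^ (2 * q)"
    proof -
      have eq: "C ^ (7 * q) = C ^ (4 * q) * C ^ q * C ^ (2 * q)" by (simp add: power_add[symmetric])
      have "real L * (16 * M\<^sup>2 * C ^ q / C ^ (7 * q)) \<le> 2 * C ^ (4 * q) * (16 * M\<^sup>2 * C ^ q / C ^ (7 * q))"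
        using Cpos[of q] Cpos[of "7 * q"] by (intro mult_right_mono L) auto
      also have "\<dots> = 32 * M\<^sup>2 / C ^ (2 * q)"
        unfolding eq using Cpos[of q] Cpos[of "4 * q"] Cpos[of "2 * q"] by simp
      finally show ?thesis .
    qed
    have "sqrt (C ^ (4 * q)) = C ^ (2 * q)"
      using Cpos[of "2 * q"] by (intro real_sqrt_unique) (simp_all add: power_mult[symmetric])
    then have "C ^ (2 * q) \<le> sqrt (real L)" using L(1) by (metis real_sqrt_le_iff)
    then have 2: "4 * M / sqrt (real L) \<le> 4 * M / C ^ (2 * q)"
      using M(1) Cpos[of "2 * q"] L0 by (intro divide_left_mono mult_pos_pos) auto
    have "app (mean a b t - mean a b s) (delta m) = app (mean a b t - mean a' b' t) (delta m)
        - app (mean a b s - mean a' b' s) (delta m) + app (mean a' b' t - mean a' b' s) (delta m)"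
      by simp
    also have "norm \<dots> \<le> 1 / C ^ (2 * q) + 1 / C ^ (2 * q) + (32 * M\<^sup>2 / C ^ (2 * q) + 4 * M / C ^ (2 * q))"
    proof (intro norm_triangle_mono norm_triangle_le_diff add_mono)
      have "norm (app (mean a b u - mean a' b' u) (delta m)) \<le> 1 / C ^ (2 * q)"
        if "u \<in> {C ^ (7 * q)..C ^ (7 * q')}" for u
        using norm_app_le[of "mean a b u - mean a' b' u" "delta m"] close[OF that] by simp
      from this[OF t] this[OF s]
      show "norm (app (mean a b t - mean a' b' t) (delta m)) \<le> 1 / C ^ (2 * q)"
        "norm (app (mean a b s - mean a' b' s) (delta m)) \<le> 1 / C ^ (2 * q)" by simp_all
      show "norm (app (mean a' b' t - mean a' b' s) (delta m)) \<le> 32 * M\<^sup>2 / C ^ (2 * q) + 4 * M / C ^ (2 * q)"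
        using pm 1 2 by linarith
    qed
    \<comment> \<open>The origin of \<kappa>: with \<open>M = 2 * R\<close>, two perturbation errors
      and the two terms of the periodic estimate add up to it.\<close>
    also have "\<dots> = \<kappa> / C ^ (2 * q)"
      by (simp add: \<kappa>_def M_def add_divide_distrib power2_eq_square)
    finally show "norm (app (mean a b t - mean a b s) (delta m)) \<le> \<kappa> / C ^ (2 * q)" .
  qed
  show "norm (app (shift (2 * int q) - 1) \<phi>)
      \<le> C ^ q * (norm (app (mean a b (C ^ (7 * q))) \<phi>) + \<kappa> / C ^ (2 * q) * norm \<phi>)" for \<phi>
  proof -
    let ?T = "C ^ (7 * q)"
    have T: "?T \<in> {?T..C ^ (7 * q')}" using q by (auto intro: Cq)
    have "norm (app (mean a' b' ?T) \<phi>) \<le> norm (app (mean a b ?T) \<phi>) + 1 / C ^ (2 * q) * norm \<phi>"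
      using norm_triangle_ineq2[of "app (mean a' b' ?T) \<phi>" "app (mean a b ?T) \<phi>"]
        norm_app_le[of "mean a b ?T - mean a' b' ?T" \<phi>] mult_right_mono[OF close[OF T] norm_ge_zero[of \<phi>]]
      by (simp add: norm_minus_commute)
    moreover have "4 * M / ?T * norm \<phi> \<le> 4 * M / C ^ (2 * q) * norm \<phi>"
      using M(1) by (intro mult_right_mono divide_left_mono Cq mult_pos_pos Cpos) auto
    ultimately have "norm (app (mean a' b' ?T) \<phi>) + 4 * M / ?T * norm \<phi>
        \<le> norm (app (mean a b ?T) \<phi>) + (1 + 4 * M) / C ^ (2 * q) * norm \<phi>"
      by (simp add: add_divide_distrib distrib_right)
    also have "\<dots> \<le> norm (app (mean a b ?T) \<phi>) + \<kappa> / C ^ (2 * q) * norm \<phi>"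
      using Cpos[of "2 * q"] zero_le_power2[of R]
      by (intro add_left_mono mult_right_mono divide_right_mono) (auto simp: \<kappa>_def M_def)
    finally have *: "norm (app (mean a' b' ?T) \<phi>) + 4 * M / ?T * norm \<phi>
        \<le> norm (app (mean a b ?T) \<phi>) + \<kappa> / C ^ (2 * q) * norm \<phi>" .
    have "norm (app (shift (2 * int q) - 1) \<phi>)
        \<le> C ^ q * (norm (app (mean a' b' ?T) \<phi>) + 4 * M / ?T * norm \<phi>)"
      using periodic_mean_lower_bound[where a = a' and b = b', OF P q(1) per M, of ?T \<phi>] Cpos
      unfolding CM by simp
    also have "\<dots> \<le> C ^ q * (norm (app (mean a b ?T) \<phi>) + \<kappa> / C ^ (2 * q) * norm \<phi>)"
      using * Cpos[of q] by (intro mult_left_mono) auto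
    finally show ?thesis .
  qed
qed

text \<open>Each hypothesis compares times within one interval. Adjacent intervals share an
  endpoint, so the comparisons chain, and as \<open>u\<close> halves, their sum stays below twice
  its first term.\<close>

lemma chain_estimate:
  fixes f :: "real \<Rightarrow> 'a::real_normed_vector" and T u :: "nat \<Rightarrow> real"
  assumes mono: "\<And>n. T n \<le> T (Suc n)" and unbounded: "\<And>x. \<exists>n. x \<le> T n"
    and step: "\<And>n s t. n \<ge> n0 \<Longrightarrow> s \<in> {T n..T (Suc n)} \<Longrightarrow> t \<in> {T n..T (Suc n)} \<Longrightarrow> norm (f t - f s) \<le> u n"
    and u: "\<And>n. u (Suc n) \<le> u n / 2"
    and n: "n \<ge> n0" and t: "t \<ge> T n"
  shows "norm (f t - f (T n)) \<le> 2 * u n"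
proof -
  have u0: "0 \<le> u n" if "n \<ge> n0" for n
    using step[OF that, of "T n" "T n"] mono[of n] by simp
  have *: "norm (f t - f (T n)) \<le> 2 * u n" if "n \<ge> n0" "t \<in> {T n..T (n + k)}" for k n t
    using that
  proof (induction k arbitrary: n)
    case 0
    then show ?case using u0[of n] by simp
  next
    case (Suc k)
    show ?case
    proof (cases "t \<le> T (Suc n)")
      case True
      then show ?thesis using step[of n "T n" t] Suc.prems mono[of n] u0[of n] by auto
    next
      case False
      then have "norm (f t - f (T (Suc n))) \<le> 2 * u (Suc n)"
        using Suc.prems by (intro Suc.IH) auto
      moreover have "norm (f (T (Suc n)) - f (T n)) \<le> u n"
        using step[of n "T n" "T (Suc n)"] Suc.prems mono[of n] by auto
      ultimately show ?thesis
        using u[of n] norm_triangle_ineq[of "f t - f (T (Suc n))" "f (T (Suc n)) - f (T n)"] by simp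
    qed
  qed
  obtain m where m: "t \<le> T m" using unbounded by blast
  have "T m \<le> T (n + m)"
    by (rule lift_Suc_mono_le[of T, OF mono]) simp
  with m t show ?thesis using *[OF n, of t m] by simp
qed

section \<open>Passing to the limit of infinite time\<close>

lemma convergent_at_top:
  fixes f :: "real \<Rightarrow> 'a::banach"
  assumes "\<And>e. e > 0 \<Longrightarrow> \<exists>T. \<forall>t\<ge>T. norm (f t - f T) \<le> e"
  shows "\<exists>l. (f \<longlongrightarrow> l) at_top"
proof -
  have C: "\<exists>T. \<forall>s\<ge>T. \<forall>t\<ge>T. norm (f t - f s) \<le> e" if e: "e > 0" for e
  proof -
    obtain T where T: "\<And>t. t \<ge> T \<Longrightarrow> norm (f t - f T) \<le> e / 2"
      using assms[of "e / 2"] e by auto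
    have "norm (f t - f s) \<le> e" if "s \<ge> T" "t \<ge> T" for s t
      using T[OF that(1)] T[OF that(2)] norm_triangle_ineq4[of "f t - f T" "f s - f T"] by simp
    then show ?thesis by blast
  qed
  have "Cauchy (\<lambda>n. f (real n))"
  proof (rule CauchyI)
    fix e :: real assume e: "e > 0"
    obtain T where T: "\<And>s t. s \<ge> T \<Longrightarrow> t \<ge> T \<Longrightarrow> norm (f t - f s) \<le> e / 2"
      using C[of "e / 2"] e by auto
    have "norm (f (real m) - f (real n)) < e" if "m \<ge> nat \<lceil>T\<rceil>" "n \<ge> nat \<lceil>T\<rceil>" for m n
    proof -
      have "real m \<ge> T" "real n \<ge> T" using that by linarith+
      then show ?thesis using T[of "real n" "real m"] e by linarith
    qed
    then show "\<exists>M. \<forall>m\<ge>M. \<forall>n\<ge>M. norm (f (real m) - f (real n)) < e" by blast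
  qed
  then obtain l where l: "(\<lambda>n. f (real n)) \<longlonglongrightarrow> l"
    by (auto simp: Cauchy_convergent_iff convergent_def)
  have "(f \<longlongrightarrow> l) at_top"
  proof (rule tendstoI)
    fix e :: real assume e: "e > 0"
    obtain T where T: "\<And>s t. s \<ge> T \<Longrightarrow> t \<ge> T \<Longrightarrow> norm (f t - f s) \<le> e / 2"
      using C[of "e / 2"] e by auto
    have "dist (f t) l < e" if "t \<ge> T" for t
    proof -
      have "(\<lambda>n. norm (f t - f (real n))) \<longlonglongrightarrow> norm (f t - l)"
        by (intro tendsto_intros l)
      moreover have "\<forall>\<^sub>F n in sequentially. norm (f t - f (real n)) \<le> e / 2"
        using eventually_ge_at_top[of "nat \<lceil>T\<rceil>"]
      proof eventually_elim
        case (elim n)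
        then have "real n \<ge> T" by linarith
        then show ?case using T that by blast
      qed
      ultimately have "norm (f t - l) \<le> e / 2"
        by (rule tendsto_upperbound) simp
      then show ?thesis using e by (simp add: dist_norm)
    qed
    then show "\<forall>\<^sub>F t in at_top. dist (f t) l < e"
      by (rule eventually_at_top_linorderI)
  qed
  then show ?thesis ..
qed

lemma exists_norm_trunc_diff_less:
  assumes "e > 0" shows "\<exists>F. finite F \<and> norm (trunc F \<phi> - \<phi>) < e"
proof -
  have "\<forall>\<^sub>F F in finite_subsets_at_top UNIV. dist (trunc F \<phi>) \<phi> < e \<and> finite F"
    by (intro eventually_conj tendstoD[OF trunc_tendsto assms] eventually_finite_subsets_at_top_weakI)
  from eventually_happens'[OF _ this] show ?thesis by (auto simp: dist_norm)
qed

text \<open>Up to a small error \<phi> has finite support; a large shift moves the support off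
  itself, and then Pythagoras applies.\<close>

lemma norm_shift_diff_ge:
  "\<exists>N. \<forall>k\<ge>N. norm \<phi> / 2 \<le> norm (app (shift (int k) - 1) \<phi>)"
proof (cases "\<phi> = 0")
  case False
  then have "0 < norm \<phi> / 8" by simp
  from exists_norm_trunc_diff_less[OF this] obtain F
    where F: "finite F" "norm (trunc F \<phi> - \<phi>) < norm \<phi> / 8" by blast
  let ?\<psi> = "trunc F \<phi>"
  define B where "B = (\<Sum>n\<in>F. \<bar>n\<bar>)"
  have B: "\<bar>n\<bar> \<le> B" if "n \<in> F" for n
    unfolding B_def using F(1) that by (intro member_le_sum[of n F abs]) auto
  have "norm \<phi> / 2 \<le> norm (app (shift (int k) - 1) \<phi>)" if k: "k \<ge> nat (2 * B + 1)" for k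
  proof -
    have "n \<in> F \<Longrightarrow> n + int k \<notin> F" for n
      using B[of n] B[of "n + int k"] k by (auto simp: abs_le_iff)
    then have "Re (cnj (coord (app (shift (int k)) ?\<psi>) n) * coord ?\<psi> n) = 0" for n by simp
    then have "orthogonal (app (shift (int k)) ?\<psi>) (- ?\<psi>)"
      by (simp add: orthogonal_def inner_ell2_alt)
    from norm_add_Pythagorean[OF this]
    have "(norm ?\<psi>)\<^sup>2 \<le> (norm (app (shift (int k) - 1) ?\<psi>))\<^sup>2" by simp
    then have "norm ?\<psi> \<le> norm (app (shift (int k) - 1) ?\<psi>)"
      by (rule power2_le_imp_le) simp
    moreover have "app (shift (int k) - 1) \<phi> = app (shift (int k) - 1) ?\<psi>
        - (app (shift (int k)) (?\<psi> - \<phi>) - (?\<psi> - \<phi>))"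
      by (simp add: app.diff_right)
    moreover have "norm (app (shift (int k)) (?\<psi> - \<phi>) - (?\<psi> - \<phi>)) \<le> norm \<phi> / 8 + norm \<phi> / 8"
      using F(2) norm_triangle_ineq4[of "app (shift (int k)) (?\<psi> - \<phi>)" "?\<psi> - \<phi>"] by simp
    moreover have "norm \<phi> \<le> norm ?\<psi> + norm \<phi> / 8"
      using F(2) norm_triangle_ineq[of ?\<psi> "\<phi> - ?\<psi>"] norm_minus_commute[of \<phi> ?\<psi>] by simp
    ultimately show ?thesis
      using norm_triangle_ineq2[of "app (shift (int k) - 1) ?\<psi>" "app (shift (int k)) (?\<psi> - \<phi>) - (?\<psi> - \<phi>)"]
        norm_ge_zero[of \<phi>] by (simp only:)
  qed
  then show ?thesis by blast
qed simp

lemma strict_mono_ge_nat: "(\<And>n. q n < q (Suc n)) \<Longrightarrow> n \<le> q n" for q :: "nat \<Rightarrow> nat"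
  by (intro strict_mono_imp_increasing) (simp add: strict_mono_Suc_iff)

lemma mean_converges_ell1:
  fixes R :: real and q :: "nat \<Rightarrow> nat" and a' b' :: "nat \<Rightarrow> int \<Rightarrow> real"
  defines "C \<equiv> 4 * R * (14 * R + 1)"
  assumes J: "jacobi_coeffs a b" and P: "\<And>n. jacobi_coeffs (a' n) (b' n)"
    and q: "\<And>n. q n > 0" "\<And>n. q n < q (Suc n)"
    and per: "\<And>n k. a' n (k + int (q n)) = a' n k" "\<And>n k. b' n (k + int (q n)) = b' n k"
    and R: "norm (jac a b) \<le> R" "\<And>n. 1 / R \<le> a n" "R > 0"
    and eps: "\<forall>\<^sub>F n in sequentially. norm (jac a b - jac (a' n) (b' n)) \<le> 1 / C ^ (14 * q (Suc n))"
    and \<phi>: "\<phi> \<in> ell1"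
  shows "\<exists>l. ((\<lambda>t. app (mean a b t) \<phi>) \<longlongrightarrow> l) at_top \<and> (\<phi> \<noteq> 0 \<longrightarrow> l \<noteq> 0)"
proof -
  define \<kappa> where "\<kappa> = 128 * R\<^sup>2 + 8 * R + 2"
  define T where "T n = C ^ (7 * q n)" for n
  define u where "u n = \<kappa> / C ^ (2 * q n) * ell1_norm \<phi>" for n
  let ?f = "\<lambda>t. app (mean a b t) \<phi>"
  obtain n0 where n0: "\<And>n. n \<ge> n0 \<Longrightarrow> norm (jac a b - jac (a' n) (b' n)) \<le> 1 / C ^ (14 * q (Suc n))"
    using eps by (auto simp: eventually_sequentially)
  have "\<bar>a 0\<bar> \<le> R" using coeffs_le(1)[OF J, of 0] R(1) by linarith
  then have "1 / R \<le> R" using R(2)[of 0] by linarith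
  then have "1 \<le> R\<^sup>2" using R(3) by (simp add: field_simps power2_eq_square)
  then have R1: "1 \<le> R" using R(3) power2_le_imp_le[of 1 R] by simp
  have "1 * 1 \<le> R * (14 * R + 1)" using R1 by (intro mult_mono) simp_all
  then have C: "4 \<le> C" unfolding C_def by simp
  have \<kappa>: "0 \<le> \<kappa>" using R1 by (simp add: \<kappa>_def)
  have Cpos: "0 < C ^ j" for j using C by simp
  have nq: "n \<le> q n" for n by (rule strict_mono_ge_nat) (rule q)
  have Cn: "real j \<le> C ^ j" for j
    using C Bernoulli_inequality[of "C - 1" j] mult_left_mono[of 1 "C - 1" "real j"] by simp
  have T_mono: "T n \<le> T (Suc n)" for n
    unfolding T_def using q(2)[of n] C by (intro power_increasing) auto
  have T_unb: "\<exists>n. x \<le> T n" for x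
  proof
    have "x \<le> real (nat \<lceil>x\<rceil>)" by linarith
    also have "\<dots> \<le> real (7 * q (nat \<lceil>x\<rceil>))" using nq[of "nat \<lceil>x\<rceil>"] by linarith
    also have "\<dots> \<le> T (nat \<lceil>x\<rceil>)" unfolding T_def by (rule Cn)
    finally show "x \<le> T (nat \<lceil>x\<rceil>)" .
  qed
  have u_half: "u (Suc n) \<le> u n / 2" for n
  proof -
    have "2 * C ^ (2 * q n) \<le> C * C ^ (2 * q n)" using C Cpos by (intro mult_right_mono) auto
    also have "\<dots> = C ^ (Suc (2 * q n))" by simp
    also have "\<dots> \<le> C ^ (2 * q (Suc n))" using C q(2)[of n] by (intro power_increasing) auto
    finally have "\<kappa> / C ^ (2 * q (Suc n)) \<le> \<kappa> / (2 * C ^ (2 * q n))"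
      using \<kappa> Cpos by (intro divide_left_mono mult_pos_pos) auto
    from mult_right_mono[OF this ell1_norm_nonneg[of \<phi>]] show ?thesis by (simp add: u_def)
  qed
  note sc = scale_estimates[where a = a and b = b and R = R, folded C_def \<kappa>_def,
      OF J P q per R n0, unfolded C_def[symmetric] \<kappa>_def[symmetric]]
  have step: "norm (?f t - ?f s) \<le> u n"
    if "n \<ge> n0" "s \<in> {T n..T (Suc n)}" "t \<in> {T n..T (Suc n)}" for n s t
    using sc(1)[OF that(1) \<phi>, of s t] that unfolding T_def u_def by simp
  have chain: "norm (?f t - ?f (T n)) \<le> 2 * u n" if "n \<ge> n0" "t \<ge> T n" for n t
    by (rule chain_estimate[of T n0 ?f u n t]) (use T_mono T_unb step u_half that in auto)
  have u_le: "u n \<le> \<kappa> * ell1_norm \<phi> / C ^ n" for n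
  proof -
    have "\<kappa> / C ^ (2 * q n) \<le> \<kappa> / C ^ n"
      using nq[of n] C \<kappa> Cpos by (intro divide_left_mono power_increasing mult_pos_pos) auto
    from mult_right_mono[OF this ell1_norm_nonneg[of \<phi>]] show ?thesis by (simp add: u_def)
  qed
  have "(\<lambda>n. \<kappa> * ell1_norm \<phi> / C ^ n) \<longlonglongrightarrow> 0"
    using C by (intro LIMSEQ_divide_realpow_zero) simp
  then have small: "\<exists>n\<ge>n0. u n \<le> e" if "e > 0" for e
  proof -
    have "\<forall>\<^sub>F n in sequentially. \<kappa> * ell1_norm \<phi> / C ^ n < e \<and> n0 \<le> n"
      using \<open>(\<lambda>n. \<kappa> * ell1_norm \<phi> / C ^ n) \<longlonglongrightarrow> 0\<close> that
      by (intro eventually_conj order_tendstoD eventually_ge_at_top) auto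
    from eventually_happens'[OF _ this] show ?thesis using u_le by (force intro: order_trans less_imp_le)
  qed
  have "\<exists>T. \<forall>t\<ge>T. norm (?f t - ?f T) \<le> e" if e: "e > 0" for e
  proof -
    obtain n where "n \<ge> n0" "u n \<le> e / 2" using small[of "e / 2"] e by auto
    then show ?thesis using chain[of n] by (intro exI[of _ "T n"]) force
  qed
  then obtain l where l: "(?f \<longlongrightarrow> l) at_top" using convergent_at_top[of ?f] by blast
  have lT: "norm (l - ?f (T n)) \<le> 2 * u n" if "n \<ge> n0" for n
  proof (rule tendsto_upperbound)
    show "((\<lambda>t. norm (?f t - ?f (T n))) \<longlongrightarrow> norm (l - ?f (T n))) at_top"
      by (intro tendsto_intros l)
    show "\<forall>\<^sub>F t in at_top. norm (?f t - ?f (T n)) \<le> 2 * u n"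
      using chain[OF that] by (rule eventually_at_top_linorderI)
  qed simp
  have "l \<noteq> 0" if "\<phi> \<noteq> 0"
  proof
    \<comment> \<open>Then the mean at \<open>T n\<close> has norm at most \<open>2 * u n\<close>,
      of order \<open>C^(-2q)\<close> for \<open>q = q n\<close>. The lower bound loses only
      \<open>C^q\<close>, so \<open>norm \<phi> / 2\<close> would be of order \<open>C^(-q)\<close>
      for all large \<open>n\<close>.\<close>
    assume "l = 0"
    obtain N where N: "\<And>k. k \<ge> N \<Longrightarrow> norm \<phi> / 2 \<le> norm (app (shift (int k) - 1) \<phi>)"
      using norm_shift_diff_ge by blast
    have bound: "C ^ n * (norm \<phi> / 2) \<le> 3 * \<kappa> * ell1_norm \<phi>" if n: "n \<ge> n0" "n \<ge> N" for n
    proof -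
      have "N \<le> 2 * q n" using nq[of n] n by linarith
      from N[OF this] have "norm \<phi> / 2 \<le> norm (app (shift (2 * int (q n)) - 1) \<phi>)" by simp
      also have "\<dots> \<le> C ^ q n * (norm (?f (T n)) + \<kappa> / C ^ (2 * q n) * norm \<phi>)"
        using sc(2)[OF n(1)] by (simp add: T_def)
      also have "\<dots> \<le> C ^ q n * (2 * u n + u n)"
      proof (intro mult_left_mono add_mono)
        show "norm (?f (T n)) \<le> 2 * u n" using lT[OF n(1)] \<open>l = 0\<close> by simp
        show "\<kappa> / C ^ (2 * q n) * norm \<phi> \<le> u n"
          unfolding u_def ell1_norm_def
          using \<kappa> Cpos[of "2 * q n"] norm_le_ell1[OF \<phi>] by (intro mult_left_mono) auto
        show "0 \<le> C ^ q n" using Cpos[of "q n"] by simp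
      qed
      also have "\<dots> = 3 * \<kappa> * ell1_norm \<phi> / C ^ q n"
      proof -
        have "C ^ (2 * q n) = C ^ q n * C ^ q n" by (simp add: power_add[symmetric] mult_2)
        then show ?thesis using Cpos[of "q n"] by (simp add: u_def field_simps)
      qed
      finally have "C ^ q n * (norm \<phi> / 2) \<le> 3 * \<kappa> * ell1_norm \<phi>"
        using Cpos[of "q n"] by (simp add: field_simps)
      moreover have "C ^ n * (norm \<phi> / 2) \<le> C ^ q n * (norm \<phi> / 2)"
        using nq[of n] C by (intro mult_right_mono power_increasing) auto
      ultimately show ?thesis by linarith
    qed
    define y where "y = 3 * \<kappa> * ell1_norm \<phi> / (norm \<phi> / 2)"
    define n where "n = max (nat \<lceil>y + 1\<rceil>) (max n0 N)"
    have "y + 1 \<le> real (nat \<lceil>y + 1\<rceil>)" by linarith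
    also have "\<dots> \<le> real n" by (simp add: n_def)
    also have "\<dots> \<le> C ^ n" by (rule Cn)
    finally have "y < C ^ n" by simp
    moreover have "C ^ n \<le> y"
      using bound[of n] \<open>\<phi> \<noteq> 0\<close> by (simp add: y_def n_def field_simps)
    ultimately show False by simp
  qed
  with l show ?thesis by blast
qed

text \<open>The means share the bound \<open>norm (jac_comm a)\<close>, so convergence extends from
  the dense set of finitely supported vectors.\<close>

lemma mean_converges:
  assumes J: "jacobi_coeffs a b"
    and ell1: "\<And>\<phi>. \<phi> \<in> ell1 \<Longrightarrow> \<exists>l. ((\<lambda>t. app (mean a b t) \<phi>) \<longlongrightarrow> l) at_top"
  shows "\<exists>l. ((\<lambda>t. app (mean a b t) \<phi>) \<longlongrightarrow> l) at_top"
proof (rule convergent_at_top)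
  fix e :: real assume e: "e > 0"
  define B where "B = norm (jac_comm a)"
  have B: "0 \<le> B" by (simp add: B_def)
  then have "0 < e / (4 * (B + 1))" using e by simp
  from exists_norm_trunc_diff_less[OF this, of \<phi>] obtain F
    where F: "finite F" "norm (trunc F \<phi> - \<phi>) < e / (4 * (B + 1))" by blast
  have d: "norm (app (mean a b t) (trunc F \<phi> - \<phi>)) \<le> e / 4" if "t > 0" for t
  proof -
    have "norm (app (mean a b t) (trunc F \<phi> - \<phi>)) \<le> B * (e / (4 * (B + 1)))"
      using norm_mean_le[OF J that] F(2) B unfolding B_def[symmetric]
      by (intro order_trans[OF norm_app_le] mult_mono) auto
    also have "\<dots> \<le> e / 4" using B e by (simp add: field_simps)
    finally show ?thesis .
  qed
  obtain l where "((\<lambda>t. app (mean a b t) (trunc F \<phi>)) \<longlongrightarrow> l) at_top"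
    using ell1[OF trunc_finite_ell1[OF F(1)]] by blast
  then have "\<forall>\<^sub>F t in at_top. dist (app (mean a b t) (trunc F \<phi>)) l < e / 4"
    using e by (intro tendstoD) auto
  then obtain T where T: "\<And>t. t \<ge> T \<Longrightarrow> dist (app (mean a b t) (trunc F \<phi>)) l < e / 4"
    by (auto simp: eventually_at_top_linorder)
  have "norm (app (mean a b t) \<phi> - app (mean a b (max T 1)) \<phi>) \<le> e" if t: "t \<ge> max T 1" for t
  proof -
    let ?s = "max T 1"
    let ?A = "app (mean a b t) (trunc F \<phi>) - l" and ?A' = "app (mean a b ?s) (trunc F \<phi>) - l"
    let ?B = "app (mean a b t) (trunc F \<phi> - \<phi>)" and ?B' = "app (mean a b ?s) (trunc F \<phi> - \<phi>)"
    have "app (mean a b t) \<phi> - app (mean a b ?s) \<phi> = (?A - ?A') - (?B - ?B')"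
      by (simp add: app.diff_right)
    moreover have "norm ?A \<le> e / 4" "norm ?A' \<le> e / 4" "norm ?B \<le> e / 4" "norm ?B' \<le> e / 4"
      using T[of t] T[of ?s] d[of t] d[of ?s] t by (auto simp: dist_norm)
    ultimately show ?thesis
      using norm_triangle_ineq4[of ?A ?A'] norm_triangle_ineq4[of ?B ?B']
        norm_triangle_ineq4[of "?A - ?A'" "?B - ?B'"] by (simp only:)
  qed
  then show "\<exists>T. \<forall>t\<ge>T. norm (app (mean a b t) \<phi> - app (mean a b T) \<phi>) \<le> e" by blast
qed

text \<open>The operator \<open>Q\<close> of the theorem. In its situation the means converge on all
  of l2, not only on the domain of \<open>X\<close>, so the domain of \<open>Q\<close> is
  \<open>UNIV\<close>. Where there is no limit, \<open>Lim\<close> is arbitrary.\<close>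

definition velocity :: "(int \<Rightarrow> real) \<Rightarrow> (int \<Rightarrow> real) \<Rightarrow> ell2 \<Rightarrow> ell2" where
  "velocity a b \<phi> = Lim at_top (\<lambda>t. app (mean a b t) \<phi>)"

lemma cinner_eq_inner: "cinner \<phi> \<psi> = of_real (inner \<phi> \<psi>) - \<i> * of_real (inner \<phi> (app iop \<psi>))"
proof -
  have "cinner \<phi> (app iop \<psi>) = \<i> * cinner \<phi> \<psi>"
    unfolding cinner_def by (subst infsum_cmult_right'[symmetric]) (simp add: algebra_simps)
  then show ?thesis by (simp add: inner_ell2_def complex_eq_iff)
qed

text \<open>A symmetric operator defined everywhere is its own adjoint. Symmetry for the real inner
  product passes to the limit, and commuting with \<open>iop\<close> turns it into symmetry for
  \<open>cinner\<close>.\<close>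

lemma selfadjoint_velocity:
  assumes J: "jacobi_coeffs a b"
    and lim: "\<And>\<phi>. ((\<lambda>t. app (mean a b t) \<phi>) \<longlongrightarrow> velocity a b \<phi>) at_top"
  shows "selfadjoint_on UNIV (velocity a b)"
proof -
  let ?Q = "velocity a b"
  have unique: "?Q \<phi> = l" if "((\<lambda>t. app (mean a b t) \<phi>) \<longlongrightarrow> l) at_top" for \<phi> l
    using lim that by (intro tendsto_unique[where F = at_top]) auto
  have add: "?Q (\<phi> + \<psi>) = ?Q \<phi> + ?Q \<psi>" for \<phi> \<psi>
    unfolding app.add_right by (rule unique) (simp add: app.add_right tendsto_add lim)
  have scale: "?Q (cscale c \<phi>) = cscale c (?Q \<phi>)" for c \<phi>
  proof (rule unique)
    show "((\<lambda>t. app (mean a b t) (cscale c \<phi>)) \<longlongrightarrow> cscale c (?Q \<phi>)) at_top"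
      unfolding app_cscale[OF iop_mean[OF J]]
      by (rule bounded_linear.tendsto[OF bounded_linear_cscale lim])
  qed
  have iopQ: "?Q (app iop \<phi>) = app iop (?Q \<phi>)" for \<phi>
    using scale[of \<i> \<phi>] by (simp add: iop_def app_bop bounded_linear_cscale)
  have sym: "inner (?Q \<phi>) \<psi> = inner \<phi> (?Q \<psi>)" for \<phi> \<psi>
  proof (rule tendsto_unique[where F = at_top])
    show "((\<lambda>t. inner (app (mean a b t) \<phi>) \<psi>) \<longlongrightarrow> inner (?Q \<phi>) \<psi>) at_top"
      by (intro tendsto_intros lim)
    have "inner (app (mean a b t) \<phi>) \<psi> = inner \<phi> (app (mean a b t) \<psi>)" for t
      using adjoint_pair_scaleR[OF adjoint_pair_accumulated[OF
            adjoint_pair_iop_jac[OF J] adjoint_pair_iop_jac_comm[OF J]], of "1 / t" t]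
      unfolding mean_def adjoint_pair_def by blast
    then show "((\<lambda>t. inner (app (mean a b t) \<phi>) \<psi>) \<longlongrightarrow> inner \<phi> (?Q \<psi>)) at_top"
      by (simp only:) (intro tendsto_intros lim)
  qed simp
  have csym: "cinner \<phi> (?Q \<xi>) = cinner (?Q \<phi>) \<xi>" for \<phi> \<xi>
    unfolding cinner_eq_inner iopQ[symmetric] sym by simp
  have nondeg: "\<phi> = \<psi>" if "\<And>\<xi>. cinner \<phi> \<xi> = cinner \<psi> \<xi>" for \<phi> \<psi>
  proof (rule ell2_eqI)
    fix n
    have "cinner \<phi> (delta n) = cnj (coord \<phi> n)" for \<phi>
    proof -
      have "cinner \<phi> (delta n) = (\<Sum>\<^sub>\<infinity>m\<in>{n}. cnj (coord \<phi> m))"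
        unfolding cinner_def by (rule infsum_cong_neutral) (auto simp: coord_delta)
      then show ?thesis by simp
    qed
    then show "coord \<phi> n = coord \<psi> n" using that[of "delta n"] by simp
  qed
  show ?thesis
    unfolding selfadjoint_on_def using add scale csym nondeg by auto
qed

lemma heisenberg_tendsto:
  assumes J: "jacobi_coeffs a b" and \<phi>: "\<phi> \<in> position_dom"
    and lim: "((\<lambda>t. app (mean a b t) \<phi>) \<longlongrightarrow> l) at_top"
  shows "((\<lambda>t. (1 / t) *\<^sub>R heisenberg (jacobi a b) t \<phi>) \<longlongrightarrow> l) at_top"
proof -
  have "((\<lambda>t. (1 / t) *\<^sub>R position \<phi> + app (mean a b t) \<phi>) \<longlongrightarrow> 0 *\<^sub>R position \<phi> + l) at_top"
    by (intro tendsto_intros lim tendsto_divide_0[OF tendsto_const] filterlim_at_top_imp_at_infinity filterlim_ident)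
  moreover have "\<forall>\<^sub>F t in at_top. (1 / t) *\<^sub>R position \<phi> + app (mean a b t) \<phi> = (1 / t) *\<^sub>R heisenberg (jacobi a b) t \<phi>"
    using eventually_ge_at_top[of 0]
    by eventually_elim (simp add: heisenberg_eq_accumulated[OF J \<phi>] mean_def scaleR_add_right)
  ultimately show ?thesis by (simp add: tendsto_cong)
qed

section \<open>Finite speed of propagation\<close>

lemma coord_jac_power_eq_0:
  assumes J: "jacobi_coeffs a b"
  shows "(\<And>m. \<bar>m - n\<bar> \<le> int j \<Longrightarrow> coord \<phi> m = 0) \<Longrightarrow> coord (app ((iop * jac a b) ^ j) \<phi>) n = 0"
proof (induction j arbitrary: \<phi>)
  case (Suc j)
  have "coord (app (iop * jac a b) \<phi>) m = 0" if "\<bar>m - n\<bar> \<le> int j" for m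
    using Suc.prems[of m] Suc.prems[of "m - 1"] Suc.prems[of "m + 1"] that
    by (simp add: coord_jac[OF J])
  from Suc.IH[OF this] show ?case
    by (simp add: power_commutes[symmetric] del: app_mult flip: app_mult)
qed simp

text \<open>Powers of the matrix up to \<open>d\<close> do not reach \<open>n\<close> from the
  support of \<phi>. In the remaining terms the factor \<open>exp (j - d) \<ge> 1\<close> is
  inserted, which turns the tail of the exponential series into a full one; this is where
  \<open>exp 1\<close> comes from.\<close>

lemma cmod_coord_exp_le:
  assumes J: "jacobi_coeffs a b" and \<phi>: "\<And>m. \<bar>m - n\<bar> \<le> int d \<Longrightarrow> coord \<phi> m = 0"
  shows "cmod (coord (app (exp (s *\<^sub>R (iop * jac a b))) \<phi>) n)
    \<le> exp (exp 1 * \<bar>s\<bar> * norm (jac a b) - real d) * norm \<phi>"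
proof -
  let ?K = "iop * jac a b"
  define x where "x = exp 1 * \<bar>s\<bar> * norm (jac a b)"
  let ?c = "\<lambda>j. coord (app ((s *\<^sub>R ?K) ^ j /\<^sub>R fact j) \<phi>) n"
  have bl: "bounded_linear (\<lambda>T. coord (app T \<phi>) n)"
    by (intro bounded_linear_compose[OF bounded_linear_coord] app.bounded_linear_left)
  have sums: "?c sums coord (app (exp (s *\<^sub>R ?K)) \<phi>) n"
    by (intro bounded_linear.sums[OF bl] exp_converges)
  have bound: "norm (?c j) \<le> exp (- real d) * norm \<phi> * (x ^ j /\<^sub>R fact j)" for j
  proof (cases "j \<le> d")
    case True
    then have "coord (app (?K ^ j) \<phi>) n = 0"
      by (intro coord_jac_power_eq_0[OF J] \<phi>) simp
    then show ?thesis by (simp add: x_def)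
  next
    case False
    have "norm (?c j) \<le> norm (app ((s *\<^sub>R ?K) ^ j /\<^sub>R fact j) \<phi>)" by (rule norm_coord_le)
    also have "\<dots> \<le> norm ((s *\<^sub>R ?K) ^ j /\<^sub>R fact j) * norm \<phi>" by (rule norm_app_le)
    also have "norm ((s *\<^sub>R ?K) ^ j /\<^sub>R fact j) \<le> (\<bar>s\<bar> * norm (jac a b)) ^ j /\<^sub>R fact j"
    proof -
      have "norm (X /\<^sub>R fact j) \<le> y /\<^sub>R fact j" if "norm X \<le> y" for X :: "ell2 bop" and y
        using that by (simp add: mult_left_mono)
      moreover have "norm ((s *\<^sub>R ?K) ^ j) \<le> (\<bar>s\<bar> * norm (jac a b)) ^ j"
        using norm_power_ineq[of "s *\<^sub>R ?K" j] by simp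
      ultimately show ?thesis by blast
    qed
    also have "\<dots> \<le> exp (- real d) * (x ^ j /\<^sub>R fact j)"
    proof -
      have "1 \<le> exp (real j - real d)" using False by simp
      then have "1 * (\<bar>s\<bar> * norm (jac a b)) ^ j \<le> exp (real j - real d) * (\<bar>s\<bar> * norm (jac a b)) ^ j"
        by (intro mult_right_mono) auto
      also have "\<dots> = exp (- real d) * x ^ j"
        by (simp add: x_def power_mult_distrib exp_diff exp_minus exp_of_nat_mult[symmetric] field_simps)
      finally show ?thesis by (simp add: field_simps)
    qed
    finally show ?thesis by (simp add: mult.commute mult.left_commute mult_right_mono)
  qed
  have sx: "(\<lambda>j. exp (- real d) * norm \<phi> * (x ^ j /\<^sub>R fact j)) sums (exp (- real d) * norm \<phi> * exp x)"
    by (intro sums_mult exp_converges)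
  have "norm (suminf ?c) \<le> suminf (\<lambda>j. exp (- real d) * norm \<phi> * (x ^ j /\<^sub>R fact j))"
    using bound sx by (intro norm_suminf_le) (auto simp: sums_iff)
  then have "cmod (coord (app (exp (s *\<^sub>R ?K)) \<phi>) n) \<le> exp (- real d) * norm \<phi> * exp x"
    using sums sx by (simp only: sums_iff)
  also have "\<dots> = exp (x - real d) * norm \<phi>"
    by (simp add: exp_diff exp_minus field_simps)
  finally show ?thesis by (simp add: x_def)
qed

lemma schwartz_summable:
  assumes "\<phi> \<in> schwartz" "N > 0"
  shows "(\<lambda>n. \<bar>real_of_int n\<bar> ^ N * cmod (coord \<phi> n)) summable_on UNIV"
proof -
  have "(\<lambda>n. real_of_int \<bar>n\<bar> powr real N * cmod (coord \<phi> n)) summable_on UNIV"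
    using assms by (simp add: schwartz_def)
  moreover have "real_of_int \<bar>n\<bar> powr real N = \<bar>real_of_int n\<bar> ^ N" for n
    using assms(2) by (cases "n = 0") (simp_all add: powr_realpow)
  ultimately show ?thesis by simp
qed

lemma schwartz_ell1: "\<phi> \<in> schwartz \<Longrightarrow> \<phi> \<in> ell1"
proof -
  assume \<phi>: "\<phi> \<in> schwartz"
  have "(\<lambda>n. \<bar>real_of_int n\<bar> ^ 1 * cmod (coord \<phi> n) + (if n = 0 then cmod (coord \<phi> 0) else 0)) summable_on UNIV"
    by (intro summable_on_add schwartz_summable[OF \<phi>] finite_nonzero_values_imp_summable_on) auto
  then show "\<phi> \<in> ell1"
    unfolding ell1_def mem_Collect_eq
  proof (rule summable_on_comparison_test)
    fix n :: int
    have "1 * cmod (coord \<phi> n) \<le> \<bar>real_of_int n\<bar> * cmod (coord \<phi> n)" if "n \<noteq> 0"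
      using that by (intro mult_right_mono) auto
    then show "cmod (coord \<phi> n) \<le> \<bar>real_of_int n\<bar> ^ 1 * cmod (coord \<phi> n) + (if n = 0 then cmod (coord \<phi> 0) else 0)"
      by auto
  qed simp
qed

lemma schwartz_position_dom: "\<phi> \<in> schwartz \<Longrightarrow> \<phi> \<in> position_dom"
proof -
  assume \<phi>: "\<phi> \<in> schwartz"
  have "(\<lambda>n. norm \<phi> * (\<bar>real_of_int n\<bar> ^ 2 * cmod (coord \<phi> n))) summable_on UNIV"
    by (intro summable_on_cmult_right schwartz_summable[OF \<phi>]) simp
  then show "\<phi> \<in> position_dom"
    unfolding position_dom_def square_summable_def mem_Collect_eq
  proof (rule summable_on_comparison_test)
    fix n :: int
    have "(cmod (coord \<phi> n))\<^sup>2 \<le> norm \<phi> * cmod (coord \<phi> n)"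
      unfolding power2_eq_square by (intro mult_right_mono norm_coord_le) simp
    then show "(cmod (of_int n * coord \<phi> n))\<^sup>2 \<le> norm \<phi> * (\<bar>real_of_int n\<bar> ^ 2 * cmod (coord \<phi> n))"
      using mult_left_mono[of "(cmod (coord \<phi> n))\<^sup>2" "norm \<phi> * cmod (coord \<phi> n)" "\<bar>real_of_int n\<bar> ^ 2"]
      by (simp add: norm_mult power_mult_distrib algebra_simps)
  qed simp
qed

lemma norm_schwartz_tail_le:
  assumes \<phi>: "\<phi> \<in> schwartz" and N: "N > 0" and x: "x > 0" "\<And>m. m \<in> A \<Longrightarrow> x \<le> \<bar>real_of_int m\<bar>"
  shows "norm (trunc A \<phi>) \<le> (\<Sum>\<^sub>\<infinity>m. \<bar>real_of_int m\<bar> ^ N * cmod (coord \<phi> m)) / x ^ N"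
proof -
  have le: "cmod (coord (trunc A \<phi>) m) \<le> \<bar>real_of_int m\<bar> ^ N * cmod (coord \<phi> m) * (1 / x ^ N)" for m
  proof (cases "m \<in> A")
    case True
    then have "1 \<le> \<bar>real_of_int m\<bar> ^ N / x ^ N"
      using x(1) power_mono[OF x(2)[OF True], of N] by simp
    then have "1 * cmod (coord \<phi> m) \<le> \<bar>real_of_int m\<bar> ^ N / x ^ N * cmod (coord \<phi> m)"
      by (intro mult_right_mono) auto
    then show ?thesis using True by simp
  qed (use x in simp)
  have s: "(\<lambda>m. \<bar>real_of_int m\<bar> ^ N * cmod (coord \<phi> m) * (1 / x ^ N)) summable_on UNIV"
    by (intro summable_on_cmult_left schwartz_summable[OF \<phi> N])
  then have t: "(\<lambda>m. cmod (coord (trunc A \<phi>) m)) summable_on UNIV"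
    by (rule summable_on_comparison_test) (use le in auto)
  have "norm (trunc A \<phi>) \<le> (\<Sum>\<^sub>\<infinity>m. cmod (coord (trunc A \<phi>) m))"
    using t by (intro norm_le_ell1) (simp add: ell1_def)
  also have "\<dots> \<le> (\<Sum>\<^sub>\<infinity>m. \<bar>real_of_int m\<bar> ^ N * cmod (coord \<phi> m) * (1 / x ^ N))"
    by (intro infsum_mono t s le)
  also have "\<dots> = (\<Sum>\<^sub>\<infinity>m. \<bar>real_of_int m\<bar> ^ N * cmod (coord \<phi> m)) / x ^ N"
    by (simp only: infsum_cmult_left') simp
  finally show ?thesis .
qed

lemma exp_minus_le_fact:
  fixes x :: real assumes "x > 0" shows "exp (- x) \<le> fact N / x ^ N"
proof -
  have "(\<Sum>n\<in>{N}. x ^ n /\<^sub>R fact n) \<le> exp x"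
    unfolding exp_def using assms by (intro sum_le_suminf summable_exp_generic) auto
  then show ?thesis using assms by (simp add: exp_minus field_simps)
qed

text \<open>Outside a linearly growing cone, \<phi> is split at half the distance to the origin: the
  near part has to travel too far and arrives exponentially small, the far part is small by the
  decay of \<phi>.\<close>

lemma propagated_decay:
  assumes J: "jacobi_coeffs a b" and \<phi>: "\<phi> \<in> schwartz" and N: "N > 0"
  shows "\<exists>B\<ge>0. \<forall>t\<ge>0. \<forall>n. n \<noteq> 0 \<longrightarrow> 4 * exp 1 * norm (jac a b) * t \<le> \<bar>real_of_int n\<bar> \<longrightarrow>
    cmod (coord (app (exp (- (t *\<^sub>R (iop * jac a b)))) \<phi>) n) \<le> B / \<bar>real_of_int n\<bar> ^ N"
proof -
  define S where "S = (\<Sum>\<^sub>\<infinity>m. \<bar>real_of_int m\<bar> ^ N * cmod (coord \<phi> m))"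
  define B where "B = exp 1 * fact N * 4 ^ N * norm \<phi> + 2 ^ N * S"
  have S: "0 \<le> S" unfolding S_def by (intro infsum_nonneg) auto
  then have B: "0 \<le> B" by (simp add: B_def)
  have "cmod (coord (app (exp (- (t *\<^sub>R (iop * jac a b)))) \<phi>) n) \<le> B / \<bar>real_of_int n\<bar> ^ N"
    if t: "t \<ge> 0" and n: "n \<noteq> 0" "4 * exp 1 * norm (jac a b) * t \<le> \<bar>real_of_int n\<bar>" for t n
  proof -
    let ?U = "exp (- (t *\<^sub>R (iop * jac a b)))" and ?n = "\<bar>real_of_int n\<bar>"
    define A where "A = {m::int. \<bar>n\<bar> \<le> 2 * \<bar>m\<bar>}"
    have "\<phi> = trunc (- A) \<phi> + trunc A \<phi>" by (intro ell2_eqI) simp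
    then have split: "coord (app ?U \<phi>) n = coord (app ?U (trunc (- A) \<phi>)) n + coord (app ?U (trunc A \<phi>)) n"
      by (metis app.add_right coord_add)
    define d where "d = nat (\<bar>n\<bar> div 2)"
    have "cmod (coord (app (exp ((- t) *\<^sub>R (iop * jac a b))) (trunc (- A) \<phi>)) n)
        \<le> exp (exp 1 * \<bar>- t\<bar> * norm (jac a b) - real d) * norm (trunc (- A) \<phi>)"
      by (rule cmod_coord_exp_le[OF J]) (auto simp: A_def d_def)
    also have "\<dots> \<le> exp (1 - ?n / 4) * norm \<phi>"
    proof (intro mult_mono norm_trunc_le)
      \<comment> \<open>The slope \<open>4 * exp 1 * norm (jac a b)\<close> of the cone keeps the
        growth exponent below \<open>?n / 4\<close>; subtracting \<open>d\<close> leaves at most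
        \<open>1 - ?n / 4\<close>.\<close>
      have "real d \<ge> ?n / 2 - 1" unfolding d_def by linarith
      then show "exp (exp 1 * \<bar>- t\<bar> * norm (jac a b) - real d) \<le> exp (1 - ?n / 4)"
        using n(2) t by (simp add: algebra_simps)
    qed auto
    also have "exp (1 - ?n / 4) = exp 1 * exp (- (?n / 4))" by (simp add: mult_exp_exp)
    also have "\<dots> * norm \<phi> \<le> exp 1 * (fact N / (?n / 4) ^ N) * norm \<phi>"
      using n(1) by (intro mult_right_mono mult_left_mono exp_minus_le_fact) auto
    also have "\<dots> = exp 1 * fact N * 4 ^ N * norm \<phi> / ?n ^ N"
      by (simp add: power_divide)
    finally have 1: "cmod (coord (app ?U (trunc (- A) \<phi>)) n) \<le> exp 1 * fact N * 4 ^ N * norm \<phi> / ?n ^ N"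
      by simp
    have "cmod (coord (app ?U (trunc A \<phi>)) n) \<le> norm (app ?U (trunc A \<phi>))" by (rule norm_coord_le)
    also have "\<dots> = norm (trunc A \<phi>)"
      using norm_app_exp_skew[OF adjoint_pair_iop_jac[OF J], of "- t"] by simp
    also have "\<dots> \<le> S / (?n / 2) ^ N"
      unfolding S_def using n(1) by (intro norm_schwartz_tail_le \<phi> N) (auto simp: A_def)
    also have "\<dots> = 2 ^ N * S / ?n ^ N" by (simp add: power_divide)
    finally have 2: "cmod (coord (app ?U (trunc A \<phi>)) n) \<le> 2 ^ N * S / ?n ^ N" .
    show ?thesis
      unfolding split B_def add_divide_distrib by (intro norm_triangle_mono 1 2)
  qed
  then show ?thesis using B by blast
qed

section \<open>Moments\<close>

lemma summable_inverse_squares: "(\<lambda>n::int. 1 / (real_of_int n)\<^sup>2) summable_on UNIV"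
proof -
  have nat: "(\<lambda>n::nat. 1 / (real n)\<^sup>2) summable_on UNIV"
    using inverse_power_summable[of 2, where 'a = real]
    by (intro norm_summable_imp_summable_on) (simp add: divide_inverse)
  have "(\<lambda>n::int. 1 / (real_of_int n)\<^sup>2) summable_on range int"
    using nat by (subst summable_on_reindex) (auto simp: o_def)
  moreover have "(\<lambda>n::int. 1 / (real_of_int n)\<^sup>2) summable_on range (\<lambda>n. - int n)"
    using nat by (subst summable_on_reindex) (auto simp: o_def inj_on_def)
  ultimately have "(\<lambda>n::int. 1 / (real_of_int n)\<^sup>2) summable_on (range int \<union> range (\<lambda>n. - int n))"
    by (rule summable_on_union)
  moreover have "x \<in> range int \<union> range (\<lambda>n. - int n)" for x
    by (cases x rule: int_cases2) auto
  then have "range int \<union> range (\<lambda>n. - int n) = UNIV" by blast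
  ultimately show ?thesis by simp
qed

definition weighted_moment :: "real \<Rightarrow> ell2 \<Rightarrow> real" where
  "weighted_moment p \<psi> = (\<Sum>\<^sub>\<infinity>n. (real_of_int \<bar>n\<bar> powr p + 1) * (cmod (coord \<psi> n))\<^sup>2)"

text \<open>A sum without convergence has the value 0, so a bound on \<open>weighted_moment\<close>
  alone would say nothing; this predicate carries the convergence.\<close>

definition has_moment :: "real \<Rightarrow> ell2 \<Rightarrow> bool" where
  "has_moment p \<psi> \<longleftrightarrow> (\<lambda>n. (real_of_int \<bar>n\<bar> powr p + 1) * (cmod (coord \<psi> n))\<^sup>2) summable_on UNIV"

lemma moment_eq:
  assumes "jacobi_coeffs a b"
  shows "moment (jacobi a b) p \<phi> t = weighted_moment p (app (exp (- (t *\<^sub>R (iop * jac a b)))) \<phi>)"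
proof -
  have "op_exp (- \<i> * of_real t) (jacobi a b) \<phi> = app (exp (- (t *\<^sub>R (iop * jac a b)))) \<phi>"
    using op_exp_jacobi[OF assms, of "- t" \<phi>] by simp
  then show ?thesis
    by (simp add: moment_def weighted_moment_def cinner_delta)
qed

text \<open>Inside the cone the weight is at most \<open>(v * t) powr p + 1\<close> and the norm is
  conserved; outside, the decay of the evolved vector beats the weight.\<close>

lemma moment_upper_bound:
  assumes J: "jacobi_coeffs a b" and \<phi>: "\<phi> \<in> schwartz" and p: "p > 0"
  shows "\<exists>B. \<forall>t\<ge>1. has_moment p (app (exp (- (t *\<^sub>R (iop * jac a b)))) \<phi>) \<and>
    weighted_moment p (app (exp (- (t *\<^sub>R (iop * jac a b)))) \<phi>) \<le> B * t powr p"
proof -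
  \<comment> \<open>\<open>2 * N \<ge> p + 2\<close> leaves the summable inverse square after
    multiplication by the weight.\<close>
  define N where "N = nat \<lceil>p / 2 + 1\<rceil>"
  have N: "N > 0" "p + 2 \<le> 2 * real N" using p unfolding N_def by linarith+
  define v where "v = 4 * exp 1 * norm (jac a b)"
  have v: "0 \<le> v" by (simp add: v_def)
  obtain B where B: "0 \<le> B" "\<And>t n. t \<ge> 0 \<Longrightarrow> n \<noteq> 0 \<Longrightarrow> v * t \<le> \<bar>real_of_int n\<bar> \<Longrightarrow>
      cmod (coord (app (exp (- (t *\<^sub>R (iop * jac a b)))) \<phi>) n) \<le> B / \<bar>real_of_int n\<bar> ^ N"
    using propagated_decay[OF J \<phi> N(1)] unfolding v_def by blast
  define Z where "Z = (\<Sum>\<^sub>\<infinity>n::int. 1 / (real_of_int n)\<^sup>2)"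
  have Z: "0 \<le> Z" unfolding Z_def by (intro infsum_nonneg) auto
  let ?B = "(v powr p + 1) * (norm \<phi>)\<^sup>2 + B\<^sup>2 * Z"
  have "has_moment p \<psi> \<and> weighted_moment p \<psi> \<le> ?B * t powr p"
    if t: "t \<ge> 1" and \<psi>: "\<psi> = app (exp (- (t *\<^sub>R (iop * jac a b)))) \<phi>" for t \<psi>
  proof -
    have n\<psi>: "norm \<psi> = norm \<phi>"
      using norm_app_exp_skew[OF adjoint_pair_iop_jac[OF J], of "- t" \<phi>] by (simp add: \<psi>)
    let ?f = "\<lambda>n. (real_of_int \<bar>n\<bar> powr p + 1) * (cmod (coord \<psi> n))\<^sup>2"
    let ?g = "\<lambda>n. ((v * t) powr p + 1) * (cmod (coord \<psi> n))\<^sup>2 + B\<^sup>2 * (1 / (real_of_int n)\<^sup>2)"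
    have le: "?f n \<le> ?g n" for n
    proof (cases "real_of_int \<bar>n\<bar> \<le> v * t")
      case True
      then have "real_of_int \<bar>n\<bar> powr p \<le> (v * t) powr p"
        using p by (intro powr_mono2) auto
      then have "?f n \<le> ((v * t) powr p + 1) * (cmod (coord \<psi> n))\<^sup>2"
        by (intro mult_right_mono) auto
      then show ?thesis by (intro order_trans[OF _ add_increasing2[OF _ order_refl]]) simp_all
    next
      case False
      show ?thesis
      proof (cases "n = 0")
        case False
        let ?n = "\<bar>real_of_int n\<bar>"
        have n1: "1 \<le> ?n" using False by linarith
        have "cmod (coord \<psi> n) \<le> B / ?n ^ N"
          using B(2)[of t n] t False \<open>\<not> real_of_int \<bar>n\<bar> \<le> v * t\<close> by (simp add: \<psi>)
        then have "(cmod (coord \<psi> n))\<^sup>2 \<le> (B / ?n ^ N)\<^sup>2" by (intro power_mono) auto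
        also have "\<dots> = B\<^sup>2 / ?n powr (2 * real N)"
        proof -
          have "?n powr (2 * real N) = (?n ^ N)\<^sup>2"
            using n1 powr_realpow[of ?n "2 * N"] by (simp add: power_mult[symmetric] mult.commute)
          then show ?thesis by (simp only: power_divide)
        qed
        finally have "?n powr p * (cmod (coord \<psi> n))\<^sup>2 \<le> ?n powr p * (B\<^sup>2 / ?n powr (2 * real N))"
          by (intro mult_left_mono) auto
        also have "\<dots> = B\<^sup>2 * ?n powr (p - 2 * real N)" by (simp add: powr_diff)
        also have "\<dots> \<le> B\<^sup>2 * ?n powr (- 2)"
          using N(2) n1 by (intro mult_left_mono powr_mono) auto
        also have "\<dots> = B\<^sup>2 * (1 / (real_of_int n)\<^sup>2)"
          using n1 by (simp add: powr_minus_divide)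
        finally have "?n powr p * (cmod (coord \<psi> n))\<^sup>2 \<le> B\<^sup>2 * (1 / (real_of_int n)\<^sup>2)" .
        moreover have "0 \<le> (v * t) powr p * (cmod (coord \<psi> n))\<^sup>2" by simp
        ultimately show ?thesis unfolding distrib_right of_int_abs by linarith
      qed (use False v t in auto)
    qed
    have sg: "?g summable_on UNIV"
      by (intro summable_on_add summable_on_cmult_right summable_norm_coord summable_inverse_squares)
    then have sf: "?f summable_on UNIV"
      by (rule summable_on_comparison_test) (use le in auto)
    have "weighted_moment p \<psi> \<le> infsum ?g UNIV"
      unfolding weighted_moment_def by (intro infsum_mono sf sg le)
    also have "\<dots> = ((v * t) powr p + 1) * (norm \<phi>)\<^sup>2 + B\<^sup>2 * Z"
      unfolding Z_def n\<psi>[symmetric] norm_power2_ell2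
      by (simp only: infsum_add summable_on_cmult_right summable_norm_coord summable_inverse_squares infsum_cmult_right')
    also have "\<dots> \<le> (v powr p * t powr p + t powr p) * (norm \<phi>)\<^sup>2 + B\<^sup>2 * Z * t powr p"
    proof (intro add_mono mult_right_mono)
      have t1: "1 \<le> t powr p" using t p by (simp add: ge_one_powr_ge_zero)
      show "(v * t) powr p \<le> v powr p * t powr p" using v t by (simp add: powr_mult)
      show "1 \<le> t powr p" by (rule t1)
      show "B\<^sup>2 * Z \<le> B\<^sup>2 * Z * t powr p"
        using mult_left_mono[OF t1, of "B\<^sup>2 * Z"] Z by simp
    qed simp
    also have "\<dots> = ?B * t powr p" by (simp add: algebra_simps)
    finally show ?thesis using sf by (simp add: has_moment_def)
  qed
  then show ?thesis by blast
qed

text \<open>Interpolation between the second, the fourth and the \<open>p\<close>-th moment: the mass counted by the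
  second moment cannot sit at \<open>x \<le> \<mu> t\<close>, nor, given the fourth moment, at \<open>x \<ge> \<Lambda> t\<close>.\<close>

lemma square_le_interpolation:
  fixes x t \<mu> \<Lambda> p :: real
  assumes "0 \<le> x" "0 < t" "0 < \<mu>" "0 < \<Lambda>" "0 < p"
  shows "x\<^sup>2 \<le> \<mu>\<^sup>2 * t\<^sup>2 + \<Lambda>\<^sup>2 * t\<^sup>2 / (\<mu> * t) powr p * (x powr p + 1) + (x powr 4 + 1) / (\<Lambda>\<^sup>2 * t\<^sup>2)"
    (is "_ \<le> ?a + ?b + ?c")
proof -
  have nonneg: "0 \<le> ?a" "0 \<le> ?b" "0 \<le> ?c" by simp_all
  consider "x \<le> \<mu> * t" | "\<Lambda> * t \<le> x" | "\<mu> * t < x" "x < \<Lambda> * t" by linarith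
  then show ?thesis
  proof cases
    case 1
    then have "x\<^sup>2 \<le> (\<mu> * t)\<^sup>2" using assms by (intro power_mono) auto
    then have "x\<^sup>2 \<le> ?a" by (simp add: power_mult_distrib)
    then show ?thesis using nonneg by linarith
  next
    case 2
    have x: "0 < x" using 2 assms by (meson less_le_trans mult_pos_pos)
    have "(\<Lambda> * t)\<^sup>2 \<le> x\<^sup>2" using 2 assms by (intro power_mono) auto
    then have "x\<^sup>2 * (\<Lambda> * t)\<^sup>2 \<le> x\<^sup>2 * x\<^sup>2" by (intro mult_left_mono) auto
    also have "\<dots> = x powr 4" using x by (simp add: powr_numeral power_add[symmetric])
    finally have "x\<^sup>2 \<le> x powr 4 / (\<Lambda>\<^sup>2 * t\<^sup>2)"
      using assms by (simp add: pos_le_divide_eq power_mult_distrib)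
    also have "\<dots> \<le> ?c" by (intro divide_right_mono) auto
    finally show ?thesis using nonneg by linarith
  next
    case 3
    have "x\<^sup>2 \<le> (\<Lambda> * t)\<^sup>2" using 3 assms by (intro power_mono) auto
    also have "\<dots> \<le> ?b"
    proof -
      have "(\<mu> * t) powr p \<le> x powr p + 1"
        using 3 assms powr_mono2[of p "\<mu> * t" x] by simp
      moreover have "0 < (\<mu> * t) powr p" using assms by simp
      ultimately have "1 \<le> (x powr p + 1) / (\<mu> * t) powr p" by simp
      then have "(\<Lambda> * t)\<^sup>2 * 1 \<le> (\<Lambda> * t)\<^sup>2 * ((x powr p + 1) / (\<mu> * t) powr p)"
        by (intro mult_left_mono) auto
      then show ?thesis by (simp add: power_mult_distrib)
    qed
    finally show ?thesis using nonneg by linarith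
  qed
qed

text \<open>The pointwise interpolation is summed against \<psi>. The hypotheses on \<mu> and
  \<Lambda> limit the near and the far mass to a quarter of \<open>c * t\<^sup>2\<close> each, so
  half of it is left for the \<open>p\<close>-th moment.\<close>

lemma weighted_moment_lower_bound:
  assumes \<psi>: "\<psi> \<in> position_dom" "has_moment p \<psi>" "has_moment 4 \<psi>"
    and pos: "0 < t" "0 < \<mu>" "0 < \<Lambda>" "0 < p"
    and c: "c * t\<^sup>2 \<le> (norm (position \<psi>))\<^sup>2" and \<mu>: "\<mu>\<^sup>2 * (norm \<psi>)\<^sup>2 \<le> c / 4"
    and \<Lambda>: "weighted_moment 4 \<psi> \<le> c / 4 * \<Lambda>\<^sup>2 * t powr 4"
  shows "c / 2 * \<mu> powr p / \<Lambda>\<^sup>2 * t powr p \<le> weighted_moment p \<psi>"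
proof -
  let ?w = "\<lambda>n. (cmod (coord \<psi> n))\<^sup>2"
  let ?K = "\<Lambda>\<^sup>2 * t\<^sup>2 / (\<mu> * t) powr p"
  let ?g = "\<lambda>n. \<mu>\<^sup>2 * t\<^sup>2 * ?w n + ?K * ((real_of_int \<bar>n\<bar> powr p + 1) * ?w n)
      + 1 / (\<Lambda>\<^sup>2 * t\<^sup>2) * ((real_of_int \<bar>n\<bar> powr 4 + 1) * ?w n)"
  have sp: "(\<lambda>n. (real_of_int \<bar>n\<bar> powr p + 1) * ?w n) summable_on UNIV"
    and s4: "(\<lambda>n. (real_of_int \<bar>n\<bar> powr 4 + 1) * ?w n) summable_on UNIV"
    using \<psi> by (simp_all add: has_moment_def)
  have sg: "?g summable_on UNIV"
    by (intro summable_on_add summable_on_cmult_right summable_norm_coord sp s4)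
  have "c * t\<^sup>2 \<le> (\<Sum>\<^sub>\<infinity>n. (cmod (coord (position \<psi>) n))\<^sup>2)"
    using c by (simp add: norm_power2_ell2)
  also have "\<dots> \<le> infsum ?g UNIV"
  proof (intro infsum_mono summable_norm_coord sg)
    fix n :: int
    have "(cmod (coord (position \<psi>) n))\<^sup>2 = (real_of_int \<bar>n\<bar>)\<^sup>2 * ?w n"
      by (simp add: coord_position[OF \<psi>(1)] norm_mult power_mult_distrib)
    also have "\<dots> \<le> (\<mu>\<^sup>2 * t\<^sup>2 + ?K * (real_of_int \<bar>n\<bar> powr p + 1)
        + (real_of_int \<bar>n\<bar> powr 4 + 1) / (\<Lambda>\<^sup>2 * t\<^sup>2)) * ?w n"
      using pos by (intro mult_right_mono square_le_interpolation) auto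
    also have "\<dots> = ?g n" by (simp add: algebra_simps add_divide_distrib)
    finally show "(cmod (coord (position \<psi>) n))\<^sup>2 \<le> ?g n" .
  qed
  also have "\<dots> = \<mu>\<^sup>2 * t\<^sup>2 * (norm \<psi>)\<^sup>2 + ?K * weighted_moment p \<psi>
      + 1 / (\<Lambda>\<^sup>2 * t\<^sup>2) * weighted_moment 4 \<psi>"
    unfolding norm_power2_ell2 weighted_moment_def
    by (simp only: infsum_add summable_on_add summable_on_cmult_right summable_norm_coord sp s4 infsum_cmult_right')
  also have "\<dots> \<le> c / 4 * t\<^sup>2 + ?K * weighted_moment p \<psi> + c / 4 * t\<^sup>2"
  proof (intro add_mono order_refl)
    show "\<mu>\<^sup>2 * t\<^sup>2 * (norm \<psi>)\<^sup>2 \<le> c / 4 * t\<^sup>2"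
      using mult_right_mono[OF \<mu>, of "t\<^sup>2"] by (simp add: algebra_simps)
    have "1 / (\<Lambda>\<^sup>2 * t\<^sup>2) * weighted_moment 4 \<psi> \<le> 1 / (\<Lambda>\<^sup>2 * t\<^sup>2) * (c / 4 * \<Lambda>\<^sup>2 * t powr 4)"
      by (intro mult_left_mono \<Lambda>) simp
    also have "\<dots> = c / 4 * t\<^sup>2"
      using pos by (simp add: powr_numeral power2_eq_square power4_eq_xxxx)
    finally show "1 / (\<Lambda>\<^sup>2 * t\<^sup>2) * weighted_moment 4 \<psi> \<le> c / 4 * t\<^sup>2" .
  qed
  finally have "c / 2 * t\<^sup>2 \<le> ?K * weighted_moment p \<psi>" by linarith
  then have "c / 2 * t\<^sup>2 * ((\<mu> * t) powr p / (\<Lambda>\<^sup>2 * t\<^sup>2)) \<le> ?K * weighted_moment p \<psi> * ((\<mu> * t) powr p / (\<Lambda>\<^sup>2 * t\<^sup>2))"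
    by (intro mult_right_mono) auto
  then show ?thesis
    using pos by (simp add: powr_mult field_simps)
qed

lemma beta_eq_1:
  assumes J: "jacobi_coeffs a b" and \<phi>: "\<phi> \<in> schwartz" and p: "p > 0"
    and lim: "((\<lambda>t. (1 / t) *\<^sub>R heisenberg (jacobi a b) t \<phi>) \<longlongrightarrow> l) at_top" and l: "l \<noteq> 0"
  shows "beta_plus (jacobi a b) \<phi> p = 1 \<and> beta_minus (jacobi a b) \<phi> p = 1"
proof -
  let ?\<psi> = "\<lambda>t. app (exp (- (t *\<^sub>R (iop * jac a b)))) \<phi>"
  let ?m = "\<lambda>t. weighted_moment p (?\<psi> t)"
  have op: "op_exp (- \<i> * of_real t) (jacobi a b) \<phi> = ?\<psi> t" for t
    using op_exp_jacobi[OF J, of "- t" \<phi>] by simp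
  have unitary: "norm (?\<psi> t) = norm \<phi>" for t
    using norm_app_exp_skew[OF adjoint_pair_iop_jac[OF J], of "- t" \<phi>] by simp
  have dom: "?\<psi> t \<in> position_dom" for t
    using op_exp_jacobi_position_dom[OF J schwartz_position_dom[OF \<phi>]] op by metis
  have heis: "norm (heisenberg (jacobi a b) t \<phi>) = norm (position (?\<psi> t))" for t
    unfolding heisenberg_def op op_exp_jacobi[OF J]
    by (rule norm_app_exp_skew[OF adjoint_pair_iop_jac[OF J]])
  define c where "c = (norm l)\<^sup>2 / 4"
  have c: "0 < c" using l by (simp add: c_def)
  have "\<phi> \<noteq> 0"
  proof
    assume "\<phi> = 0"
    then have "?\<psi> t = 0" for t by (simp add: app.zero_right)
    moreover have "position 0 = 0" by (auto simp: position_def intro!: ell2_eqI simp: coord_Ell2 square_summable_0)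
    ultimately have "heisenberg (jacobi a b) t \<phi> = 0" for t
      using heis[of t] by simp
    with lim have "((\<lambda>t::real. 0) \<longlongrightarrow> l) at_top" by simp
    with l show False using tendsto_unique[OF _ tendsto_const] by force
  qed
  have "((\<lambda>t. norm ((1 / t) *\<^sub>R heisenberg (jacobi a b) t \<phi>)) \<longlongrightarrow> norm l) at_top"
    by (intro tendsto_norm lim)
  then have "\<forall>\<^sub>F t in at_top. norm l / 2 < norm ((1 / t) *\<^sub>R heisenberg (jacobi a b) t \<phi>)"
    using l by (intro order_tendstoD) auto
  then have low: "\<forall>\<^sub>F t in at_top. c * t\<^sup>2 \<le> (norm (position (?\<psi> t)))\<^sup>2"
    using eventually_gt_at_top[of 0]
  proof eventually_elim
    case (elim t)
    then have "norm l / 2 * t \<le> norm (position (?\<psi> t))"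
      by (simp add: heis field_simps)
    then have "(norm l / 2 * t)\<^sup>2 \<le> (norm (position (?\<psi> t)))\<^sup>2"
      using elim by (intro power_mono) auto
    then show ?case by (simp add: c_def power_mult_distrib power_divide)
  qed
  obtain B where B: "\<And>t. t \<ge> 1 \<Longrightarrow> has_moment p (?\<psi> t) \<and> ?m t \<le> B * t powr p"
    using moment_upper_bound[OF J \<phi> p] by blast
  obtain B4 where B4: "\<And>t. t \<ge> 1 \<Longrightarrow> has_moment 4 (?\<psi> t) \<and> weighted_moment 4 (?\<psi> t) \<le> B4 * t powr 4"
    using moment_upper_bound[OF J \<phi>, of 4] by auto
  \<comment> \<open>\<Lambda> and \<mu> are solved from the two shares \<open>c / 4\<close> in
    \<open>weighted_moment_lower_bound\<close>; adding 1 to \<open>\<bar>B4\<bar>\<close> keeps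
    \<Lambda> positive.\<close>
  define \<Lambda> where "\<Lambda> = sqrt (4 * (\<bar>B4\<bar> + 1) / c)"
  have \<Lambda>: "0 < \<Lambda>" "B4 \<le> c / 4 * \<Lambda>\<^sup>2" using c by (simp_all add: \<Lambda>_def)
  define \<mu> where "\<mu> = sqrt (c / 4) / norm \<phi>"
  have \<mu>: "0 < \<mu>" "\<mu>\<^sup>2 * (norm \<phi>)\<^sup>2 \<le> c / 4"
    using c \<open>\<phi> \<noteq> 0\<close> by (simp_all add: \<mu>_def power_divide)
  define b' where "b' = c / 2 * \<mu> powr p / \<Lambda>\<^sup>2"
  have b': "0 < b'" using c \<Lambda> \<mu> by (simp add: b'_def)
  have lower: "\<forall>\<^sub>F t in at_top. b' * t powr p \<le> ?m t"
    using low eventually_ge_at_top[of 1]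
  proof eventually_elim
    case (elim t)
    have "weighted_moment 4 (?\<psi> t) \<le> B4 * t powr 4" using B4[OF elim(2)] by simp
    also have "\<dots> \<le> c / 4 * \<Lambda>\<^sup>2 * t powr 4" by (intro mult_right_mono \<Lambda>) simp
    finally show ?case
      unfolding b'_def using elim dom B[OF elim(2)] B4[OF elim(2)] \<Lambda>(1) \<mu> p
      by (intro weighted_moment_lower_bound) (auto simp: unitary)
  qed
  have lnB: "((\<lambda>t. ln d / (p * ln t) + 1) \<longlongrightarrow> 1) at_top" for d :: real
  proof -
    have "LIM t at_top. p * ln t :> at_top"
      using p by (intro filterlim_tendsto_pos_mult_at_top[OF tendsto_const] ln_at_top)
    then have "((\<lambda>t. ln d / (p * ln t)) \<longlongrightarrow> 0) at_top"
      by (intro tendsto_divide_0[OF tendsto_const] filterlim_at_top_imp_at_infinity)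
    from tendsto_add[OF this tendsto_const[of 1]] show ?thesis by simp
  qed
  have "((\<lambda>t. ln (?m t) / (p * ln t)) \<longlongrightarrow> 1) at_top"
  proof (rule tendsto_sandwich)
    have bounds: "\<forall>\<^sub>F t in at_top. ln b' / (p * ln t) + 1 \<le> ln (?m t) / (p * ln t) \<and>
        ln (?m t) / (p * ln t) \<le> ln (max B 1) / (p * ln t) + 1"
      using lower eventually_gt_at_top[of 1]
    proof eventually_elim
      case (elim t)
      have pl: "0 < p * ln t" using elim p by simp
      have tp: "0 < t powr p" using elim by simp
      have m0: "0 < ?m t" using elim(1) b' tp by (meson less_le_trans mult_pos_pos)
      have "ln (b' * t powr p) \<le> ln (?m t)" using elim(1) b' tp m0 by (subst ln_le_cancel_iff) auto
      then have 1: "ln b' + p * ln t \<le> ln (?m t)" using b' elim by (simp add: ln_mult ln_powr)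
      have "?m t \<le> max B 1 * t powr p"
      proof -
        have "B * t powr p \<le> max B 1 * t powr p" by (intro mult_right_mono) auto
        then show ?thesis using B[of t] elim(2) by linarith
      qed
      then have "ln (?m t) \<le> ln (max B 1 * t powr p)" using m0 tp by (subst ln_le_cancel_iff) auto
      also have "\<dots> = ln (max B 1) + p * ln t" using elim by (subst ln_mult) (auto simp: ln_powr)
      finally have 2: "ln (?m t) \<le> ln (max B 1) + p * ln t" .
      have e: "ln d / (p * ln t) + 1 = (ln d + p * ln t) / (p * ln t)" for d
        using pl unfolding add_divide_distrib by (metis divide_self less_irrefl)
      show ?case unfolding e using 1 2 pl by (intro conjI divide_right_mono) auto
    qed
    then show "\<forall>\<^sub>F t in at_top. ln b' / (p * ln t) + 1 \<le> ln (?m t) / (p * ln t)"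
      by (rule eventually_mono) simp
    from bounds show "\<forall>\<^sub>F t in at_top. ln (?m t) / (p * ln t) \<le> ln (max B 1) / (p * ln t) + 1"
      by (rule eventually_mono) simp
  qed (rule lnB)+
  then have "((\<lambda>t. ereal (ln (moment (jacobi a b) p \<phi> t) / (p * ln t))) \<longlongrightarrow> ereal 1) at_top"
    unfolding moment_eq[OF J] by (intro tendsto_intros)
  then show ?thesis
    unfolding beta_plus_def beta_minus_def one_ereal_def
    by (auto intro!: lim_imp_Limsup lim_imp_Liminf)
qed

theorem theorem1p1:
  fixes R :: real
  assumes "R > 0"
  shows "\<exists>\<eta>\<^sub>0>0. \<forall>J. J \<in> EC \<eta>\<^sub>0 \<and> J \<in> jacobi_class R \<longrightarrow>
     (\<exists>D Q. selfadjoint_on D Q \<and> position_dom \<subseteq> D \<and>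
        (\<forall>\<phi>\<in>position_dom.
           ((\<lambda>t. norm ((1 / t) *\<^sub>R heisenberg J t \<phi> - Q \<phi>)) \<longlongrightarrow> 0) at_top) \<and>
        {\<phi>\<in>D. Q \<phi> = 0} \<inter> ell1 = {0}) \<and>
     (\<forall>\<phi>\<in>schwartz. \<phi> \<noteq> 0 \<longrightarrow>
        (\<forall>p>0. beta_plus J \<phi> p = 1 \<and> beta_minus J \<phi> p = 1))"
proof -
  \<comment> \<open>For \<open>R < 1\<close> the class is empty, but \<eta>0 must be positive all
    the same; enlarging \<open>R\<close> ensures \<open>C > 1\<close>.\<close>
  define S where "S = max R 1"
  define C where "C = 4 * S * (14 * S + 1)"
  have S: "R \<le> S" "1 \<le> S" by (auto simp: S_def)
  have "1 * 1 \<le> S * (14 * S + 1)" using S by (intro mult_mono) simp_all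
  then have C: "1 < C" unfolding C_def by simp
  show ?thesis
  \<comment> \<open>With this value, \<open>exp (\<eta>\<^sub>0 * q (Suc n))\<close> is
    \<open>C ^ (14 * q (Suc n))\<close>, the accuracy that \<open>scale_estimates\<close> asks
    for.\<close>
  proof (intro exI[of _ "14 * ln C"] conjI allI impI; (elim conjE)?)
    show "14 * ln C > 0" using C by simp
  next
    fix J assume EC: "J \<in> EC (14 * ln C)" and cl: "J \<in> jacobi_class R"
    obtain a b where J: "jacobi_coeffs a b" and Jab: "J = jacobi a b"
      and R: "onorm J \<le> R" "(INF n. a n) \<ge> inverse R"
      using cl unfolding jacobi_class_def by blast
    obtain q P where P: "\<And>n::nat. periodic_jacobi (q n) (P n)"
      and lim: "(\<lambda>n. exp (14 * ln C * real (q (Suc n))) * onorm (\<lambda>\<phi>. J \<phi> - P n \<phi>)) \<longlonglongrightarrow> 0"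
      and dvd: "\<And>n. q n dvd q (Suc n) \<and> q n \<noteq> q (Suc n)"
      using EC unfolding EC_def by blast
    have q0: "q n > 0" for n using P[of n] by (simp add: periodic_jacobi_def)
    have q1: "q n < q (Suc n)" for n
      using dvd[of n] q0[of "Suc n"] by (meson dvd_imp_le le_neq_implies_less)
    have "\<forall>n. \<exists>a' b'. jacobi_coeffs a' b' \<and> P n = jacobi a' b' \<and>
        (\<forall>k. a' (k + int (q n)) = a' k \<and> b' (k + int (q n)) = b' k)"
      using P by (simp add: periodic_jacobi_def)
    then obtain a' b' where ab': "\<And>n. jacobi_coeffs (a' n) (b' n)" "\<And>n. P n = jacobi (a' n) (b' n)"
      "\<And>n k. a' n (k + int (q n)) = a' n k" "\<And>n k. b' n (k + int (q n)) = b' n k"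
      by metis
    have nJ: "norm (jac a b) \<le> S" using R(1) S(1) by (simp add: norm_bop_eq_onorm app_jac[OF J] Jab)
    have aS: "1 / S \<le> a n" for n
    proof -
      have "bdd_below (range a)"
        using jacobi_coeffs_bounded(1)[OF J] by (rule bounded_imp_bdd_below)
      then have "(INF n. a n) \<le> a n" by (intro cINF_lower) auto
      moreover have "1 / S \<le> inverse R"
        using S assms by (simp add: divide_inverse le_imp_inverse_le)
      ultimately show ?thesis using R(2) by linarith
    qed
    have eps: "\<forall>\<^sub>F n in sequentially. norm (jac a b - jac (a' n) (b' n)) \<le> 1 / C ^ (14 * q (Suc n))"
    proof -
      have "\<forall>\<^sub>F n in sequentially. exp (14 * ln C * real (q (Suc n))) * onorm (\<lambda>\<phi>. J \<phi> - P n \<phi>) < 1"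
        using lim by (rule order_tendstoD) simp
      then show ?thesis
      proof eventually_elim
        case (elim n)
        have "exp (14 * ln C * real (q (Suc n))) = exp (real (14 * q (Suc n)) * ln C)" by (simp add: mult_ac)
        also have "\<dots> = C ^ (14 * q (Suc n))" using C by (subst exp_of_nat_mult) simp
        finally have e: "exp (14 * ln C * real (q (Suc n))) = C ^ (14 * q (Suc n))" .
        have "app (jac a b - jac (a' n) (b' n)) = (\<lambda>\<phi>. J \<phi> - P n \<phi>)"
          by (rule ext) (simp add: app_jac J ab' Jab)
        with elim have "C ^ (14 * q (Suc n)) * norm (jac a b - jac (a' n) (b' n)) < 1"
          by (simp add: norm_bop_eq_onorm e)
        then show ?case using C by (simp add: field_simps)
      qed
    qed
    have ell1: "\<exists>l. ((\<lambda>t. app (mean a b t) \<phi>) \<longlongrightarrow> l) at_top \<and> (\<phi> \<noteq> 0 \<longrightarrow> l \<noteq> 0)" if "\<phi> \<in> ell1" for \<phi>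
      by (rule mean_converges_ell1[where R = S and a = a and b = b and q = q and a' = a' and b' = b'])
        (use J ab' q0 q1 nJ aS S eps that in \<open>simp_all add: C_def\<close>)
    have vel: "((\<lambda>t. app (mean a b t) \<phi>) \<longlongrightarrow> velocity a b \<phi>) at_top" for \<phi>
    proof -
      have "\<exists>l. ((\<lambda>t. app (mean a b t) \<phi>) \<longlongrightarrow> l) at_top"
      proof (rule mean_converges[OF J])
        fix \<phi> assume "\<phi> \<in> ell1"
        from ell1[OF this] show "\<exists>l. ((\<lambda>t. app (mean a b t) \<phi>) \<longlongrightarrow> l) at_top" by (elim exE conjE exI)
      qed
      then obtain l where l: "((\<lambda>t. app (mean a b t) \<phi>) \<longlongrightarrow> l) at_top" ..
      then have "velocity a b \<phi> = l" unfolding velocity_def by (intro tendsto_Lim) simp_all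
      with l show ?thesis by simp
    qed
    have vel_nz: "velocity a b \<phi> \<noteq> 0" if nz: "\<phi> \<in> ell1" "\<phi> \<noteq> 0" for \<phi>
    proof -
      obtain l where "((\<lambda>t. app (mean a b t) \<phi>) \<longlongrightarrow> l) at_top" "l \<noteq> 0"
        using ell1[OF nz(1)] nz(2) by (elim exE conjE) simp
      moreover from tendsto_unique[OF trivial_limit_at_top_linorder vel[of \<phi>] this(1)]
      have "velocity a b \<phi> = l" .
      ultimately show ?thesis by simp
    qed
    note heis = heisenberg_tendsto[OF J _ vel, folded Jab]
    have "(0::ell2) \<in> ell1" by (simp add: ell1_def)
    moreover have "velocity a b 0 = 0"
      using vel[of 0] by (intro tendsto_unique[OF trivial_limit_at_top_linorder vel[of 0]])
        (simp add: app.zero_right)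
    ultimately have ker: "{\<phi> \<in> UNIV. velocity a b \<phi> = 0} \<inter> ell1 = {0}"
      using vel_nz by auto
    show "\<exists>D Q. selfadjoint_on D Q \<and> position_dom \<subseteq> D \<and>
        (\<forall>\<phi>\<in>position_dom.
           ((\<lambda>t. norm ((1 / t) *\<^sub>R heisenberg J t \<phi> - Q \<phi>)) \<longlongrightarrow> 0) at_top) \<and>
        {\<phi>\<in>D. Q \<phi> = 0} \<inter> ell1 = {0}"
    proof (intro exI[of _ UNIV] exI[of _ "velocity a b"] conjI ballI)
      show "selfadjoint_on UNIV (velocity a b)" by (rule selfadjoint_velocity[OF J vel])
      show "((\<lambda>t. norm ((1 / t) *\<^sub>R heisenberg J t \<phi> - velocity a b \<phi>)) \<longlongrightarrow> 0) at_top"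
        if "\<phi> \<in> position_dom" for \<phi>
        by (intro tendsto_norm_zero LIM_zero heis that)
    qed (use ker in auto)
    show "\<forall>\<phi>\<in>schwartz. \<phi> \<noteq> 0 \<longrightarrow> (\<forall>p>0. beta_plus J \<phi> p = 1 \<and> beta_minus J \<phi> p = 1)"
    proof (intro ballI impI allI)
      fix \<phi> and p :: real assume \<phi>: "\<phi> \<in> schwartz" "\<phi> \<noteq> 0" and p: "p > 0"
      show "beta_plus J \<phi> p = 1 \<and> beta_minus J \<phi> p = 1"
        unfolding Jab
        by (rule beta_eq_1[OF J \<phi>(1) p heis[OF schwartz_position_dom[OF \<phi>(1)], unfolded Jab]
              vel_nz[OF schwartz_ell1[OF \<phi>(1)] \<phi>(2)]])
    qed
  qed
qed

end
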